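(* Let $\mathfrak{P}=\{\mathbb{F}_1,\ldots,\mathbb{F}_n\}$ be a system of generic sparse linear differential polynomials as described in the context, satisfying $(\mathcal{P}1)$ and $(\mathcal{P}4)$. If $\mathfrak{P}$ is super essential, then there exist a linear perturbation $\varepsilon$ (with $\partial\mathrm{FRes}(\mathfrak{P}_\varepsilon)\neq0$, so that $A_\varepsilon(\mathfrak{P})$ is defined) and a nonzero $\alpha\in\mathcal{K}$ such that $\alpha\,\partial\mathrm{Res}(\mathfrak{P})=A_\varepsilon(\mathfrak{P})$.
   Context: Generic sparse system: let $n\ge2$, $U=\{u_1,\ldots,u_{n-1}\}$, $u_{j,k}=\partial^ku_j$. For $i=1,\ldots,n$, $j=1,\ldots,n-1$ let $\mathfrak{S}_{i,j}\subset\mathbb{N}_0$ be finite sets and $\mathcal{G}_{i,j}=\sum_{k\in\mathfrak{S}_{i,j}}c_{i,j,k}\partial^k$ ($\mathcal{G}_{i,j}=0$ if $\mathfrak{S}_{i,j}=\emptyset$), where $\overline{C}=\{c_{i,j,k}\}$ is a set of differential indeterminates over $\mathbb{Q}$ ($\mathbb{Q}$ a field of constants). Let $\mathcal{K}=\mathbb{Q}\langle\overline{C}\rangle$ be the differential field extension of $\mathbb Q$ by $\overline C$, $C=\{c_1,\ldots,c_n\}$ differential indeterminates over $\mathcal{K}$, $\mathbb{D}=\mathcal{K}\{C\}$, and $\mathbb{F}_i=c_i+\sum_{j=1}^{n-1}\mathcal{G}_{i,j}(u_j)$, $\mathfrak{P}=\{\mathbb{F}_1,\ldots,\mathbb{F}_n\}\subset\mathbb{D}\{U\}$.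 Assumptions: $(\mathcal{P}1)$ the order of $\mathbb{F}_i$ in $U$ is $o_i\ge0$ for every $i$; $(\mathcal{P}4)$ for every $j$ there is $i$ with $\mathcal{G}_{i,j}\neq0$. Super essential (resp. differentially essential): for every (resp. for some) $i\in\{1,\ldots,n\}$ there is a permutation $\tau_i$ of $\{1,\ldots,n-1\}$ such that $\mathcal{G}_{j,\tau_i(n-j)}\neq 0$ for $j=1,\ldots,i-1$ and $\mathcal{G}_{j,\tau_i(n-j+1)}\neq 0$ for $j=i+1,\ldots,n$. Sparse linear differential resultant: let $\mathrm{ID}(\mathfrak{P})=[\mathfrak{P}]_{\mathbb{D}\{U\}}\cap\mathbb{D}$, where $[\cdot]$ denotes generated differential ideal. If $\mathfrak{P}$ is differentially essential (in particular if it is super essential), $\mathrm{ID}(\mathfrak{P})$ is a differential prime ideal of differential dimension $n-1$ and $\mathrm{ID}(\mathfrak{P})=\mathrm{sat}(R)$, the saturation ideal of an irreducible differential polynomial $R\in\mathbb{D}$, unique up to scaling, which (clearing denominators) may be taken in $\mathbb{Q}\{\overline{C},C\}$; $\partial\mathrm{Res}(\mathfrak{P}):=R$. Formula $\partial\mathrm{FRes}$: for a nonzero operator $\mathcal{L}=\sum_k\alpha_k\partial^k$ let $\deg$ and $\mathrm{ldeg}$ be the largest and smallest $k$ with $\alpha_k\neq0$. For a system $\mathcal{P}=\{c_i+\sum_j\mathcal{L}_{i,j}(u_j)\mid i=1,\dots,n\}$ with orders $o_i$ in $U$, put $\overline{\gamma}_j=\min\{o_i-\deg(\mathcal{L}_{i,j})\mid\mathcal{L}_{i,j}\neq0,\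 i=1,\ldots,n\}$, $\underline{\gamma}_j=\min\{\mathrm{ldeg}(\mathcal{L}_{i,j})\mid\mathcal{L}_{i,j}\neq0,\ i=1,\ldots,n\}$, $\gamma=\sum_{j}(\underline{\gamma}_j+\overline{\gamma}_j)$, $N=\sum_io_i$. If $N-o_i-\gamma\ge0$ for all $i$, let $\mathrm{ps}(\mathcal{P})$ be the set of derivatives of order $k$, $0\le k\le N-o_i-\gamma$, of the $i$-th polynomial, $i=1,\ldots,n$, which has $L=\sum_i(N-o_i-\gamma+1)$ elements, and $\mathcal{V}=\{u_{j,k}\mid\underline{\gamma}_j\le k\le N-\overline{\gamma}_j-\gamma,\ j=1,\ldots,n-1\}$, which has $L-1$ elements. $\mathcal{M}(\mathcal{P})$ is the $L\times L$ coefficient matrix of $\mathrm{ps}(\mathcal{P})$ as polynomials in the variables $\mathcal{V}$ (last column: terms $\partial^kc_i$ free of $\mathcal{V}$), and $\partial\mathrm{FRes}(\mathcal{P})=\det\mathcal{M}(\mathcal{P})$. Perturbation: $p$ is an algebraic indeterminate over $\mathcal{K}$ with $\partial(p)=0$. A linear perturbation is a family $\varepsilon=(\varepsilon_1(U),\ldots,\varepsilon_n(U))$ of linear differential polynomials in $\mathcal{K}\{U\}$, and $\mathfrak{P}_\varepsilon=\{\mathbb{F}_i-p\,\varepsilon_i(U)\mid i=1,\ldots,n\}$, a system over $\mathcal{K}\langle p\rangle$. $A_\varepsilon(\mathfrak{P})$: a nonzero linear differential polynomial $B\in\mathrm{ID}(\mathfrak{P})$ can be written uniquely $B=\sum_{i=1}^n\mathcal{F}_i(c_i)$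 with $\mathcal{F}_i\in\mathcal{K}[\partial]$; if $\mathcal{D}$ is a greatest common left divisor of $\mathcal{F}_1,\ldots,\mathcal{F}_n$ and $\mathcal{F}_i=\mathcal{D}\mathcal{L}_i$ with $\mathcal{L}_i\in\mathcal{K}[\partial]$, then $\sum_i\mathcal{L}_i(c_i)$ is called an $\mathrm{ID}$-primitive part of $B$. For $\varepsilon$ with $\partial\mathrm{FRes}(\mathfrak{P}_\varepsilon)$ a nonzero element of $\mathcal{K}[p]\{C\}$, let $D_\varepsilon$ be its lowest degree in $p$ and $A_{D_\varepsilon}$ the coefficient of $p^{D_\varepsilon}$ in it (a nonzero linear differential polynomial in $\mathrm{ID}(\mathfrak{P})$); $A_\varepsilon(\mathfrak{P})$ denotes an $\mathrm{ID}$-primitive part of $A_{D_\varepsilon}$. *)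

theory Defs
  imports
    "HOL-Library.Poly_Mapping"
    "HOL-Computational_Algebra.Polynomial"
    "HOL-Combinatorics.Permutations"
    "Jordan_Normal_Form.Determinant"
begin

section \<open>Polynomials in arbitrarily many variables\<close>

type_synonym ('v, 'a) mpol = "('v \<Rightarrow>\<^sub>0 nat) \<Rightarrow>\<^sub>0 'a"

definition vars :: "('v, 'a::zero) mpol \<Rightarrow> 'v set" where
  "vars f = (\<Union>t\<in>Poly_Mapping.keys f. Poly_Mapping.keys t)"

definition Const :: "'a::zero \<Rightarrow> ('v, 'a) mpol" where
  "Const a = Poly_Mapping.single 0 a"

definition Var :: "'v \<Rightarrow> ('v, 'a::zero_neq_one) mpol" where
  "Var v = Poly_Mapping.single (Poly_Mapping.single v 1) 1"

text \<open>The coefficient of the monomial \<open>m\<close> (supported in \<open>W\<close>) when \<open>f\<close> is regarded as a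
  polynomial in the variables \<open>W\<close>; it is a polynomial in the variables outside \<open>W\<close>.\<close>

definition coeff_in :: "'v set \<Rightarrow> ('v \<Rightarrow>\<^sub>0 nat) \<Rightarrow> ('v, 'a::comm_monoid_add) mpol \<Rightarrow> ('v, 'a) mpol" where
  "coeff_in W m f =
     (\<Sum>t | t \<in> Poly_Mapping.keys f \<and>
           (\<forall>v\<in>W. Poly_Mapping.lookup t v = Poly_Mapping.lookup m v).
        Poly_Mapping.single (t - m) (Poly_Mapping.lookup f t))"

definition partial_deriv :: "'v \<Rightarrow> ('v, 'a::comm_semiring_1) mpol \<Rightarrow> ('v, 'a) mpol" where
  "partial_deriv v f =
     (\<Sum>t\<in>Poly_Mapping.keys f.
        Poly_Mapping.single (t - Poly_Mapping.single v 1)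
          (of_nat (Poly_Mapping.lookup t v) * Poly_Mapping.lookup f t))"

definition eval_rat :: "('v \<Rightarrow> 'k::field_char_0) \<Rightarrow> ('v, rat) mpol \<Rightarrow> 'k" where
  "eval_rat x f =
     (\<Sum>t\<in>Poly_Mapping.keys f. of_rat (Poly_Mapping.lookup f t) *
        (\<Prod>v\<in>Poly_Mapping.keys t. x v ^ Poly_Mapping.lookup t v))"


section \<open>The differential field of coefficients\<close>

definition derivation :: "('a::comm_ring_1 \<Rightarrow> 'a) \<Rightarrow> bool" where
  "derivation d \<longleftrightarrow>
     (\<forall>x y. d (x + y) = d x + d y) \<and> (\<forall>x y. d (x * y) = d x * y + x * d y)"

text \<open>The family \<open>(c x)\<close>, \<open>x \<in> I\<close>, consists of differential indeterminates over the rationals: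
  all derivatives of all its members are algebraically independent.\<close>

definition diff_indeterminates ::
  "('k::field_char_0 \<Rightarrow> 'k) \<Rightarrow> 'x set \<Rightarrow> ('x \<Rightarrow> 'k) \<Rightarrow> bool" where
  "diff_indeterminates d I c \<longleftrightarrow>
     (\<forall>f :: ('x \<times> nat, rat) mpol.
        vars f \<subseteq> I \<times> UNIV \<and> eval_rat (\<lambda>(x, l). (d ^^ l) (c x)) f = 0 \<longrightarrow> f = 0)"

text \<open>The type \<open>'k\<close> is generated by \<open>X\<close> as a differential field (it contains the rationals
  automatically, being of characteristic zero).\<close>

definition diff_field_generated :: "('k::field_char_0 \<Rightarrow> 'k) \<Rightarrow> 'k set \<Rightarrow> bool" where
  "diff_field_generated d X \<longleftrightarrow>
     (\<forall>F. X \<subseteq> F \<and> 0 \<in> F \<and> 1 \<in> F \<and>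
          (\<forall>x\<in>F. \<forall>y\<in>F. x + y \<in> F \<and> x - y \<in> F \<and> x * y \<in> F) \<and>
          (\<forall>x\<in>F. inverse x \<in> F \<and> d x \<in> F) \<longrightarrow> F = UNIV)"


section \<open>Differential polynomials\<close>

text \<open>\<open>CV i k\<close> stands for the \<open>k\<close>-th derivative of \<open>c\<^sub>i\<close> and \<open>UV j k\<close> for \<open>u\<^bsub>j,k\<^esub>\<close>.
  All indices start at 1; the sets \<open>Cvars n\<close> and \<open>Uvars n\<close> single out the variables that
  occur for a given \<open>n\<close>.\<close>

datatype dvar = CV nat nat | UV nat nat

fun dnext :: "dvar \<Rightarrow> dvar" where
  "dnext (CV i k) = CV i (Suc k)"
| "dnext (UV j k) = UV j (Suc k)"

type_synonym 'a dpol = "(dvar, 'a) mpol"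

definition Cvars :: "nat \<Rightarrow> dvar set" where
  "Cvars n = {CV i k | i k. i \<in> {1..n}}"

definition Uvars :: "nat \<Rightarrow> dvar set" where
  "Uvars n = {UV j k | j k. j \<in> {1..n - 1}}"

definition ring_D :: "nat \<Rightarrow> 'a::zero dpol set" where
  "ring_D n = {f. vars f \<subseteq> Cvars n}"

definition ring_DU :: "nat \<Rightarrow> 'a::zero dpol set" where
  "ring_DU n = {f. vars f \<subseteq> Cvars n \<union> Uvars n}"

text \<open>The derivation extending a derivation \<open>d\<close> of the coefficient ring by
  \<open>v \<mapsto> dnext v\<close>.\<close>

definition dd :: "('a::comm_ring_1 \<Rightarrow> 'a) \<Rightarrow> 'a dpol \<Rightarrow> 'a dpol" where
  "dd d f =
     (\<Sum>t\<in>Poly_Mapping.keys f.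
        Poly_Mapping.single t (d (Poly_Mapping.lookup f t)) +
        (\<Sum>v\<in>Poly_Mapping.keys t.
           Poly_Mapping.single
             (t - Poly_Mapping.single v 1 + Poly_Mapping.single (dnext v) 1)
             (of_nat (Poly_Mapping.lookup t v) * Poly_Mapping.lookup f t)))"

definition diff_ideal ::
  "('a::comm_ring_1 \<Rightarrow> 'a) \<Rightarrow> 'a dpol set \<Rightarrow> 'a dpol set \<Rightarrow> bool" where
  "diff_ideal d A I \<longleftrightarrow>
     I \<subseteq> A \<and> 0 \<in> I \<and> (\<forall>f\<in>I. \<forall>g\<in>I. f + g \<in> I) \<and>
     (\<forall>a\<in>A. \<forall>f\<in>I. a * f \<in> I) \<and> (\<forall>f\<in>I. dd d f \<in> I)"

definition diff_ideal_gen ::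
  "('a::comm_ring_1 \<Rightarrow> 'a) \<Rightarrow> 'a dpol set \<Rightarrow> 'a dpol set \<Rightarrow> 'a dpol set" where
  "diff_ideal_gen d A X = \<Inter>{I. diff_ideal d A I \<and> X \<subseteq> I}"


section \<open>Linear differential operators\<close>

text \<open>An element \<open>\<Sum>\<^sub>k \<alpha>\<^sub>k \<partial>\<^sup>k\<close> of \<open>\<K>[\<partial>]\<close> is stored as the polynomial with coefficients
  \<open>\<alpha>\<^sub>k\<close>. Addition and degree are those of polynomials, but the product of operators is
  \<open>op_mult\<close> (Leibniz rule), not the commutative product of the polynomial type.\<close>

definition op_apply :: "('a::comm_ring_1 \<Rightarrow> 'a) \<Rightarrow> 'a poly \<Rightarrow> 'a dpol \<Rightarrow> 'a dpol" where
  "op_apply d L f = (\<Sum>k\<le>degree L. Const (coeff L k) * (dd d ^^ k) f)"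

definition op_mult :: "('a::comm_ring_1 \<Rightarrow> 'a) \<Rightarrow> 'a poly \<Rightarrow> 'a poly \<Rightarrow> 'a poly" where
  "op_mult d A B =
     (\<Sum>i\<le>degree A. \<Sum>j\<le>degree B. \<Sum>l\<le>i.
        monom (coeff A i * of_nat (i choose l) * (d ^^ l) (coeff B j)) (i - l + j))"

definition ldeg :: "'a::zero poly \<Rightarrow> nat" where
  "ldeg L = (LEAST k. coeff L k \<noteq> 0)"

definition left_dvd :: "('a::comm_ring_1 \<Rightarrow> 'a) \<Rightarrow> 'a poly \<Rightarrow> 'a poly \<Rightarrow> bool" where
  "left_dvd d A B \<longleftrightarrow> (\<exists>L. B = op_mult d A L)"

definition is_gcld ::
  "('a::comm_ring_1 \<Rightarrow> 'a) \<Rightarrow> nat \<Rightarrow> (nat \<Rightarrow> 'a poly) \<Rightarrow> 'a poly \<Rightarrow> bool" where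
  "is_gcld d n F D \<longleftrightarrow>
     (\<forall>i\<in>{1..n}. left_dvd d D (F i)) \<and>
     (\<forall>E. (\<forall>i\<in>{1..n}. left_dvd d E (F i)) \<longrightarrow> left_dvd d E D)"


section \<open>Generic sparse systems\<close>

definition coeff_index :: "nat \<Rightarrow> (nat \<Rightarrow> nat \<Rightarrow> nat set) \<Rightarrow> (nat \<times> nat \<times> nat) set" where
  "coeff_index n S = {(i, j, k). i \<in> {1..n} \<and> j \<in> {1..n - 1} \<and> k \<in> S i j}"

definition gen_op ::
  "(nat \<Rightarrow> nat \<Rightarrow> nat set) \<Rightarrow> (nat \<times> nat \<times> nat \<Rightarrow> 'a::comm_ring_1) \<Rightarrow> nat \<Rightarrow> nat \<Rightarrow> 'a poly" where
  "gen_op S c i j = (\<Sum>k\<in>S i j. monom (c (i, j, k)) k)"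

definition gen_sys ::
  "('a::comm_ring_1 \<Rightarrow> 'a) \<Rightarrow> nat \<Rightarrow> (nat \<Rightarrow> nat \<Rightarrow> nat set) \<Rightarrow>
   (nat \<times> nat \<times> nat \<Rightarrow> 'a) \<Rightarrow> nat \<Rightarrow> 'a dpol" where
  "gen_sys d n S c i = Var (CV i 0) + (\<Sum>j=1..n - 1. op_apply d (gen_op S c i j) (Var (UV j 0)))"

definition super_essential :: "nat \<Rightarrow> (nat \<Rightarrow> nat \<Rightarrow> 'a::zero poly) \<Rightarrow> bool" where
  "super_essential n G \<longleftrightarrow>
     (\<forall>i\<in>{1..n}. \<exists>\<tau>. \<tau> permutes {1..n - 1} \<and>
        (\<forall>j\<in>{1..i - 1}. G j (\<tau> (n - j)) \<noteq> 0) \<and>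
        (\<forall>j\<in>{i + 1..n}. G j (\<tau> (n - j + 1)) \<noteq> 0))"

text \<open>Order in \<open>U\<close>; the value is -1 if no \<open>u\<^bsub>j,k\<^esub>\<close> occurs.\<close>

definition ord_U :: "'a::zero dpol \<Rightarrow> int" where
  "ord_U f = (if \<exists>j k. UV j k \<in> vars f then int (Max {k. \<exists>j. UV j k \<in> vars f}) else -1)"


section \<open>The sparse linear differential resultant\<close>

definition ID ::
  "('a::comm_ring_1 \<Rightarrow> 'a) \<Rightarrow> nat \<Rightarrow> (nat \<Rightarrow> 'a dpol) \<Rightarrow> 'a dpol set" where
  "ID d n P = diff_ideal_gen d (ring_DU n) (P ` {1..n}) \<inter> ring_D n"

text \<open>Rankings on \<open>C\<close>; saturation ideals are formed with respect to such a ranking.\<close>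

definition ranking :: "nat \<Rightarrow> (dvar \<Rightarrow> dvar \<Rightarrow> bool) \<Rightarrow> bool" where
  "ranking n lt \<longleftrightarrow>
     (\<forall>v\<in>Cvars n. \<not> lt v v) \<and>
     (\<forall>u\<in>Cvars n. \<forall>v\<in>Cvars n. \<forall>w\<in>Cvars n. lt u v \<longrightarrow> lt v w \<longrightarrow> lt u w) \<and>
     (\<forall>u\<in>Cvars n. \<forall>v\<in>Cvars n. u \<noteq> v \<longrightarrow> lt u v \<or> lt v u) \<and>
     (\<forall>v\<in>Cvars n. lt v (dnext v)) \<and>
     (\<forall>u\<in>Cvars n. \<forall>v\<in>Cvars n. lt u v \<longrightarrow> lt (dnext u) (dnext v))"

definition leader :: "(dvar \<Rightarrow> dvar \<Rightarrow> bool) \<Rightarrow> 'a::zero dpol \<Rightarrow> dvar" where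
  "leader lt f = (THE v. v \<in> vars f \<and> (\<forall>w\<in>vars f. w \<noteq> v \<longrightarrow> lt w v))"

definition initial_of :: "(dvar \<Rightarrow> dvar \<Rightarrow> bool) \<Rightarrow> 'a::comm_ring_1 dpol \<Rightarrow> 'a dpol" where
  "initial_of lt f =
     (let v = leader lt f; e = Max ((\<lambda>t. Poly_Mapping.lookup t v) ` Poly_Mapping.keys f)
      in coeff_in {v} (Poly_Mapping.single v e) f)"

definition separant :: "(dvar \<Rightarrow> dvar \<Rightarrow> bool) \<Rightarrow> 'a::comm_ring_1 dpol \<Rightarrow> 'a dpol" where
  "separant lt f = partial_deriv (leader lt f) f"

definition sat_ideal ::
  "('a::comm_ring_1 \<Rightarrow> 'a) \<Rightarrow> nat \<Rightarrow> (dvar \<Rightarrow> dvar \<Rightarrow> bool) \<Rightarrow> 'a dpol \<Rightarrow> 'a dpol set" where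
  "sat_ideal d n lt R =
     {f \<in> ring_D n. \<exists>a b. initial_of lt R ^ a * separant lt R ^ b * f
                            \<in> diff_ideal_gen d (ring_D n) {R}}"

definition unit_in_D :: "nat \<Rightarrow> 'a::comm_ring_1 dpol \<Rightarrow> bool" where
  "unit_in_D n f \<longleftrightarrow> f \<in> ring_D n \<and> (\<exists>g\<in>ring_D n. f * g = 1)"

definition irreducible_in_D :: "nat \<Rightarrow> 'a::comm_ring_1 dpol \<Rightarrow> bool" where
  "irreducible_in_D n R \<longleftrightarrow>
     R \<in> ring_D n \<and> R \<noteq> 0 \<and> \<not> unit_in_D n R \<and>
     (\<forall>f\<in>ring_D n. \<forall>g\<in>ring_D n. R = f * g \<longrightarrow> unit_in_D n f \<or> unit_in_D n g)"

text \<open>\<open>R\<close> is a sparse differential resultant of \<open>P\<close>. This determines \<open>R\<close> up to a nonzero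
  factor from the coefficient field; no representative is singled out.\<close>

definition is_dRes ::
  "('a::comm_ring_1 \<Rightarrow> 'a) \<Rightarrow> nat \<Rightarrow> (dvar \<Rightarrow> dvar \<Rightarrow> bool) \<Rightarrow> (nat \<Rightarrow> 'a dpol) \<Rightarrow> 'a dpol \<Rightarrow> bool" where
  "is_dRes d n lt P R \<longleftrightarrow> irreducible_in_D n R \<and> ID d n P = sat_ideal d n lt R"


section \<open>The determinantal formula\<close>

text \<open>For a system \<open>P i = c\<^sub>i + \<Sum>\<^sub>j L\<^bsub>i,j\<^esub>(u\<^sub>j)\<close> the operator \<open>L\<^bsub>i,j\<^esub>\<close> is
  \<open>op_of (P i) j\<close>.\<close>

definition op_of :: "'a::comm_monoid_add dpol \<Rightarrow> nat \<Rightarrow> 'a poly" where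
  "op_of f j =
     (\<Sum>k | UV j k \<in> vars f. monom (Poly_Mapping.lookup f (Poly_Mapping.single (UV j k) 1)) k)"

definition gamma_up :: "nat \<Rightarrow> (nat \<Rightarrow> 'a::comm_monoid_add dpol) \<Rightarrow> nat \<Rightarrow> int" where
  "gamma_up n P j =
     Min {ord_U (P i) - int (degree (op_of (P i) j)) | i. i \<in> {1..n} \<and> op_of (P i) j \<noteq> 0}"

definition gamma_lo :: "nat \<Rightarrow> (nat \<Rightarrow> 'a::comm_monoid_add dpol) \<Rightarrow> nat \<Rightarrow> int" where
  "gamma_lo n P j =
     Min {int (ldeg (op_of (P i) j)) | i. i \<in> {1..n} \<and> op_of (P i) j \<noteq> 0}"

definition gamma :: "nat \<Rightarrow> (nat \<Rightarrow> 'a::comm_monoid_add dpol) \<Rightarrow> int" where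
  "gamma n P = (\<Sum>j=1..n - 1. gamma_lo n P j + gamma_up n P j)"

definition total_ord :: "nat \<Rightarrow> (nat \<Rightarrow> 'a::zero dpol) \<Rightarrow> int" where
  "total_ord n P = (\<Sum>i=1..n. ord_U (P i))"

definition FRes_defined :: "nat \<Rightarrow> (nat \<Rightarrow> 'a::comm_monoid_add dpol) \<Rightarrow> bool" where
  "FRes_defined n P \<longleftrightarrow> (\<forall>i\<in>{1..n}. 0 \<le> total_ord n P - ord_U (P i) - gamma n P)"

text \<open>The set \<open>ps(P)\<close> and the set \<open>\<V>\<close> are listed in a fixed order; another order would change
  the determinant by a sign only.\<close>

definition ps ::
  "('a::comm_ring_1 \<Rightarrow> 'a) \<Rightarrow> nat \<Rightarrow> (nat \<Rightarrow> 'a dpol) \<Rightarrow> 'a dpol list" where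
  "ps d n P =
     concat (map (\<lambda>i. map (\<lambda>k. (dd d ^^ k) (P i))
                       [0..<Suc (nat (total_ord n P - ord_U (P i) - gamma n P))])
              [1..<Suc n])"

definition col_vars :: "nat \<Rightarrow> (nat \<Rightarrow> 'a::comm_monoid_add dpol) \<Rightarrow> dvar list" where
  "col_vars n P =
     concat (map (\<lambda>j. map (UV j)
                       [nat (gamma_lo n P j)..<
                        Suc (nat (total_ord n P - gamma_up n P j - gamma n P))])
              [1..<n])"

definition FMat ::
  "('a::comm_ring_1 \<Rightarrow> 'a) \<Rightarrow> nat \<Rightarrow> (nat \<Rightarrow> 'a dpol) \<Rightarrow> 'a dpol mat" where
  "FMat d n P =
     (let rows = ps d n P; cols = col_vars n P; L = length rows
      in mat L L (\<lambda>(r, s).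
           coeff_in (set cols)
             (if s < length cols then Poly_Mapping.single (cols ! s) 1 else 0) (rows ! r)))"

definition FRes :: "('a::comm_ring_1 \<Rightarrow> 'a) \<Rightarrow> nat \<Rightarrow> (nat \<Rightarrow> 'a dpol) \<Rightarrow> 'a dpol" where
  "FRes d n P = Determinant.det (FMat d n P)"


section \<open>Perturbations\<close>

text \<open>The members of a perturbation are homogeneous linear, so that the perturbed system again
  consists of polynomials of the form \<open>c\<^sub>i + \<Sum>\<^sub>j L\<^bsub>i,j\<^esub>(u\<^sub>j)\<close>.\<close>

definition linear_perturbation :: "nat \<Rightarrow> (nat \<Rightarrow> 'a::zero dpol) \<Rightarrow> bool" where
  "linear_perturbation n \<epsilon> \<longleftrightarrow>
     (\<forall>i\<in>{1..n}. \<forall>t\<in>Poly_Mapping.keys (\<epsilon> i). \<exists>v\<in>Uvars n. t = Poly_Mapping.single v 1)"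

text \<open>The perturbed system has its coefficients in \<open>\<K>[p]\<close>, i.e. in the type \<open>'k poly\<close>, where
  \<open>p\<close> is \<open>[:0, 1:]\<close>; as \<open>\<partial>p = 0\<close>, the derivation of \<open>\<K>[p]\<close> acts coefficientwise.\<close>

definition embed_p :: "'a::comm_ring_1 dpol \<Rightarrow> 'a poly dpol" where
  "embed_p f = Poly_Mapping.map (\<lambda>a. [:a:]) f"

definition perturbed ::
  "(nat \<Rightarrow> 'a::comm_ring_1 dpol) \<Rightarrow> (nat \<Rightarrow> 'a dpol) \<Rightarrow> nat \<Rightarrow> 'a poly dpol" where
  "perturbed P \<epsilon> i = embed_p (P i) - Const [:0, 1:] * embed_p (\<epsilon> i)"

definition p_deriv :: "('a::zero \<Rightarrow> 'a) \<Rightarrow> 'a poly \<Rightarrow> 'a poly" where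
  "p_deriv d = map_poly d"

definition p_coeff :: "nat \<Rightarrow> 'a::zero poly dpol \<Rightarrow> 'a dpol" where
  "p_coeff e f = Poly_Mapping.map (\<lambda>q. coeff q e) f"

definition lowest_p_coeff :: "'a::zero poly dpol \<Rightarrow> 'a dpol" where
  "lowest_p_coeff f = p_coeff (LEAST e. p_coeff e f \<noteq> 0) f"

definition ID_primitive_part ::
  "('a::comm_ring_1 \<Rightarrow> 'a) \<Rightarrow> nat \<Rightarrow> (nat \<Rightarrow> 'a dpol) \<Rightarrow> 'a dpol \<Rightarrow> 'a dpol \<Rightarrow> bool" where
  "ID_primitive_part d n P B A \<longleftrightarrow>
     B \<in> ID d n P \<and> B \<noteq> 0 \<and>
     (\<exists>F D L. B = (\<Sum>i=1..n. op_apply d (F i) (Var (CV i 0))) \<and>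
        is_gcld d n F D \<and>
        (\<forall>i\<in>{1..n}. F i = op_mult d D (L i)) \<and>
        A = (\<Sum>i=1..n. op_apply d (L i) (Var (CV i 0))))"

definition is_A_eps ::
  "('a::comm_ring_1 \<Rightarrow> 'a) \<Rightarrow> nat \<Rightarrow> (nat \<Rightarrow> 'a dpol) \<Rightarrow> (nat \<Rightarrow> 'a dpol) \<Rightarrow> 'a dpol \<Rightarrow> bool" where
  "is_A_eps d n P \<epsilon> A \<longleftrightarrow>
     ID_primitive_part d n P (lowest_p_coeff (FRes (p_deriv d) n (perturbed P \<epsilon>))) A"

end

theory Submission
  imports Defs
begin

text \<open>The differential homomorphism \<open>phi\<close> with \<open>c\<^sub>i \<mapsto> -\<Sum>\<^sub>j G\<^bsub>i,j\<^esub>(u\<^sub>j)\<close>, \<open>u\<^sub>j \<mapsto> u\<^sub>j\<close> identifies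
  \<open>ID(P)\<close> with its kernel on the polynomials in \<open>C\<close>. The linear elements of the kernel are
  the left syzygies of the matrix \<open>G\<close> over \<open>\<K>[\<partial>]\<close>. Because \<open>G\<close> is generic, the first \<open>n - 1\<close> rows are left independent, so right
  division makes the module of syzygies cyclic; let \<open>A\<close> be the linear form of a generator \<open>L\<close>.
  Then \<open>ID(P) = [A] = sat(A)\<close>, and the entries of a syzygy \<open>E L\<close> have greatest common
  left divisor \<open>E\<close>, so every primitive part of a linear element of \<open>ID(P)\<close> is \<open>A\<close> up to a nonzero factor.
  If \<open>R\<close> is irreducible with \<open>sat(R) = ID(P)\<close>, then comparing Jacobians of \<open>R\<close> and \<open>A\<close> modulo \<open>ID(P)\<close>
  shows that the leader of \<open>R\<close> is at most that of \<open>A\<close>, hence \<open>A\<close> divides \<open>R\<close>.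
  For the perturbation \<open>u\<^sub>i\<^sup>(\<^sup>m\<^sup>) + u\<^bsub>i-1\<^esub>\<close> with \<open>m\<close> above all orders the highest power of the parameter
  forces the determinant to be nonzero, and its lowest coefficient is a linear element of \<open>ID(P)\<close>.\<close>

section \<open>Polynomials\<close>

text \<open>A relation between rows of operators is therefore unfolded into a relation between the
  rows multiplied by powers of \<open>\<partial>\<close>; this gives a scalar matrix, to which the
  algebraic independence of all derivatives of the coefficients applies.

  The definition of the resultant admits any irreducible \<open>R\<close> with the right saturation.
  Its order and degree are unknown beforehand, and its own initial and separant enter the ideal. The
  Jacobian removes this nonlinearity: in a combination of derivatives of an element of the ideal,
  the terms in which a multiplier is differentiated vanish modulo the ideal. What remains is
  composition of operators whose coefficients lie in a polynomial ring, hence in a domain, so orders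
  add.

  The scalar in the conclusion arises twice: the units of the polynomial ring are the nonzero
  constants, which settles \<open>R\<close> against \<open>A\<close>; and an operator with a
  one-sided inverse has order 0, which settles an arbitrary choice of greatest common left
  divisor.\<close>

lemma sum_keys_superset:
  assumes "finite T" "Poly_Mapping.keys f \<subseteq> T" "\<And>t. g t 0 = (0::'b::comm_monoid_add)"
  shows "(\<Sum>t\<in>Poly_Mapping.keys f. g t (Poly_Mapping.lookup f t)) = (\<Sum>t\<in>T. g t (Poly_Mapping.lookup f t))"
  using assms by (intro sum.mono_neutral_left) (auto simp: in_keys_iff)

text \<open>Evaluation, partial derivatives and \<open>dd\<close> are sums over keys, and keys can
  disappear by cancellation in \<open>f + h\<close>. Extending all three sums to the union of the
  keys makes them comparable.\<close>

lemma sum_keys_add: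
  assumes z: "\<And>t. g t 0 = (0::'b::comm_monoid_add)" and a: "\<And>t x y. g t (x + y) = g t x + g t y"
  shows "(\<Sum>t\<in>Poly_Mapping.keys (f + h). g t (Poly_Mapping.lookup (f + h) t)) =
    (\<Sum>t\<in>Poly_Mapping.keys f. g t (Poly_Mapping.lookup f t)) + (\<Sum>t\<in>Poly_Mapping.keys h. g t (Poly_Mapping.lookup h t))"
proof -
  let ?T = "Poly_Mapping.keys f \<union> Poly_Mapping.keys h"
  have "Poly_Mapping.keys (f + h) \<subseteq> ?T" by (rule keys_add)
  then show ?thesis
    by (subst (1 2 3) sum_keys_superset[where T = ?T and g = g])
      (auto simp: z a lookup_add sum.distrib)
qed

lemma poly_mapping_as_sum: "f = (\<Sum>t\<in>Poly_Mapping.keys f. Poly_Mapping.single t (Poly_Mapping.lookup f t))"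
  by (rule poly_mapping_eqI)
    (auto simp: lookup_sum lookup_single when_def in_keys_iff sum.delta' split: if_splits)

lemma additive_sum:
  assumes "D 0 = (0::'b::comm_monoid_add)" "\<And>x y. D (x + y) = D x + D y"
  shows "D (sum f S) = (\<Sum>x\<in>S. D (f x))"
  by (induction S rule: infinite_finite_induct) (auto simp: assms)

text \<open>The product rules for evaluation, partial derivatives and \<open>dd\<close> each equate
  two biadditive maps. This reduces them to single monomials, where only exponents have to be
  tracked.\<close>

lemma bilinear_ext:
  fixes B1 B2 :: "('v \<Rightarrow>\<^sub>0 'a::comm_monoid_add) \<Rightarrow> ('v \<Rightarrow>\<^sub>0 'a) \<Rightarrow> 'c::cancel_comm_monoid_add"
  assumes "\<And>f g h. B1 (f + g) h = B1 f h + B1 g h" "\<And>f g h. B1 h (f + g) = B1 h f + B1 h g"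
    and "\<And>f g h. B2 (f + g) h = B2 f h + B2 g h" "\<And>f g h. B2 h (f + g) = B2 h f + B2 h g"
    and s: "\<And>t a u b. B1 (Poly_Mapping.single t a) (Poly_Mapping.single u b) = B2 (Poly_Mapping.single t a) (Poly_Mapping.single u b)"
  shows "B1 f g = B2 f g"
proof -
  have z: "B1 0 h = 0" "B1 h 0 = 0" "B2 0 h = 0" "B2 h 0 = 0" for h
    using assms(1)[of 0 0 h] assms(2)[of h 0 0] assms(3)[of 0 0 h] assms(4)[of h 0 0] by simp_all
  let ?s = "\<lambda>f. \<Sum>t\<in>Poly_Mapping.keys f. Poly_Mapping.single t (Poly_Mapping.lookup f t)"
  have "B1 (?s f) (?s g) = B2 (?s f) (?s g)"
    by (simp add: additive_sum[where D = "\<lambda>x. B1 x _"] additive_sum[where D = "\<lambda>x. B1 _ x"]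
        additive_sum[where D = "\<lambda>x. B2 x _"] additive_sum[where D = "\<lambda>x. B2 _ x"] z assms)
  then show ?thesis by (simp flip: poly_mapping_as_sum)
qed

lemma Const_0 [simp]: "Const 0 = 0"
  by (simp add: Const_def)
lemma Const_1 [simp]: "Const (1::'a::comm_ring_1) = 1"
  by (simp add: Const_def)
lemma Const_add: "Const (a + b :: 'a::comm_ring_1) = Const a + Const b"
  by (simp add: Const_def single_add)
lemma Const_uminus: "Const (- a :: 'a::comm_ring_1) = - Const a"
  by (simp add: Const_def single_uminus)
lemma Const_mult: "Const (a * b :: 'a::comm_ring_1) = Const a * Const b"
  by (simp add: Const_def mult_single)
lemma Const_sum: "Const (sum f S :: 'a::comm_ring_1) = (\<Sum>x\<in>S. Const (f x))"
  by (rule additive_sum) (simp_all add: Const_add)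
lemma Const_of_nat: "Const (of_nat n :: 'a::comm_ring_1) = of_nat n"
  by (induction n) (simp_all add: Const_add)
lemma Const_power: "Const (a ^ k :: 'a::comm_ring_1) = Const a ^ k"
  by (induction k) (simp_all add: Const_mult)
lemma Const_inject [simp]: "Const a = Const b \<longleftrightarrow> a = b"
  by (auto simp: Const_def) (metis lookup_single_eq)
lemma Const_eq_0 [simp]: "Const a = 0 \<longleftrightarrow> a = 0"
  using Const_inject[of a 0] by (simp del: Const_inject)
lemma lookup_Const_mult: "Poly_Mapping.lookup (Const (a::'a::comm_ring_1) * f) t = a * Poly_Mapping.lookup f t"
proof -
  have "Const a * f = Poly_Mapping.map ((*) a) f"
    by (simp add: Const_def mult_map_scale_conv_mult)
  then show ?thesis by (simp add: map.rep_eq when_def)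
qed

lemma mpol_monom:
  "(Poly_Mapping.single t (a::'a::comm_ring_1) :: ('v, 'a) mpol) = Const a * (\<Prod>v\<in>Poly_Mapping.keys t. Var v ^ Poly_Mapping.lookup t v)"
proof -
  have pw: "Var v ^ k = (Poly_Mapping.single (Poly_Mapping.single v k) 1 :: ('v, 'a) mpol)" for v :: 'v and k
    by (induction k) (simp_all add: Var_def mult_single flip: single_add)
  have "(\<Prod>v\<in>T. Var v ^ e v) = (Poly_Mapping.single (\<Sum>v\<in>T. Poly_Mapping.single v (e v)) 1 :: ('v, 'a) mpol)"
    if "finite T" for T and e :: "'v \<Rightarrow> nat"
    using that by induction (simp_all add: pw mult_single)
  then show ?thesis
    by (simp add: Const_def mult_single flip: poly_mapping_as_sum)
qed

lemma finite_vars [simp]: "finite (vars f)"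
  by (simp add: vars_def)
lemma vars_0 [simp]: "vars 0 = {}" by (simp add: vars_def)
lemma vars_Const [simp]: "vars (Const a) = {}" by (simp add: vars_def Const_def)
lemma vars_1 [simp]: "vars (1 :: ('v, 'a::comm_ring_1) mpol) = {}" by (simp add: vars_def)
lemma vars_Var [simp]: "vars (Var v :: ('v, 'a::comm_ring_1) mpol) = {v}" by (simp add: vars_def Var_def)
lemma vars_add: "vars (f + g) \<subseteq> vars f \<union> vars g"
  using keys_add[of f g] by (auto simp: vars_def)
lemma vars_uminus [simp]: "vars (- f :: ('v, 'a::comm_ring_1) mpol) = vars f"
  by (auto simp: vars_def in_keys_iff)
lemma vars_diff: "vars (f - g :: ('v, 'a::comm_ring_1) mpol) \<subseteq> vars f \<union> vars g"
  using vars_add[of f "- g"] by simp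
lemma vars_mult: "vars (f * g :: ('v, 'a::comm_ring_1) mpol) \<subseteq> vars f \<union> vars g"
proof
  fix v assume "v \<in> vars (f * g)"
  then obtain t where t: "t \<in> Poly_Mapping.keys (f * g)" "v \<in> Poly_Mapping.keys t" by (auto simp: vars_def)
  then obtain a b where "t = a + b" "a \<in> Poly_Mapping.keys f" "b \<in> Poly_Mapping.keys g"
    using keys_mult[of f g] by auto
  with t keys_add[of a b] show "v \<in> vars f \<union> vars g" by (auto simp: vars_def)
qed
lemma vars_sum: "vars (sum f S) \<subseteq> (\<Union>x\<in>S. vars (f x))"
proof (induction S rule: infinite_finite_induct)
  case (insert x F)
  then show ?case using vars_add[of "f x" "sum f F"] by auto
qed auto
lemma vars_prod: "vars (prod f S :: ('v, 'a::comm_ring_1) mpol) \<subseteq> (\<Union>x\<in>S. vars (f x))"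
proof (induction S rule: infinite_finite_induct)
  case (insert x F)
  then show ?case using vars_mult[of "f x" "prod f F"] by auto
qed auto
lemma vars_empty_iff: "vars f = {} \<longleftrightarrow> (\<exists>a. f = Const (a::'a::comm_ring_1))"
proof
  assume "vars f = {}"
  then have "Poly_Mapping.keys f \<subseteq> {0}" by (auto simp: vars_def)
  then have "f = Const (Poly_Mapping.lookup f 0)"
    by (intro poly_mapping_eqI) (auto simp: Const_def lookup_single when_def in_keys_iff)
  then show "\<exists>a. f = Const a" ..
qed auto

lemma vars_Const_mult: "vars (Const (a::'a::comm_ring_1) * f) \<subseteq> vars f"
  using vars_mult[of "Const a" f] by simp

text \<open>Monomials are built up one variable at a time, so rules for homomorphisms and
  derivations have to be checked only on constants and on the variables in \<open>X\<close>.\<close>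

lemma mpol_induct [consumes 1, case_names const add var]:
  fixes f :: "('v, 'a::comm_ring_1) mpol"
  assumes "vars f \<subseteq> X"
    and c: "\<And>a. Q (Const a)"
    and a: "\<And>f g. vars f \<subseteq> X \<Longrightarrow> vars g \<subseteq> X \<Longrightarrow> Q f \<Longrightarrow> Q g \<Longrightarrow> Q (f + g)"
    and v: "\<And>f v. v \<in> X \<Longrightarrow> vars f \<subseteq> X \<Longrightarrow> Q f \<Longrightarrow> Q (f * Var v)"
  shows "Q f"
proof -
  let ?R = "\<lambda>f. vars f \<subseteq> X \<and> Q f"
  have pw: "?R (f * Var v ^ k)" if "?R f" "v \<in> X" for f v k
  proof (induction k)
    case 0 then show ?case using that by simp
  next
    case (Suc k)
    have e: "f * Var v ^ Suc k = (f * Var v ^ k) * Var v" by (simp add: mult_ac)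
    show ?case using Suc v[OF that(2), of "f * Var v ^ k"] vars_mult[of "f * Var v ^ k" "Var v"] that
      unfolding e by auto
  qed
  have pr: "?R (Const b * (\<Prod>v\<in>T. Var v ^ e v))" if "finite T" "T \<subseteq> X" for b T and e :: "'v \<Rightarrow> nat"
    using that
  proof (induction T)
    case empty then show ?case by (simp add: c)
  next
    case (insert x F)
    have *: "Const b * (\<Prod>v\<in>insert x F. Var v ^ e v) = (Const b * (\<Prod>v\<in>F. Var v ^ e v)) * Var x ^ e x"
      using insert by (simp add: mult_ac)
    show ?case unfolding * using pw insert by auto
  qed
  have "?R (\<Sum>t\<in>T. Poly_Mapping.single t (Poly_Mapping.lookup f t))" if "T \<subseteq> Poly_Mapping.keys f" "finite T" for T
    using that(2,1)
  proof induction
    case empty then show ?case using c[of 0] by simp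
  next
    case (insert t T)
    have "Poly_Mapping.keys t \<subseteq> X" using insert(4) assms(1) by (auto simp: vars_def)
    then have "?R (Poly_Mapping.single t (Poly_Mapping.lookup f t))"
      unfolding mpol_monom using pr by simp
    with insert show ?case
      using vars_add[of "Poly_Mapping.single t (Poly_Mapping.lookup f t)" "\<Sum>t\<in>T. Poly_Mapping.single t (Poly_Mapping.lookup f t)"] a by auto
  qed
  from this[of "Poly_Mapping.keys f"] show ?thesis by (simp flip: poly_mapping_as_sum)
qed

section \<open>Evaluation\<close>

text \<open>The substitution extending \<open>h\<close> by \<open>v \<mapsto> s v\<close>. The body
  copies \<open>eval_rat\<close>, which is the case \<open>h = of_rat\<close>, so that the
  evaluation of the generic coefficients becomes a ring homomorphism and commutes with
  determinants.\<close>

definition mp_eval :: "('a::comm_ring_1 \<Rightarrow> 'b::comm_ring_1) \<Rightarrow> ('v \<Rightarrow> 'b) \<Rightarrow> ('v, 'a) mpol \<Rightarrow> 'b" where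
  "mp_eval h s f = (\<Sum>t\<in>Poly_Mapping.keys f. h (Poly_Mapping.lookup f t) * (\<Prod>v\<in>Poly_Mapping.keys t. s v ^ Poly_Mapping.lookup t v))"

context comm_ring_hom
begin

lemma mp_eval_add: "mp_eval hom s (f + g) = mp_eval hom s f + mp_eval hom s g"
  unfolding mp_eval_def
  by (rule sum_keys_add[where g = "\<lambda>t a. hom a * (\<Prod>v\<in>Poly_Mapping.keys t. s v ^ Poly_Mapping.lookup t v)"])
    (simp_all add: hom_distribs algebra_simps)

lemma mp_eval_single:
  "mp_eval hom s (Poly_Mapping.single t a) = hom a * (\<Prod>v\<in>Poly_Mapping.keys t. s v ^ Poly_Mapping.lookup t v)"
  by (cases "a = 0") (simp_all add: mp_eval_def)

lemma mp_eval_Const [simp]: "mp_eval hom s (Const a) = hom a"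
  by (simp add: Const_def mp_eval_single)

lemma mp_eval_Var [simp]: "mp_eval hom s (Var v) = s v"
  by (simp add: Var_def mp_eval_single)

lemma mp_eval_mult: "mp_eval hom s (f * g) = mp_eval hom s f * mp_eval hom s g"
proof (rule bilinear_ext[of "\<lambda>f g. mp_eval hom s (f * g)" "\<lambda>f g. mp_eval hom s f * mp_eval hom s g"])
  fix t u :: "'c \<Rightarrow>\<^sub>0 nat" and a b
  let ?P = "\<lambda>T t. \<Prod>v\<in>T. s v ^ Poly_Mapping.lookup t v"
  let ?T = "Poly_Mapping.keys t \<union> Poly_Mapping.keys u"
  have e: "?P (Poly_Mapping.keys w) w = ?P ?T w" if "Poly_Mapping.keys w \<subseteq> ?T" for w
    using that by (intro prod.mono_neutral_left) (auto simp: in_keys_iff)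
  have "?P (Poly_Mapping.keys (t + u)) (t + u) = ?P (Poly_Mapping.keys t) t * ?P (Poly_Mapping.keys u) u"
    using keys_add[of t u] e[of "t + u"] e[of t] e[of u] by (simp add: lookup_add power_add prod.distrib)
  then show "mp_eval hom s (Poly_Mapping.single t a * Poly_Mapping.single u b)
    = mp_eval hom s (Poly_Mapping.single t a) * mp_eval hom s (Poly_Mapping.single u b)"
    by (simp add: mult_single mp_eval_single hom_distribs mult_ac)
qed (simp_all add: mp_eval_add algebra_simps)

lemma comm_ring_hom_mp_eval: "comm_ring_hom (mp_eval hom s)"
proof
  show "mp_eval hom s 1 = 1"
    using mp_eval_Const[of s 1] by simp
  show "mp_eval hom s 0 = 0"
    by (simp add: mp_eval_def)
qed (simp_all add: mp_eval_add mp_eval_mult)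

end

lemma comm_ring_hom_Const: "comm_ring_hom (Const :: 'a::comm_ring_1 \<Rightarrow> ('v, 'a) mpol)"
  by unfold_locales (simp_all add: Const_add Const_mult)

lemma mpol_hom_eqI:
  fixes F G :: "('v, 'a::comm_ring_1) mpol \<Rightarrow> 'b::comm_ring_1"
  assumes "comm_ring_hom F" "comm_ring_hom G" "vars f \<subseteq> X"
    and c: "\<And>a. F (Const a) = G (Const a)" and v: "\<And>v. v \<in> X \<Longrightarrow> F (Var v) = G (Var v)"
  shows "F f = G f"
proof -
  interpret F: comm_ring_hom F by fact
  interpret G: comm_ring_hom G by fact
  show ?thesis using assms(3)
    by (induction rule: mpol_induct) (simp_all add: c v F.hom_add F.hom_mult G.hom_add G.hom_mult)
qed

lemma vars_hom:
  assumes h: "comm_ring_hom F" and "vars f \<subseteq> X"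
    and c: "\<And>a::'a::comm_ring_1. vars (F (Const a) :: ('w, 'b::comm_ring_1) mpol) \<subseteq> Y" and v: "\<And>v. v \<in> X \<Longrightarrow> vars (F (Var v)) \<subseteq> Y"
  shows "vars (F f) \<subseteq> Y"
proof -
  interpret F: comm_ring_hom F by fact
  show ?thesis using assms(2)
  proof (induction rule: mpol_induct)
    case (add f g)
    then show ?case using vars_add[of "F f" "F g"] by (auto simp: F.hom_add F.hom_mult F.hom_minus)
  next
    case (var f w)
    then show ?case using vars_mult[of "F f" "F (Var w)"] v[of w] by (auto simp: F.hom_add F.hom_mult F.hom_minus)
  qed (rule c)
qed

text \<open>The identity \<open>f w - F f F w = f (w - F w) + F w (f - F f)\<close> reduces the
  claim to the variables. The set \<open>I\<close> is described by closure properties only, so that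
  it may be an ideal of the polynomials in any set \<open>Y\<close> of variables.\<close>

lemma hom_diff_in_ideal:
  fixes F :: "('v, 'a::comm_ring_1) mpol \<Rightarrow> ('v, 'a) mpol"
  assumes "comm_ring_hom F" "vars f \<subseteq> X"
    and c: "\<And>a. F (Const a) = Const a"
    and I: "0 \<in> I" "\<And>f g. f \<in> I \<Longrightarrow> g \<in> I \<Longrightarrow> f + g \<in> I"
      "\<And>f g. vars f \<subseteq> Y \<Longrightarrow> g \<in> I \<Longrightarrow> f * g \<in> I"
    and X: "X \<subseteq> Y" and FX: "\<And>v. v \<in> X \<Longrightarrow> vars (F (Var v)) \<subseteq> Y"
    and v: "\<And>v. v \<in> X \<Longrightarrow> Var v - F (Var v) \<in> I"
  shows "f - F f \<in> I"
proof -
  interpret F: comm_ring_hom F by fact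
  show ?thesis using assms(2)
  proof (induction rule: mpol_induct)
    case (const a) then show ?case by (simp add: c I)
  next
    case (add f g)
    then show ?case using I(2)[of "f - F f" "g - F g"] by (simp add: F.hom_add F.hom_mult F.hom_minus algebra_simps)
  next
    case (var f w)
    have "f * Var w - F (f * Var w) = f * (Var w - F (Var w)) + F (Var w) * (f - F f)"
      by (simp add: F.hom_add F.hom_mult F.hom_minus algebra_simps)
    moreover have "vars f \<subseteq> Y" using var X by auto
    ultimately show ?case using var I(2,3) v FX by auto
  qed
qed

text \<open>Ordering the variables orders the monomials, and through this \<open>'a dpol\<close> is
  an integral domain whenever \<open>'a\<close> is one. The order is unrelated to the ranking
  \<open>lt\<close> of the theorem.\<close>

instantiation dvar :: linorder
begin

fun dvar_key :: "dvar \<Rightarrow> nat \<times> nat \<times> nat" where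
  "dvar_key (CV i k) = (0, i, k)"
| "dvar_key (UV j k) = (1, j, k)"

fun triple_less :: "nat \<times> nat \<times> nat \<Rightarrow> nat \<times> nat \<times> nat \<Rightarrow> bool" where
  "triple_less (a, b, c) (a', b', c') \<longleftrightarrow> a < a' \<or> (a = a' \<and> (b < b' \<or> (b = b' \<and> c < c')))"

definition less_dvar :: "dvar \<Rightarrow> dvar \<Rightarrow> bool" where
  "x < y \<longleftrightarrow> triple_less (dvar_key x) (dvar_key y)"

definition less_eq_dvar :: "dvar \<Rightarrow> dvar \<Rightarrow> bool" where
  "x \<le> y \<longleftrightarrow> x = y \<or> triple_less (dvar_key x) (dvar_key (y :: dvar))"

instance
proof
  fix x y z :: dvar
  show "x < y \<longleftrightarrow> x \<le> y \<and> \<not> y \<le> x"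
    by (cases x; cases y) (auto simp: less_dvar_def less_eq_dvar_def)
  show "x \<le> x" by (simp add: less_eq_dvar_def)
  show "x \<le> y \<Longrightarrow> y \<le> z \<Longrightarrow> x \<le> z"
    by (cases x; cases y; cases z) (auto simp: less_dvar_def less_eq_dvar_def)
  show "x \<le> y \<Longrightarrow> y \<le> x \<Longrightarrow> x = y"
    by (cases x; cases y) (auto simp: less_dvar_def less_eq_dvar_def)
  show "x \<le> y \<or> y \<le> x"
    by (cases x; cases y) (auto simp: less_dvar_def less_eq_dvar_def)
qed

end

lemma dnext_inject [simp]: "dnext v = dnext w \<longleftrightarrow> v = w"
  by (cases v; cases w) auto

section \<open>Partial derivatives\<close>

lemma partial_deriv_add: "partial_deriv w (f + g) = partial_deriv w f + partial_deriv w (g :: ('v, 'a::comm_ring_1) mpol)"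
  unfolding partial_deriv_def
  by (rule sum_keys_add[where g = "\<lambda>t a. Poly_Mapping.single (t - Poly_Mapping.single w 1) (of_nat (Poly_Mapping.lookup t w) * a)"])
    (simp_all add: single_add algebra_simps)

lemma partial_deriv_single: "partial_deriv w (Poly_Mapping.single t a) =
    Poly_Mapping.single (t - Poly_Mapping.single w 1) (of_nat (Poly_Mapping.lookup t w) * (a::'a::comm_ring_1))"
  by (cases "a = 0") (simp_all add: partial_deriv_def)

lemma partial_deriv_0 [simp]: "partial_deriv w (0 :: ('v, 'a::comm_ring_1) mpol) = 0"
  by (simp add: partial_deriv_def)

lemma partial_deriv_Const [simp]: "partial_deriv w (Const a :: ('v, 'a::comm_ring_1) mpol) = 0"
  by (simp add: Const_def partial_deriv_single)

lemma partial_deriv_Var: "partial_deriv w (Var v :: ('v, 'a::comm_ring_1) mpol) = (if v = w then 1 else 0)"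
  by (auto simp: Var_def partial_deriv_single lookup_single)

text \<open>Subtraction of exponents is truncated, so \<open>u\<close> may be moved past it only if
  \<open>v\<close> occurs in \<open>t\<close>. Otherwise the factor \<open>of_nat 0\<close> from
  differentiation has already made the coefficient vanish.\<close>

lemma single_shift:
  assumes "Poly_Mapping.lookup t v > (0::nat) \<or> (b::'a::comm_ring_1) = 0"
  shows "Poly_Mapping.single (t + u - Poly_Mapping.single v 1) b = Poly_Mapping.single ((t - Poly_Mapping.single v 1) + u) b"
proof (cases "b = 0")
  case False
  with assms have "Poly_Mapping.lookup t v > 0" by simp
  then have "t + u - Poly_Mapping.single v 1 = (t - Poly_Mapping.single v 1) + u"
    by (intro poly_mapping_eqI) (auto simp: lookup_minus lookup_add lookup_single when_def)
  then show ?thesis by simp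
qed simp

lemma partial_deriv_mult:
  "partial_deriv w (f * g) = partial_deriv w f * g + f * partial_deriv w (g :: ('v, 'a::comm_ring_1) mpol)"
proof (rule bilinear_ext[of "\<lambda>f g. partial_deriv w (f * g)" "\<lambda>f g. partial_deriv w f * g + f * partial_deriv w g"])
  fix t u :: "'v \<Rightarrow>\<^sub>0 nat" and a b :: 'a
  let ?t = "Poly_Mapping.lookup t w" and ?u = "Poly_Mapping.lookup u w" and ?w = "Poly_Mapping.single w 1"
  have 1: "Poly_Mapping.single (t + u - ?w) (of_nat ?t * (a * b)) = Poly_Mapping.single (t - ?w + u) (of_nat ?t * (a * b))"
    by (rule single_shift) (cases ?t, auto)
  have 2: "Poly_Mapping.single (u + t - ?w) (of_nat ?u * (a * b)) = Poly_Mapping.single (u - ?w + t) (of_nat ?u * (a * b))"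
    by (rule single_shift) (cases ?u, auto)
  show "partial_deriv w (Poly_Mapping.single t a * Poly_Mapping.single u b) =
       partial_deriv w (Poly_Mapping.single t a) * Poly_Mapping.single u b +
       Poly_Mapping.single t a * partial_deriv w (Poly_Mapping.single u b)"
    using 1 2 by (simp add: mult_single partial_deriv_single lookup_add single_add ring_distribs ac_simps)
qed (simp_all add: partial_deriv_add algebra_simps)

lemma vars_partial_deriv: "vars (partial_deriv w f :: ('v, 'a::comm_ring_1) mpol) \<subseteq> vars f"
proof -
  have "vars (partial_deriv w f) \<subseteq> X" if "vars f \<subseteq> X" for X
    using that
  proof (induction rule: mpol_induct)
    case (add f g)
    then show ?case using vars_add[of "partial_deriv w f" "partial_deriv w g"] by (auto simp: partial_deriv_add)
  next
    case (var f v)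
    then show ?case using vars_add[of "partial_deriv w f * Var v" "f * partial_deriv w (Var v)"]
        vars_mult[of "partial_deriv w f" "Var v"] by (auto simp: partial_deriv_mult partial_deriv_Var split: if_splits)
  qed simp
  then show ?thesis by simp
qed

section \<open>Derivations\<close>

locale diff_ring =
  fixes d :: "'a::comm_ring_1 \<Rightarrow> 'a"
  assumes der: "derivation d"
begin

lemma d_add: "d (x + y) = d x + d y" and d_mult: "d (x * y) = d x * y + x * d y"
  using der by (auto simp: derivation_def)

lemma d_0 [simp]: "d 0 = 0"
  using d_add[of 0 0] by simp

lemma d_1 [simp]: "d 1 = 0"
  using d_mult[of 1 1] by simp

lemma d_uminus: "d (- x) = - d x"
  using d_add[of x "- x"] by (simp add: add_eq_0_iff)

lemma d_sum: "d (sum f S) = (\<Sum>x\<in>S. d (f x))"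
  by (rule additive_sum) (simp_all add: d_add)

lemma d_of_nat [simp]: "d (of_nat n) = 0"
  by (induction n) (simp_all add: d_add)

lemma dpow_add: "(d ^^ n) (x + y) = (d ^^ n) x + (d ^^ n) y"
  by (induction n) (simp_all add: d_add)

lemma dpow_0 [simp]: "(d ^^ n) 0 = 0"
  by (induction n) simp_all

lemma dpow_uminus: "(d ^^ n) (- x) = - (d ^^ n) x"
  by (induction n) (simp_all add: d_uminus)

lemma leibniz: "(d ^^ n) (x * y) = (\<Sum>l\<le>n. of_nat (n choose l) * (d ^^ l) x * (d ^^ (n - l)) y)"
proof (induction n)
  case (Suc n)
  let ?c = "\<lambda>l. of_nat (n choose l) :: 'a"
  have b0: "(\<Sum>l\<le>n. ?c l * (d ^^ l) x * (d ^^ Suc (n - l)) y) =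
      (\<Sum>l\<le>Suc n. ?c l * (d ^^ l) x * (d ^^ (Suc n - l)) y)"
    by (simp add: Suc_diff_le binomial_eq_0)
  have b1: "\<dots> = x * (d ^^ Suc n) y + (\<Sum>l\<le>n. of_nat (n choose Suc l) * (d ^^ Suc l) x * (d ^^ (n - l)) y)"
    by (subst sum.atMost_Suc_shift) (simp add: binomial_eq_0)
  have "(d ^^ Suc n) (x * y) = (\<Sum>l\<le>n. ?c l * (d ^^ Suc l) x * (d ^^ (n - l)) y) +
      (\<Sum>l\<le>n. ?c l * (d ^^ l) x * (d ^^ Suc (n - l)) y)"
    by (simp add: Suc d_sum d_mult sum.distrib algebra_simps)
  also have "\<dots> = x * (d ^^ Suc n) y +
     (\<Sum>l\<le>n. of_nat (Suc n choose Suc l) * (d ^^ Suc l) x * (d ^^ (n - l)) y)"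
    unfolding b0 b1 by (simp add: sum.distrib algebra_simps binomial_eq_0)
  also have "\<dots> = (\<Sum>l\<le>Suc n. of_nat (Suc n choose l) * (d ^^ l) x * (d ^^ (Suc n - l)) y)"
    by (subst sum.atMost_Suc_shift) simp
  finally show ?case .
qed simp

lemma dd_add: "dd d (f + g) = dd d f + dd d g"
  unfolding dd_def
  by (rule sum_keys_add[where g = "\<lambda>t a. Poly_Mapping.single t (d a) +
        (\<Sum>v\<in>Poly_Mapping.keys t.
           Poly_Mapping.single (t - Poly_Mapping.single v 1 + Poly_Mapping.single (dnext v) 1)
             (of_nat (Poly_Mapping.lookup t v) * a))"])
    (simp_all add: d_add single_add algebra_simps sum.distrib)

lemma dd_single:
  assumes "finite T" "Poly_Mapping.keys t \<subseteq> T"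
  shows "dd d (Poly_Mapping.single t a) = Poly_Mapping.single t (d a) +
    (\<Sum>v\<in>T. Poly_Mapping.single (t - Poly_Mapping.single v 1 + Poly_Mapping.single (dnext v) 1) (of_nat (Poly_Mapping.lookup t v) * a))"
proof -
  have "(\<Sum>v\<in>Poly_Mapping.keys t. Poly_Mapping.single (t - Poly_Mapping.single v 1 + Poly_Mapping.single (dnext v) 1) (of_nat (Poly_Mapping.lookup t v) * a))
    = (\<Sum>v\<in>T. Poly_Mapping.single (t - Poly_Mapping.single v 1 + Poly_Mapping.single (dnext v) 1) (of_nat (Poly_Mapping.lookup t v) * a))"
    using assms by (intro sum.mono_neutral_left) (auto simp: in_keys_iff)
  then show ?thesis by (cases "a = 0") (simp_all add: dd_def)
qed

lemma dd_Const [simp]: "dd d (Const a) = Const (d a)"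
  by (simp add: Const_def dd_single[of "{}"])

lemma dd_Var [simp]: "dd d (Var v) = Var (dnext v)"
  by (simp add: Var_def dd_single[of "{v}"])

lemma dd_mult: "dd d (f * g) = dd d f * g + f * dd d g"
proof (rule bilinear_ext[of "\<lambda>f g. dd d (f * g)" "\<lambda>f g. dd d f * g + f * dd d g"])
  fix t u :: "dvar \<Rightarrow>\<^sub>0 nat" and a b :: 'a
  let ?T = "Poly_Mapping.keys t \<union> Poly_Mapping.keys u"
  let ?l = "Poly_Mapping.lookup" and ?s = "\<lambda>v. Poly_Mapping.single v (1::nat)"
  have "Poly_Mapping.single (t + u - ?s v + ?s (dnext v)) (of_nat (?l (t + u) v) * (a * b)) =
     Poly_Mapping.single (t - ?s v + ?s (dnext v)) (of_nat (?l t v) * a) * Poly_Mapping.single u b +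
     Poly_Mapping.single t a * Poly_Mapping.single (u - ?s v + ?s (dnext v)) (of_nat (?l u v) * b)" for v
  proof -
    have 1: "Poly_Mapping.single (t + u - ?s v) (of_nat (?l t v) * (a * b)) = Poly_Mapping.single (t - ?s v + u) (of_nat (?l t v) * (a * b))"
      by (rule single_shift) (cases "?l t v", auto)
    have 2: "Poly_Mapping.single (u + t - ?s v) (of_nat (?l u v) * (a * b)) = Poly_Mapping.single (u - ?s v + t) (of_nat (?l u v) * (a * b))"
      by (rule single_shift) (cases "?l u v", auto)
    have *: "Poly_Mapping.single (x + y) c = Poly_Mapping.single x c * Poly_Mapping.single y 1" for x y :: "dvar \<Rightarrow>\<^sub>0 nat" and c :: 'a
      by (simp add: mult_single)
    have "Poly_Mapping.single (t + u - ?s v + ?s (dnext v)) (of_nat (?l (t + u) v) * (a * b)) =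
      Poly_Mapping.single (t + u - ?s v) (of_nat (?l t v) * (a * b)) * Poly_Mapping.single (?s (dnext v)) 1 +
      Poly_Mapping.single (u + t - ?s v) (of_nat (?l u v) * (a * b)) * Poly_Mapping.single (?s (dnext v)) 1"
      by (subst *) (simp add: lookup_add single_add ring_distribs add.commute)
    then show ?thesis unfolding 1 2
      by (simp add: mult_single ac_simps)
  qed
  then show "dd d (Poly_Mapping.single t a * Poly_Mapping.single u b) =
       dd d (Poly_Mapping.single t a) * Poly_Mapping.single u b + Poly_Mapping.single t a * dd d (Poly_Mapping.single u b)"
    using keys_add[of t u]
    by (simp add: mult_single dd_single[of ?T] d_mult single_add ring_distribs sum.distrib sum_distrib_left sum_distrib_right)
qed (simp_all add: dd_add algebra_simps)

lemma diff_ring_dd: "diff_ring (dd d)"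
  by unfold_locales (simp add: derivation_def dd_add dd_mult)

lemmas dd_0 [simp] = diff_ring.d_0[OF diff_ring_dd]
lemmas dd_1 [simp] = diff_ring.d_1[OF diff_ring_dd]
lemmas dd_uminus = diff_ring.d_uminus[OF diff_ring_dd]
lemmas dd_sum = diff_ring.d_sum[OF diff_ring_dd]
lemmas ddpow_0 [simp] = diff_ring.dpow_0[OF diff_ring_dd]
lemmas ddpow_add = diff_ring.dpow_add[OF diff_ring_dd]
lemmas ddpow_uminus = diff_ring.dpow_uminus[OF diff_ring_dd]
lemmas dd_leibniz = diff_ring.leibniz[OF diff_ring_dd]

lemma vars_dd:
  assumes "vars f \<subseteq> X" "dnext ` X \<subseteq> X"
  shows "vars (dd d f) \<subseteq> X"
  using assms(1)
proof (induction rule: mpol_induct)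
  case (add f g)
  then show ?case using vars_add[of "dd d f" "dd d g"] by (auto simp: dd_add)
next
  case (var f v)
  then have "dnext v \<in> X" using assms(2) by auto
  then show ?case using var vars_add[of "dd d f * Var v" "f * Var (dnext v)"]
      vars_mult[of "dd d f" "Var v"] vars_mult[of f "Var (dnext v)"] by (simp add: dd_mult) blast
qed simp

lemma vars_ddpow:
  assumes "vars f \<subseteq> X" "dnext ` X \<subseteq> X"
  shows "vars ((dd d ^^ k) f) \<subseteq> X"
  by (induction k) (auto simp: assms(1) intro!: vars_dd[OF _ assms(2)])

lemma ddpow_CV: "(dd d ^^ k) (Var (CV i 0)) = Var (CV i k)"
  by (induction k) simp_all

lemma ddpow_UV: "(dd d ^^ k) (Var (UV j l)) = Var (UV j (l + k))"
  by (induction k) simp_all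

lemma hom_dd:
  assumes "comm_ring_hom F" and c: "\<And>a. F (Const a) = Const a"
    and v: "\<And>v. v \<in> X \<Longrightarrow> F (Var (dnext v)) = dd d (F (Var v))" and "vars f \<subseteq> X"
  shows "F (dd d f) = dd d (F f)"
proof -
  interpret F: comm_ring_hom F by fact
  show ?thesis using assms(4)
    by (induction rule: mpol_induct) (simp_all add: c v dd_add dd_mult F.hom_add F.hom_mult)
qed

text \<open>This commutation rule makes the partial derivatives of \<open>f\<close> behave like the
  coefficients of an operator: applying \<open>dd\<close> to \<open>f\<close> amounts to composing
  that operator with \<partial> from the left.\<close>

lemma partial_deriv_dd:
  "partial_deriv (dnext w) (dd d f) = dd d (partial_deriv (dnext w) f) + partial_deriv w f"
proof -
  have "vars f \<subseteq> UNIV" by simp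
  then show ?thesis
    by (induction rule: mpol_induct)
      (simp_all add: dd_add dd_mult partial_deriv_add partial_deriv_mult partial_deriv_Var algebra_simps)
qed

end

section \<open>Linear forms\<close>

definition linform :: "('v, 'a::zero) mpol \<Rightarrow> bool" where
  "linform f \<longleftrightarrow> (\<forall>t\<in>Poly_Mapping.keys f. \<exists>v. t = Poly_Mapping.single v 1)"

text \<open>The letters stand for linear coefficient, not for leading coefficient.\<close>

definition lc :: "('v, 'a::zero) mpol \<Rightarrow> 'v \<Rightarrow> 'a" where
  "lc f v = Poly_Mapping.lookup f (Poly_Mapping.single v 1)"

lemma lc_0 [simp]: "lc 0 v = 0" by (simp add: lc_def)
lemma lc_add: "lc (f + g) v = lc f v + lc g v" by (simp add: lc_def lookup_add)
lemma lc_diff: "lc (f - g :: ('v, 'a::comm_ring_1) mpol) v = lc f v - lc g v" by (simp add: lc_def lookup_minus)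
lemma lc_uminus: "lc (- f :: ('v, 'a::comm_ring_1) mpol) v = - lc f v" by (simp add: lc_def)
lemma lc_sum: "lc (sum f S) v = (\<Sum>x\<in>S. lc (f x) v)" by (simp add: lc_def lookup_sum)
lemma lc_Const_mult: "lc (Const (a::'a::comm_ring_1) * f) v = a * lc f v" by (simp add: lc_def lookup_Const_mult)
lemma lc_Var: "lc (Var v :: ('v, 'a::comm_ring_1) mpol) w = (if v = w then 1 else 0)"
proof -
  have "Poly_Mapping.single v (1::nat) = Poly_Mapping.single w 1 \<longleftrightarrow> v = w"
    by (metis lookup_single_eq lookup_single_not_eq zero_neq_one)
  then show ?thesis by (simp add: lc_def Var_def lookup_single when_def)
qed

lemma linform_0 [simp]: "linform 0" by (simp add: linform_def)
lemma linform_Var [simp]: "linform (Var v :: ('v, 'a::comm_ring_1) mpol)" by (auto simp: linform_def Var_def)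
lemma linform_add: "linform f \<Longrightarrow> linform g \<Longrightarrow> linform (f + g)"
  using keys_add[of f g] by (auto simp: linform_def)
lemma linform_uminus: "linform f \<Longrightarrow> linform (- f :: ('v, 'a::comm_ring_1) mpol)"
  by (auto simp: linform_def in_keys_iff)
lemma linform_diff: "linform f \<Longrightarrow> linform g \<Longrightarrow> linform (f - g :: ('v, 'a::comm_ring_1) mpol)"
  using linform_add[of f "- g"] by (simp add: linform_uminus)
lemma linform_sum: "(\<And>x. x \<in> S \<Longrightarrow> linform (f x)) \<Longrightarrow> linform (sum f S)"
  by (induction S rule: infinite_finite_induct) (auto intro: linform_add)
lemma linform_Const_mult: "linform f \<Longrightarrow> linform (Const (a::'a::comm_ring_1) * f)"
  by (auto simp: linform_def in_keys_iff lookup_Const_mult)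

lemma linform_eqI:
  assumes "linform f" "linform g" "\<And>v. lc f v = lc g v"
  shows "f = g"
proof (rule poly_mapping_eqI)
  fix t
  show "Poly_Mapping.lookup f t = Poly_Mapping.lookup g t"
  proof (cases "\<exists>v. t = Poly_Mapping.single v 1")
    case True then show ?thesis using assms(3) by (auto simp: lc_def)
  next
    case False
    then have "t \<notin> Poly_Mapping.keys f" "t \<notin> Poly_Mapping.keys g" using assms(1,2) by (auto simp: linform_def)
    then show ?thesis by (simp add: in_keys_iff)
  qed
qed

lemma vars_linform: "linform f \<Longrightarrow> vars f = {v. lc f v \<noteq> 0}"
proof -
  assume f: "linform f"
  show "vars f = {v. lc f v \<noteq> 0}"
  proof (intro Set.set_eqI iffI)
    fix v assume "v \<in> vars f"
    then obtain t where t: "t \<in> Poly_Mapping.keys f" "v \<in> Poly_Mapping.keys t" by (auto simp: vars_def)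
    with f obtain w where "t = Poly_Mapping.single w 1" by (auto simp: linform_def)
    with t show "v \<in> {v. lc f v \<noteq> 0}" by (simp add: lc_def in_keys_iff lookup_single when_def split: if_splits)
  next
    fix v assume "v \<in> {v. lc f v \<noteq> 0}"
    then show "v \<in> vars f" unfolding vars_def lc_def
      by (auto simp: in_keys_iff intro!: bexI[of _ "Poly_Mapping.single v 1"])
  qed
qed

lemma mult_delta: "a * (if Q then 1 else 0) = (if Q then a else (0::'a::semiring_1))"
  by simp

lemma linform_as_sum:
  assumes "linform f" "finite T" "vars f \<subseteq> T"
  shows "f = (\<Sum>v\<in>T. Const (lc f v :: 'a::comm_ring_1) * Var v)"
proof (rule linform_eqI)
  show "lc f w = lc (\<Sum>v\<in>T. Const (lc f v) * Var v) w" for w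
    using assms vars_linform[OF assms(1)]
    by (auto simp: lc_sum lc_Const_mult lc_Var mult_delta)
qed (auto intro!: assms linform_sum linform_Const_mult)

lemma linform_hom:
  assumes "comm_ring_hom F" and "linform f" "finite T" "vars f \<subseteq> T"
  shows "F f = (\<Sum>v\<in>T. F (Const (lc f v :: 'a::comm_ring_1)) * F (Var v))"
proof -
  interpret F: comm_ring_hom F by fact
  show ?thesis
    using arg_cong[OF linform_as_sum[OF assms(2-4)], of F] by (simp add: F.hom_sum F.hom_mult)
qed

context diff_ring
begin

lemma dd_linform_sum:
  assumes "linform f"
  shows "dd d f = (\<Sum>v\<in>vars f. Const (d (lc f v)) * Var v + Const (lc f v) * Var (dnext v))"
  using arg_cong[OF linform_as_sum[OF assms, of "vars f"], of "dd d"] by (simp add: dd_sum dd_mult)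

lemma linform_dd: "linform f \<Longrightarrow> linform (dd d f)"
  by (auto simp: dd_linform_sum intro!: linform_sum linform_add linform_Const_mult)

lemma linform_ddpow: "linform f \<Longrightarrow> linform ((dd d ^^ k) f)"
  by (induction k) (auto intro: linform_dd)

text \<open>A variable of positive order also receives the coefficient of its predecessor; a
  variable of order 0 has no predecessor.\<close>

lemma lc_dd:
  assumes "linform f"
  shows "lc (dd d f) (dnext w) = d (lc f (dnext w)) + lc f w"
    and "(\<And>w. v \<noteq> dnext w) \<Longrightarrow> lc (dd d f) v = d (lc f v)"
proof -
  have *: "lc (dd d f) x = (if x \<in> vars f then d (lc f x) else 0) + (\<Sum>v\<in>vars f. lc f v * (if dnext v = x then 1 else 0))" for x
    by (simp add: dd_linform_sum[OF assms] lc_sum lc_add lc_Const_mult lc_Var sum.distrib mult_delta)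
  have in_vars: "x \<in> vars f \<longleftrightarrow> lc f x \<noteq> 0" for x
    using vars_linform[OF assms] by blast
  show "lc (dd d f) (dnext w) = d (lc f (dnext w)) + lc f w"
    unfolding * by (simp add: mult_delta in_vars)
  assume "\<And>w. v \<noteq> dnext w"
  then have "(\<Sum>w\<in>vars f. lc f w * (if dnext w = v then 1 else 0)) = 0"
    by (intro sum.neutral) (metis mult_zero_right)
  then show "lc (dd d f) v = d (lc f v)"
    unfolding * by (simp add: in_vars)
qed

section \<open>Operators\<close>

lemma op_apply_sum:
  assumes "\<And>k. k \<ge> m \<Longrightarrow> coeff L k = 0"
  shows "op_apply d L f = (\<Sum>k<m. Const (coeff L k) * (dd d ^^ k) f)"
proof -
  have "(\<Sum>k\<le>degree L. Const (coeff L k) * (dd d ^^ k) f) = (\<Sum>k\<in>{..degree L} \<union> {..<m}. Const (coeff L k) * (dd d ^^ k) f)"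
    by (intro sum.mono_neutral_left) (auto simp: coeff_eq_0)
  also have "\<dots> = (\<Sum>k<m. Const (coeff L k) * (dd d ^^ k) f)"
    using assms by (intro sum.mono_neutral_right) auto
  finally show ?thesis by (simp add: op_apply_def)
qed

lemma op_apply_add_left: "op_apply d (A + B) f = op_apply d A f + op_apply d B f"
proof -
  let ?m = "Suc (max (degree A) (degree B))"
  show ?thesis
    by (subst (1 2 3) op_apply_sum[where m = ?m])
      (auto simp: coeff_eq_0 Const_add algebra_simps sum.distrib)
qed

lemma op_apply_0_left [simp]: "op_apply d 0 f = 0"
  by (simp add: op_apply_def)

lemma op_apply_smult: "op_apply d (smult a A) f = Const a * op_apply d A f"
proof -
  let ?m = "Suc (degree A)"
  show ?thesis
    by (subst (1 2) op_apply_sum[where m = ?m])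
      (auto simp: coeff_eq_0 Const_mult algebra_simps sum_distrib_left)
qed

lemma op_apply_uminus_left: "op_apply d (- A) f = - op_apply d A f"
  using op_apply_smult[of "- 1" A f] by (simp add: Const_uminus)

lemma op_apply_sum_left: "op_apply d (sum A S) f = (\<Sum>x\<in>S. op_apply d (A x) f)"
  by (rule additive_sum) (simp_all add: op_apply_add_left)

lemma op_apply_monom: "op_apply d (monom a k) f = Const a * (dd d ^^ k) f"
proof -
  have "op_apply d (monom a k) f = (\<Sum>i<Suc k. Const (coeff (monom a k) i) * (dd d ^^ i) f)"
    by (rule op_apply_sum) auto
  also have "\<dots> = (\<Sum>i<Suc k. if i = k then Const a * (dd d ^^ i) f else 0)"
    by (rule sum.cong) auto
  finally show ?thesis by simp
qed

lemma op_apply_const: "op_apply d [:a:] f = Const a * f"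
  by (simp add: op_apply_def)

lemma op_apply_1 [simp]: "op_apply d 1 f = f"
  by (simp add: op_apply_def)

lemma op_apply_add: "op_apply d A (f + g) = op_apply d A f + op_apply d A g"
  by (simp add: op_apply_def ddpow_add algebra_simps sum.distrib)

lemma op_apply_0 [simp]: "op_apply d A 0 = 0"
  by (simp add: op_apply_def)

lemma op_apply_sum_right: "op_apply d A (sum f S) = (\<Sum>x\<in>S. op_apply d A (f x))"
  by (rule additive_sum) (simp_all add: op_apply_add)

lemma op_apply_uminus: "op_apply d A (- f) = - op_apply d A f"
  by (simp add: op_apply_def ddpow_uminus sum_negf)

lemma linform_op_apply: "linform f \<Longrightarrow> linform (op_apply d A f)"
  by (auto simp: op_apply_def intro!: linform_sum linform_Const_mult linform_ddpow)

lemma vars_op_apply: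
  assumes "vars f \<subseteq> X" "dnext ` X \<subseteq> X"
  shows "vars (op_apply d A f) \<subseteq> X"
proof -
  have "vars (Const (coeff A k) * (dd d ^^ k) f) \<subseteq> X" for k
    using vars_Const_mult[of "coeff A k" "(dd d ^^ k) f"] vars_ddpow[OF assms, of k] by blast
  then show ?thesis
    using vars_sum[of "\<lambda>k. Const (coeff A k) * (dd d ^^ k) f" "{..degree A}"] unfolding op_apply_def by blast
qed

lemma op_apply_Const_monom:
  "op_apply d (monom a i) (Const b * f) = (\<Sum>l\<le>i. Const (a * of_nat (i choose l) * (d ^^ l) b) * (dd d ^^ (i - l)) f)"
proof -
  have "(dd d ^^ l) (Const b) = Const ((d ^^ l) b)" for l
    by (induction l) simp_all
  then show ?thesis
    unfolding op_apply_monom dd_leibniz by (simp add: sum_distrib_left Const_mult Const_of_nat mult_ac)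
qed

text \<open>The coefficients in \<open>op_mult\<close> are those of the Leibniz expansion in
  \<open>op_apply_Const_monom\<close>, so \<open>op_mult\<close> is composition.\<close>

lemma op_apply_mult: "op_apply d (op_mult d A B) f = op_apply d A (op_apply d B f)"
proof -
  have fp: "(dd d ^^ a) ((dd d ^^ b) g) = (dd d ^^ (a + b)) g" for a b g
    by (simp add: funpow_add)
  have "op_apply d (op_mult d A B) f =
    (\<Sum>i\<le>degree A. \<Sum>j\<le>degree B. op_apply d (monom (coeff A i) i) (Const (coeff B j) * (dd d ^^ j) f))"
    by (simp add: op_mult_def op_apply_sum_left op_apply_monom[where f = f] op_apply_Const_monom fp)
  also have "\<dots> = (\<Sum>i\<le>degree A. op_apply d (monom (coeff A i) i) (op_apply d B f))"
    by (subst (2) op_apply_def) (simp add: op_apply_sum_right)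
  also have "\<dots> = op_apply d A (op_apply d B f)"
    by (simp add: op_apply_monom) (simp add: op_apply_def)
  finally show ?thesis .
qed

lemma lc_op_apply_Var:
  "lc (op_apply d A (Var (CV i 0))) w = (case w of CV i' k \<Rightarrow> (if i = i' then coeff A k else 0) | UV j k \<Rightarrow> 0)"
  "lc (op_apply d A (Var (UV j 0))) w = (case w of UV j' k \<Rightarrow> (if j = j' then coeff A k else 0) | CV i k \<Rightarrow> 0)"
proof -
  have *: "(\<Sum>k\<le>degree A. coeff A k * (if k = l then 1 else 0)) = coeff A l" for l
    by (auto simp: mult_delta coeff_eq_0)
  show "lc (op_apply d A (Var (CV i 0))) w = (case w of CV i' k \<Rightarrow> (if i = i' then coeff A k else 0) | UV j k \<Rightarrow> 0)"
    by (cases w) (auto simp: op_apply_def lc_sum lc_Const_mult ddpow_CV lc_Var *)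
  show "lc (op_apply d A (Var (UV j 0))) w = (case w of UV j' k \<Rightarrow> (if j = j' then coeff A k else 0) | CV i k \<Rightarrow> 0)"
    by (cases w) (auto simp: op_apply_def lc_sum lc_Const_mult ddpow_UV lc_Var *)
qed

text \<open>The derivatives of a single \<open>c_i\<close> are distinct variables, so the action on
  it recovers every coefficient. The ring laws of \<open>op_mult\<close> then follow from those of
  composition, without its triple sum.\<close>

lemma op_apply_eqI:
  assumes "op_apply d A (Var (CV i 0)) = op_apply d B (Var (CV i 0))"
  shows "A = B"
proof (rule poly_eqI)
  fix k
  show "coeff A k = coeff B k"
    using lc_op_apply_Var(1)[of A i "CV i k"] lc_op_apply_Var(1)[of B i "CV i k"] assms by simp
qed

lemma op_mult_assoc: "op_mult d (op_mult d A B) C = op_mult d A (op_mult d B C)"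
  by (rule op_apply_eqI) (simp add: op_apply_mult)
lemma op_mult_add_left: "op_mult d (A + B) C = op_mult d A C + op_mult d B C"
  by (rule op_apply_eqI) (simp add: op_apply_mult op_apply_add_left)
lemma op_mult_add_right: "op_mult d A (B + C) = op_mult d A B + op_mult d A C"
  by (rule op_apply_eqI) (simp add: op_apply_mult op_apply_add_left op_apply_add)
lemma op_mult_uminus_left: "op_mult d (- A) C = - op_mult d A C"
  by (rule op_apply_eqI) (simp add: op_apply_mult op_apply_uminus_left)
lemma op_mult_uminus_right: "op_mult d A (- C) = - op_mult d A C"
  by (rule op_apply_eqI) (simp add: op_apply_mult op_apply_uminus_left op_apply_uminus)
lemma op_mult_diff_left: "op_mult d (A - B) C = op_mult d A C - op_mult d B C"
  using op_mult_add_left[of A "- B" C] by (simp add: op_mult_uminus_left)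
lemma op_mult_diff_right: "op_mult d A (B - C) = op_mult d A B - op_mult d A C"
  using op_mult_add_right[of A B "- C"] by (simp add: op_mult_uminus_right)
lemma op_mult_0_left [simp]: "op_mult d 0 A = 0"
  by (rule op_apply_eqI) (simp add: op_apply_mult)
lemma op_mult_0_right [simp]: "op_mult d A 0 = 0"
  by (rule op_apply_eqI) (simp add: op_apply_mult)
lemma op_mult_1_right [simp]: "op_mult d A 1 = A"
  by (rule op_apply_eqI) (simp add: op_apply_mult)
lemma op_mult_sum_right: "op_mult d A (sum B S) = (\<Sum>x\<in>S. op_mult d A (B x))"
  by (rule additive_sum) (simp_all add: op_mult_add_right)
lemma degree_op_mult_le: "degree (op_mult d A B) \<le> degree A + degree B"
proof -
  have *: "degree (monom (coeff A i * of_nat (i choose l) * (d ^^ l) (coeff B j)) (i - l + j)) \<le> degree A + degree B"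
    if "i \<le> degree A" "j \<le> degree B" for i j l
    by (rule order_trans[OF degree_monom_le]) (use that in simp)
  show ?thesis unfolding op_mult_def
    by (rule degree_sum_le, simp, rule degree_sum_le, simp, rule degree_sum_le, simp, rule *) auto
qed

text \<open>Every derivative that falls on a coefficient of \<open>B\<close> costs one order, so
  only \<open>l = 0\<close> reaches the top. Over a field this gives additivity of degrees and the
  absence of zero divisors.\<close>

lemma coeff_op_mult_top: "coeff (op_mult d A B) (degree A + degree B) = lead_coeff A * lead_coeff B"
proof -
  have *: "(\<Sum>l\<le>i. coeff (monom (coeff A i * of_nat (i choose l) * (d ^^ l) (coeff B j)) (i - l + j)) (degree A + degree B))
    = (if j = degree B then if i = degree A then lead_coeff A * lead_coeff B else 0 else 0)"
    if "i \<le> degree A" "j \<le> degree B" for i j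
  proof -
    have "coeff (monom (coeff A i * of_nat (i choose l) * (d ^^ l) (coeff B j)) (i - l + j)) (degree A + degree B) =
      (if l = 0 then if i = degree A \<and> j = degree B then lead_coeff A * lead_coeff B else 0 else 0)"
      if "l \<le> i" for l
      using \<open>i \<le> degree A\<close> \<open>j \<le> degree B\<close> that by auto
    then show ?thesis by simp
  qed
  have "coeff (op_mult d A B) (degree A + degree B) =
    (\<Sum>i\<le>degree A. \<Sum>j\<le>degree B. if j = degree B then if i = degree A then lead_coeff A * lead_coeff B else 0 else 0)"
    unfolding op_mult_def coeff_sum by (intro sum.cong refl *) auto
  then show ?thesis by simp
qed

end

locale diff_field = diff_ring d for d :: "'k::field_char_0 \<Rightarrow> 'k"
begin

lemma op_mult_eq_0_iff: "op_mult d A B = 0 \<longleftrightarrow> A = 0 \<or> B = 0"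
  using coeff_op_mult_top[of A B] by auto

lemma degree_op_mult: "A \<noteq> 0 \<Longrightarrow> B \<noteq> 0 \<Longrightarrow> degree (op_mult d A B) = degree A + degree B"
  by (intro antisym degree_op_mult_le le_degree) (simp add: coeff_op_mult_top)

text \<open>Leading coefficients multiply without derivatives, so a monomial multiplied from the
  left cancels the leading term exactly as for commutative polynomials.\<close>

lemma op_right_division:
  assumes "B \<noteq> 0"
  shows "\<exists>Q r. A = op_mult d Q B + r \<and> (r = 0 \<or> degree r < degree B)"
proof (induction "degree A" arbitrary: A rule: less_induct)
  case less
  show ?case
  proof (cases "A = 0 \<or> degree A < degree B")
    case True
    then show ?thesis by (intro exI[of _ 0] exI[of _ A]) auto
  next
    case False
    let ?M = "monom (lead_coeff A / lead_coeff B) (degree A - degree B)"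
    have dM: "degree ?M = degree A - degree B" "?M \<noteq> 0" using False assms by (auto simp: degree_monom_eq)
    let ?A = "A - op_mult d ?M B"
    have dd: "degree (op_mult d ?M B) = degree A" using degree_op_mult[OF dM(2) assms] dM(1) False by simp
    have "coeff (op_mult d ?M B) (degree A) = lead_coeff A"
      using coeff_op_mult_top[of ?M B] dM(1) False assms by simp
    then have c: "coeff ?A (degree A) = 0" by simp
    have le: "degree ?A \<le> degree A" using dd degree_diff_le_max[of A "op_mult d ?M B"] by simp
    show ?thesis
    proof (cases "?A = 0")
      case True
      then show ?thesis by (intro exI[of _ ?M] exI[of _ 0]) simp
    next
      case False
      then have "degree ?A < degree A" using le c by (metis le_neq_implies_less leading_coeff_0_iff)
      then obtain Q r where Q: "?A = op_mult d Q B + r" "r = 0 \<or> degree r < degree B" using less by blast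
      have "A = ?A + op_mult d ?M B" by simp
      also have "\<dots> = op_mult d (Q + ?M) B + r" unfolding Q(1) op_mult_add_left by (simp only: ac_simps)
      finally show ?thesis using Q(2) by blast
    qed
  qed
qed

lemma op_mult_right_unit:
  assumes "op_mult d A B = 1"
  obtains b where "b \<noteq> 0" "B = [:b:]"
proof -
  have "A \<noteq> 0" "B \<noteq> 0" using assms by auto
  then have "degree B = 0" using degree_op_mult[of A B] assms by simp
  then obtain b where "B = [:b:]" by (rule degree_eq_zeroE)
  with \<open>B \<noteq> 0\<close> show ?thesis by (intro that) auto
qed

end

section \<open>Differential ideals\<close>

lemma diff_ideal_gen_closed:
  shows "0 \<in> diff_ideal_gen d A X"
    and "f \<in> diff_ideal_gen d A X \<Longrightarrow> g \<in> diff_ideal_gen d A X \<Longrightarrow> f + g \<in> diff_ideal_gen d A X"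
    and "a \<in> A \<Longrightarrow> f \<in> diff_ideal_gen d A X \<Longrightarrow> a * f \<in> diff_ideal_gen d A X"
    and "f \<in> diff_ideal_gen d A X \<Longrightarrow> dd d f \<in> diff_ideal_gen d A X"
    and "x \<in> X \<Longrightarrow> x \<in> diff_ideal_gen d A X"
  unfolding diff_ideal_gen_def diff_ideal_def by blast+

lemma diff_ideal_gen_least: "diff_ideal d A I \<Longrightarrow> X \<subseteq> I \<Longrightarrow> diff_ideal_gen d A X \<subseteq> I"
  unfolding diff_ideal_gen_def by blast

lemma diff_ideal_gen_sum:
  "(\<And>x. x \<in> S \<Longrightarrow> f x \<in> diff_ideal_gen d A X) \<Longrightarrow> sum f S \<in> diff_ideal_gen d A X"
  by (induction S rule: infinite_finite_induct) (auto intro: diff_ideal_gen_closed)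

lemma ring_D_closed:
  fixes f g :: "'a::comm_ring_1 dpol"
  shows "f \<in> ring_D n \<Longrightarrow> g \<in> ring_D n \<Longrightarrow> f + g \<in> ring_D n"
    "f \<in> ring_D n \<Longrightarrow> g \<in> ring_D n \<Longrightarrow> f * g \<in> ring_D n"
    "f \<in> ring_D n \<Longrightarrow> g \<in> ring_D n \<Longrightarrow> f - g \<in> ring_D n"
    "f \<in> ring_D n \<Longrightarrow> - f \<in> ring_D n"
    "Const a \<in> ring_D n" "0 \<in> (ring_D n :: 'a dpol set)" "1 \<in> (ring_D n :: 'a dpol set)"
    "f \<in> ring_D n \<Longrightarrow> f ^ k \<in> ring_D n"
proof -
  have m: "f * g \<in> ring_D n" if "f \<in> ring_D n" "g \<in> ring_D n" for f g :: "'a dpol"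
    using vars_mult[of f g] that by (auto simp: ring_D_def)
  then show "f \<in> ring_D n \<Longrightarrow> g \<in> ring_D n \<Longrightarrow> f * g \<in> ring_D n" by blast
  have "f \<in> ring_D n \<Longrightarrow> f ^ k \<in> ring_D n" for k
    by (induction k) (auto simp: m, simp add: ring_D_def)
  then show "f \<in> ring_D n \<Longrightarrow> f ^ k \<in> ring_D n" .
  show "f \<in> ring_D n \<Longrightarrow> g \<in> ring_D n \<Longrightarrow> f + g \<in> ring_D n"
    "f \<in> ring_D n \<Longrightarrow> g \<in> ring_D n \<Longrightarrow> f - g \<in> ring_D n"
    using vars_add[of f g] vars_diff[of f g] by (auto simp: ring_D_def)
qed (auto simp: ring_D_def)

lemma dnext_Cvars: "dnext ` Cvars n \<subseteq> Cvars n"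
  by (auto simp: Cvars_def)

lemma dnext_Uvars: "dnext ` Uvars n \<subseteq> Uvars n"
  by (auto simp: Uvars_def)

lemma CV_in_Cvars [simp]: "CV i k \<in> Cvars n \<longleftrightarrow> i \<in> {1..n}" "UV j k \<notin> Cvars n"
  by (auto simp: Cvars_def)

lemma UV_in_Uvars [simp]: "UV j k \<in> Uvars n \<longleftrightarrow> j \<in> {1..n - 1}" "CV i k \<notin> Uvars n"
  by (auto simp: Uvars_def)

lemma comm_ring_hom_comp:
  assumes "comm_ring_hom F" "comm_ring_hom G"
  shows "comm_ring_hom (\<lambda>x. F (G x))"
proof -
  interpret F: comm_ring_hom F by fact
  interpret G: comm_ring_hom G by fact
  show ?thesis by unfold_locales (simp_all add: F.hom_add F.hom_mult G.hom_add G.hom_mult)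
qed

context diff_ring
begin

lemma ring_D_dd: "f \<in> ring_D n \<Longrightarrow> dd d f \<in> ring_D n"
  unfolding ring_D_def by (auto dest: subsetD[OF vars_dd[OF _ dnext_Cvars], rotated])

lemma hom_op_apply:
  assumes h: "comm_ring_hom F" and c: "\<And>a. F (Const a) = Const a" and dd: "\<And>f. F (dd d f) = dd d (F f)"
  shows "F (op_apply d A f) = op_apply d A (F f)"
proof -
  interpret F: comm_ring_hom F by fact
  have "F ((dd d ^^ k) f) = (dd d ^^ k) (F f)" for k
    by (induction k) (simp_all add: dd)
  then show ?thesis by (simp add: op_apply_def F.hom_sum F.hom_mult c)
qed

lemma diff_ideal_gen_ddpow: "f \<in> diff_ideal_gen d A X \<Longrightarrow> (dd d ^^ k) f \<in> diff_ideal_gen d A X"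
  by (induction k) (auto intro: diff_ideal_gen_closed)

lemma diff_ideal_gen_op_apply:
  "(\<And>a. Const a \<in> A) \<Longrightarrow> f \<in> diff_ideal_gen d A X \<Longrightarrow> op_apply d L f \<in> diff_ideal_gen d A X"
  unfolding op_apply_def by (intro diff_ideal_gen_sum diff_ideal_gen_closed(3) diff_ideal_gen_ddpow)

end

section \<open>The substitution \<open>phi\<close> and the ideal as its kernel\<close>

locale linear_system = diff_field d for d :: "'k::field_char_0 \<Rightarrow> 'k" +
  fixes n :: nat and G :: "nat \<Rightarrow> nat \<Rightarrow> 'k poly"
begin

definition H :: "nat \<Rightarrow> 'k dpol" where
  "H i = (\<Sum>j=1..n - 1. op_apply d (G i j) (Var (UV j 0)))"

definition sys :: "nat \<Rightarrow> 'k dpol" where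
  "sys i = Var (CV i 0) + H i"

fun phi_var :: "dvar \<Rightarrow> 'k dpol" where
  "phi_var (CV i k) = - (dd d ^^ k) (H i)"
| "phi_var (UV j k) = Var (UV j k)"

definition phi :: "'k dpol \<Rightarrow> 'k dpol" where
  "phi = mp_eval Const phi_var"

lemma phi_hom: "comm_ring_hom phi"
  unfolding phi_def by (rule comm_ring_hom.comm_ring_hom_mp_eval[OF comm_ring_hom_Const])

sublocale phi: comm_ring_hom phi
  by (rule phi_hom)

lemma phi_Const [simp]: "phi (Const a) = Const a"
  unfolding phi_def by (rule comm_ring_hom.mp_eval_Const[OF comm_ring_hom_Const])

lemma phi_Var [simp]: "phi (Var v) = phi_var v"
  unfolding phi_def by (rule comm_ring_hom.mp_eval_Var[OF comm_ring_hom_Const])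

lemma phi_dd: "phi (dd d f) = dd d (phi f)"
proof (rule hom_dd[where X = UNIV])
  show "phi (Var (dnext v)) = dd d (phi (Var v))" for v
    by (cases v) (simp_all add: dd_uminus)
qed (simp_all add: phi_hom)

lemma phi_op_apply: "phi (op_apply d A f) = op_apply d A (phi f)"
  by (rule hom_op_apply) (simp_all add: phi_hom phi_dd)

lemma phi_H: "phi (H i) = H i"
  by (simp add: H_def phi.hom_sum phi_op_apply)

lemma phi_sys: "phi (sys i) = 0"
  by (simp add: sys_def phi.hom_add phi_H)

lemma linform_H: "linform (H i)"
  unfolding H_def by (intro linform_sum linform_op_apply) simp

lemma linform_phi_var: "linform (phi_var v)"
  by (cases v) (auto intro: linform_uminus linform_ddpow linform_H)

lemma vars_H: "vars (H i) \<subseteq> Uvars n"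
proof -
  have "vars (op_apply d (G i j) (Var (UV j 0))) \<subseteq> Uvars n" if "j \<in> {1..n - 1}" for j
    using that by (intro vars_op_apply dnext_Uvars) auto
  then show ?thesis
    using vars_sum[of "\<lambda>j. op_apply d (G i j) (Var (UV j 0))" "{1..n - 1}"] unfolding H_def by blast
qed

lemma vars_phi_var: "vars (phi_var (CV i k)) \<subseteq> Uvars n"
  using vars_ddpow[OF vars_H dnext_Uvars] by simp

lemma vars_sys: "i \<in> {1..n} \<Longrightarrow> vars (sys i) \<subseteq> Cvars n \<union> Uvars n"
  using vars_H[of i] vars_add[of "Var (CV i 0)" "H i"] by (auto simp: sys_def)

text \<open>The kernel of \<open>phi\<close> is a differential ideal containing the system.
  Conversely, a derivative of \<open>c_i\<close> differs from its image by the same derivative of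
  \<open>sys i\<close>, so \<open>f\<close> and \<open>phi f\<close> agree modulo the ideal.\<close>

lemma mem_ID_iff: "f \<in> ID d n sys \<longleftrightarrow> f \<in> ring_D n \<and> phi f = 0"
proof (intro iffI conjI)
  let ?X = "Cvars n \<union> Uvars n"
  assume f: "f \<in> ID d n sys"
  then show "f \<in> ring_D n" by (simp add: ID_def)
  have "diff_ideal d (ring_DU n) {f \<in> ring_DU n. phi f = 0}"
  proof -
    have c: "vars (f + g) \<subseteq> ?X" "vars (f * g) \<subseteq> ?X"
      if "vars f \<subseteq> ?X" "vars g \<subseteq> ?X" for f g :: "'k dpol"
      using vars_add[of f g] vars_mult[of f g] that by blast+
    have c': "vars (dd d f) \<subseteq> ?X" if "vars f \<subseteq> ?X" for f
      using dnext_Cvars[of n] dnext_Uvars[of n] by (intro vars_dd that) blast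
    show ?thesis unfolding diff_ideal_def ring_DU_def
      by (intro conjI ballI) (simp_all add: phi.hom_add phi.hom_mult phi_dd c c', blast)
  qed
  moreover have "sys ` {1..n} \<subseteq> {f \<in> ring_DU n. phi f = 0}"
    using vars_sys by (simp add: image_subset_iff ring_DU_def phi_sys)
  ultimately show "phi f = 0"
    using f diff_ideal_gen_least unfolding ID_def by blast
next
  let ?I = "diff_ideal_gen d (ring_DU n) (sys ` {1..n})"
  assume f: "f \<in> ring_D n \<and> phi f = 0"
  have "f - phi f \<in> ?I"
  proof (rule hom_diff_in_ideal[where X = "Cvars n" and Y = "Cvars n \<union> Uvars n"])
    show "vars f \<subseteq> Cvars n" using f by (simp add: ring_D_def)
    show "vars (phi (Var v)) \<subseteq> Cvars n \<union> Uvars n" if "v \<in> Cvars n" for v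
      using that vars_phi_var by (cases v) auto
    show "Var v - phi (Var v) \<in> ?I" if "v \<in> Cvars n" for v
    proof -
      from that obtain i k where v: "v = CV i k" "i \<in> {1..n}" by (auto simp: Cvars_def)
      then have *: "Var v - phi (Var v) = (dd d ^^ k) (sys i)"
        by (simp add: sys_def ddpow_add ddpow_CV)
      show ?thesis unfolding *
        by (rule diff_ideal_gen_ddpow, rule diff_ideal_gen_closed(5)) (use v in auto)
    qed
  qed (auto simp: phi_hom ring_DU_def intro: diff_ideal_gen_closed(1-3))
  then show "f \<in> ID d n sys" using f by (simp add: ID_def)
qed

text \<open>A right inverse of \<open>phi\<close> on the linear forms extends to a substitution \<open>f \<mapsto> \<chi> f\<close> which moves
  \<open>f\<close> only by elements of the ideal and which factors through \<open>phi\<close>.\<close>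

lemma kernel_in_ideal:
  assumes I: "0 \<in> I" "\<And>f g. f \<in> I \<Longrightarrow> g \<in> I \<Longrightarrow> f + g \<in> I"
      "\<And>f g. vars f \<subseteq> X \<Longrightarrow> g \<in> I \<Longrightarrow> f * g \<in> I"
    and lin: "\<And>v. linform v \<Longrightarrow> vars v \<subseteq> X \<Longrightarrow> phi v = 0 \<Longrightarrow> v \<in> I"
    and f: "vars f \<subseteq> X" "phi f = 0"
  shows "f \<in> I"
proof -
  let ?sc = "\<lambda>a f. Const (a::'k) * (f :: 'k dpol)"
  interpret vs: vector_space ?sc
    by unfold_locales (simp_all add: algebra_simps Const_add Const_mult)
  interpret vp: vector_space_pair ?sc ?sc ..
  let ?V = "{v :: 'k dpol. linform v \<and> vars v \<subseteq> X}"
  have lphi: "Vector_Spaces.linear ?sc ?sc phi"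
    unfolding Vector_Spaces.linear_iff
    by (simp add: phi.hom_add phi.hom_mult vs.vector_space_axioms)
  have subV: "vs.subspace ?V"
  proof (rule vs.subspaceI)
    show "x + y \<in> ?V" if "x \<in> ?V" "y \<in> ?V" for x y
      using that vars_add[of x y] by (auto intro: linform_add)
    show "?sc a x \<in> ?V" if "x \<in> ?V" for x a
      using that vars_Const_mult[of a x] by (auto intro: linform_Const_mult)
  qed simp
  obtain g where g: "range g \<subseteq> ?V" "Vector_Spaces.linear ?sc ?sc g" "\<And>v. v \<in> phi ` ?V \<Longrightarrow> phi (g v) = v"
    using vp.linear_exists_right_inverse_on[OF lphi subV] by blast
  interpret g: Vector_Spaces.linear ?sc ?sc g by (rule g(2))
  define \<chi> where "\<chi> = mp_eval Const (\<lambda>v. g (phi_var v))"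
  define \<psi> where "\<psi> = mp_eval Const (\<lambda>v. g (Var v))"
  have hom: "comm_ring_hom \<chi>" "comm_ring_hom \<psi>"
    unfolding \<chi>_def \<psi>_def by (rule comm_ring_hom.comm_ring_hom_mp_eval[OF comm_ring_hom_Const])+
  interpret \<psi>: comm_ring_hom \<psi> by (rule hom)
  have c: "\<chi> (Const a) = Const a" "\<psi> (Const a) = Const a" "\<chi> (Var v) = g (phi_var v)" "\<psi> (Var v) = g (Var v)" for a v
    unfolding \<chi>_def \<psi>_def
    by (rule comm_ring_hom.mp_eval_Const[OF comm_ring_hom_Const] comm_ring_hom.mp_eval_Var[OF comm_ring_hom_Const])+
  \<comment> \<open>On linear forms \<open>\<psi>\<close> and \<open>g\<close> agree by linearity
    alone. The single variables in the expansion of \<open>phi_var v\<close> may lie outside the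
    image of \<open>phi\<close>, where \<open>g\<close> is some linear map.\<close>
  have "\<psi> (phi_var v) = g (phi_var v)" for v
  proof -
    let ?T = "vars (phi_var v)"
    have "\<psi> (phi_var v) = (\<Sum>w\<in>?T. Const (lc (phi_var v) w) * g (Var w))"
      using linform_hom[OF hom(2) linform_phi_var finite_vars order_refl] by (simp add: c)
    also have "\<dots> = g (\<Sum>w\<in>?T. Const (lc (phi_var v) w) * Var w)"
      by (simp add: g.sum g.scale)
    also have "\<dots> = g (phi_var v)"
      using linform_as_sum[OF linform_phi_var[of v] finite_vars order_refl] by simp
    finally show ?thesis .
  qed
  then have "\<chi> f = \<psi> (phi f)"
    using mpol_hom_eqI[OF hom(1) comm_ring_hom_comp[OF hom(2) phi_hom], of f UNIV] by (simp add: c)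
  then have "\<chi> f = 0" using f by simp
  moreover have "f - \<chi> f \<in> I"
  proof (rule hom_diff_in_ideal[where X = X and Y = X])
    show "vars (\<chi> (Var v)) \<subseteq> X" if "v \<in> X" for v
      using g(1) by (auto simp: c)
    show "Var v - \<chi> (Var v) \<in> I" if "v \<in> X" for v
    proof (rule lin)
      have gv: "linform (g (phi_var v))" "vars (g (phi_var v)) \<subseteq> X" using g(1) by auto
      then show "linform (Var v - \<chi> (Var v))" unfolding c by (intro linform_diff) simp_all
      show "vars (Var v - \<chi> (Var v)) \<subseteq> X"
        using vars_diff[of "Var v" "g (phi_var v)"] gv(2) that by (auto simp: c)
      have "phi_var v \<in> phi ` ?V" using that by (intro image_eqI[of _ _ "Var v"]) auto
      then show "phi (Var v - \<chi> (Var v)) = 0" by (simp add: c phi.hom_minus g(3))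
    qed
  qed (use I f hom c in auto)
  ultimately show ?thesis by simp
qed

section \<open>Syzygies\<close>

definition syz :: "(nat \<Rightarrow> 'k poly) \<Rightarrow> bool" where
  "syz F \<longleftrightarrow> (\<forall>j\<in>{1..n - 1}. (\<Sum>i=1..n. op_mult d (F i) (G i j)) = 0)"

definition cform :: "(nat \<Rightarrow> 'k poly) \<Rightarrow> 'k dpol" where
  "cform F = (\<Sum>i=1..n. op_apply d (F i) (Var (CV i 0)))"

lemma linform_cform: "linform (cform F)"
  unfolding cform_def by (intro linform_sum linform_op_apply) simp

lemma lc_cform: "lc (cform F) (CV i k) = (if i \<in> {1..n} then coeff (F i) k else 0)"
  "lc (cform F) (UV j k) = 0"
  by (simp_all add: cform_def lc_sum lc_op_apply_Var)

lemma vars_cform: "vars (cform F) = {CV i k | i k. i \<in> {1..n} \<and> coeff (F i) k \<noteq> 0}"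
proof -
  have "v \<in> vars (cform F) \<longleftrightarrow> v \<in> {CV i k | i k. i \<in> {1..n} \<and> coeff (F i) k \<noteq> 0}" for v
    unfolding vars_linform[OF linform_cform] by (cases v) (auto simp: lc_cform)
  then show ?thesis by (rule Set.set_eqI)
qed

lemma cform_in_ring_D: "cform F \<in> ring_D n"
  by (auto simp: ring_D_def vars_cform)

lemma cform_eqD: "cform F = cform F' \<Longrightarrow> i \<in> {1..n} \<Longrightarrow> F i = F' i"
proof (rule poly_eqI)
  fix k assume "cform F = cform F'" "i \<in> {1..n}"
  then show "coeff (F i) k = coeff (F' i) k"
    using lc_cform(1)[of F i k] lc_cform(1)[of F' i k] by simp
qed

lemma op_apply_cform: "op_apply d E (cform F) = cform (\<lambda>i. op_mult d E (F i))"
  by (simp add: cform_def op_apply_sum_right op_apply_mult)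

lemma lc_phi_cform:
  "lc (phi (cform F)) (UV j k) = (if j \<in> {1..n - 1} then - coeff (\<Sum>i=1..n. op_mult d (F i) (G i j)) k else 0)"
  "lc (phi (cform F)) (CV i k) = 0"
proof -
  have *: "phi (cform F) = - (\<Sum>i=1..n. \<Sum>j=1..n - 1. op_apply d (op_mult d (F i) (G i j)) (Var (UV j 0)))"
    by (simp add: cform_def phi.hom_sum phi_op_apply op_apply_uminus H_def op_apply_sum_right op_apply_mult sum_negf)
  show "lc (phi (cform F)) (UV j k) = (if j \<in> {1..n - 1} then - coeff (\<Sum>i=1..n. op_mult d (F i) (G i j)) k else 0)"
    by (auto simp: * lc_uminus lc_sum lc_op_apply_Var coeff_sum)
  show "lc (phi (cform F)) (CV i k) = 0"
    by (simp add: * lc_uminus lc_sum lc_op_apply_Var)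
qed

lemma linform_phi_cform: "linform (phi (cform F))"
  unfolding cform_def phi.hom_sum phi_op_apply by (intro linform_sum linform_op_apply) (simp add: linform_uminus linform_H)

lemma phi_cform_eq_0: "phi (cform F) = 0 \<longleftrightarrow> syz F"
proof
  assume "phi (cform F) = 0"
  then show "syz F" unfolding syz_def
    using lc_phi_cform(1)[of F] by (intro ballI poly_eqI) (force split: if_splits)
next
  assume "syz F"
  show "phi (cform F) = 0"
  proof (rule linform_eqI[OF linform_phi_cform linform_0])
    show "lc (phi (cform F)) v = lc 0 v" for v
      using \<open>syz F\<close> by (cases v) (auto simp: lc_phi_cform syz_def)
  qed
qed

lemma linform_eq_cform:
  assumes "linform v" "v \<in> ring_D n"
  obtains F where "v = cform F"
proof -
  define F where "F i = (\<Sum>k | CV i k \<in> vars v. monom (lc v (CV i k)) k)" for i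
  have fin: "finite {k. CV i k \<in> vars v}" for i
    using finite_vimageI[OF finite_vars[of v], of "CV i"] by (simp add: vimage_def inj_def)
  have "coeff (F i) k = lc v (CV i k)" for i k
    using vars_linform[OF assms(1)] fin[of i] by (auto simp: F_def coeff_sum)
  moreover have "lc v w = 0" if "w \<notin> Cvars n" for w
    using that assms vars_linform[OF assms(1)] by (auto simp: ring_D_def)
  ultimately have "v = cform F"
    by (intro linform_eqI assms linform_cform) (metis CV_in_Cvars dvar.exhaust lc_cform)
  then show ?thesis by (rule that)
qed

end

section \<open>Units\<close>

text \<open>\<open>hgrade\<close> multiplies every variable by a new one, so its degree is the total degree.\<close>

definition hgrade :: "'a::comm_ring_1 dpol \<Rightarrow> 'a dpol poly" where
  "hgrade = mp_eval (\<lambda>a. [:Const a:]) (\<lambda>v. monom (Var v) 1)"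

lemma comm_ring_hom_Const_poly: "comm_ring_hom (\<lambda>a::'a::comm_ring_1. [:Const a :: ('v, 'a) mpol:])"
  by unfold_locales (simp_all add: Const_add Const_mult one_pCons)

lemma hgrade_hom: "comm_ring_hom hgrade"
  unfolding hgrade_def by (rule comm_ring_hom.comm_ring_hom_mp_eval[OF comm_ring_hom_Const_poly])

lemma hgrade_Const: "hgrade (Const a) = [:Const a:]"
  unfolding hgrade_def by (rule comm_ring_hom.mp_eval_Const[OF comm_ring_hom_Const_poly])

lemma hgrade_Var: "hgrade (Var v) = monom (Var v) 1"
  unfolding hgrade_def by (rule comm_ring_hom.mp_eval_Var[OF comm_ring_hom_Const_poly])

lemma poly_hgrade_hom: "comm_ring_hom (\<lambda>f. poly (hgrade f) x)"
proof -
  interpret h: comm_ring_hom "hgrade :: 'a dpol \<Rightarrow> _" by (rule hgrade_hom)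
  show ?thesis by unfold_locales (simp_all add: h.hom_add h.hom_mult)
qed

lemma poly_hgrade_1: "poly (hgrade f) 1 = f"
proof -
  have "comm_ring_hom (\<lambda>f :: 'a dpol. f)" by unfold_locales auto
  from mpol_hom_eqI[OF poly_hgrade_hom[of 1] this, of f UNIV] show ?thesis
    by (simp add: hgrade_Const hgrade_Var poly_monom)
qed

text \<open>If \<open>hgrade f\<close> is constant, its values at 1 and at 0 coincide; the first is
  \<open>f\<close>, and the second contains no variables.\<close>

lemma degree_hgrade_0:
  assumes "degree (hgrade f) = 0"
  shows "\<exists>a. f = Const a"
proof -
  obtain h where h: "hgrade f = [:h:]" using assms by (rule degree_eq_zeroE)
  then have "f = poly (hgrade f) 0" using poly_hgrade_1[of f] by simp
  moreover have "vars (poly (hgrade f) 0) \<subseteq> {}"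
    by (rule vars_hom[OF poly_hgrade_hom, where X = UNIV]) (simp_all add: hgrade_Const hgrade_Var poly_monom)
  ultimately show ?thesis using vars_empty_iff[of f] by simp
qed

lemma unit_in_D_iff: "unit_in_D n f \<longleftrightarrow> (\<exists>a. a \<noteq> 0 \<and> f = Const (a :: 'k::field_char_0))"
proof
  assume "unit_in_D n f"
  then obtain g where g: "f * g = 1" by (auto simp: unit_in_D_def)
  interpret h: comm_ring_hom "hgrade :: 'k dpol \<Rightarrow> _" by (rule hgrade_hom)
  have e: "hgrade f * hgrade g = 1" using h.hom_mult[of f g] g by simp
  then have "hgrade f \<noteq> 0" "hgrade g \<noteq> 0" by auto
  then have "degree (hgrade f) = 0" using degree_mult_eq[of "hgrade f" "hgrade g"] e by simp
  then obtain a where "f = Const a" using degree_hgrade_0 by blast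
  moreover have "f \<noteq> 0" using g by auto
  ultimately show "\<exists>a. a \<noteq> 0 \<and> f = Const a" by auto
next
  assume "\<exists>a. a \<noteq> 0 \<and> f = Const a"
  then obtain a where a: "a \<noteq> 0" "f = Const a" by blast
  then have "f * Const (inverse a) = 1" by (simp flip: Const_mult)
  then show "unit_in_D n f" using a unfolding unit_in_D_def by (blast intro: ring_D_closed)
qed

text \<open>Since \<open>hgrade A = monom A 1\<close> has degree 1 and degrees add in a domain, one
  of two factors of \<open>A\<close> has total degree 0.\<close>

lemma irreducible_linform:
  fixes A :: "'k::field_char_0 dpol"
  assumes "linform A" "A \<noteq> 0" "A \<in> ring_D n"
  shows "irreducible_in_D n A"
proof -
  interpret h: comm_ring_hom "hgrade :: 'k dpol \<Rightarrow> _" by (rule hgrade_hom)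
  have "hgrade A = (\<Sum>v\<in>vars A. [:Const (lc A v):] * monom (Var v) 1)"
    using linform_hom[OF hgrade_hom assms(1) finite_vars order_refl] by (simp add: hgrade_Const hgrade_Var)
  also have "\<dots> = monom (\<Sum>v\<in>vars A. Const (lc A v) * Var v) 1"
    by (simp add: smult_monom monom_sum)
  also have "(\<Sum>v\<in>vars A. Const (lc A v) * Var v) = A"
    using linform_as_sum[OF assms(1) finite_vars order_refl] by simp
  finally have hA: "hgrade A = monom A 1" .
  then have dA: "degree (hgrade A) = 1" using assms(2) by (simp add: degree_monom_eq)
  have "\<not> unit_in_D n A"
    using dA by (auto simp: unit_in_D_iff hgrade_Const)
  moreover have "unit_in_D n f \<or> unit_in_D n g" if "A = f * g" for f g
  proof -
    have nz: "f \<noteq> 0" "g \<noteq> 0" using that assms(2) by auto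
    have m: "hgrade A = hgrade f * hgrade g" by (simp add: that h.hom_mult)
    then have "hgrade f \<noteq> 0" "hgrade g \<noteq> 0" using hA assms(2) by auto
    then have "degree (hgrade f) + degree (hgrade g) = 1" using dA m by (simp add: degree_mult_eq)
    then have "degree (hgrade f) = 0 \<or> degree (hgrade g) = 0" by linarith
    then show ?thesis using degree_hgrade_0 nz unfolding unit_in_D_iff by (metis Const_0)
  qed
  ultimately show ?thesis using assms by (auto simp: irreducible_in_D_def)
qed

section \<open>Leaders\<close>

lemma ranking_trans:
  assumes "ranking n lt" "u \<in> Cvars n" "v \<in> Cvars n" "w \<in> Cvars n" "lt u v" "lt v w"
  shows "lt u w"
  using assms unfolding ranking_def by blast

lemma ranking_total:
  assumes "ranking n lt" "u \<in> Cvars n" "v \<in> Cvars n" "u \<noteq> v"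
  shows "lt u v \<or> lt v u"
  using assms unfolding ranking_def by blast

lemma ranking_max:
  assumes lt: "ranking n lt" and "finite V" "V \<noteq> {}" "V \<subseteq> Cvars n"
  shows "\<exists>v\<in>V. \<forall>w\<in>V. w \<noteq> v \<longrightarrow> lt w v"
  using assms(2-4)
proof (induction rule: finite_ne_induct)
  case (insert x F)
  then obtain v where v: "v \<in> F" "\<forall>w\<in>F. w \<noteq> v \<longrightarrow> lt w v" by auto
  have C: "x \<in> Cvars n" "v \<in> Cvars n" "F \<subseteq> Cvars n" "x \<noteq> v" using insert v by auto
  then consider "lt x v" | "lt v x" using ranking_total[OF lt] by blast
  then show ?case
  proof cases
    case 2
    have "lt w x" if "w \<in> F" for w
      using v(2) that 2 C ranking_trans[OF lt, of w v x] by (cases "w = v") blast+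
    then show ?thesis by (intro bexI[of _ x]) auto
  qed (use v in auto)
qed auto

lemma ranking_asym:
  assumes "ranking n lt" "u \<in> Cvars n" "v \<in> Cvars n" "lt u v"
  shows "\<not> lt v u"
  using assms unfolding ranking_def by blast

lemma leader_props:
  assumes lt: "ranking n lt" and f: "f \<in> ring_D n" "vars f \<noteq> {}"
  shows "leader lt f \<in> vars f" "\<And>w. w \<in> vars f \<Longrightarrow> w \<noteq> leader lt f \<Longrightarrow> lt w (leader lt f)"
proof -
  have V: "vars f \<subseteq> Cvars n" using f by (simp add: ring_D_def)
  obtain v where v: "v \<in> vars f" "\<forall>w\<in>vars f. w \<noteq> v \<longrightarrow> lt w v"
    using ranking_max[OF lt finite_vars f(2) V] by blast
  have "leader lt f = v" unfolding leader_def
  proof (rule the_equality)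
    fix u assume u: "u \<in> vars f \<and> (\<forall>w\<in>vars f. w \<noteq> u \<longrightarrow> lt w u)"
    show "u = v"
    proof (rule ccontr)
      assume "u \<noteq> v"
      then have "lt u v" "lt v u" using u v by auto
      then show False using ranking_asym[OF lt, of u v] u v V by blast
    qed
  qed (use v in auto)
  then show "leader lt f \<in> vars f" "\<And>w. w \<in> vars f \<Longrightarrow> w \<noteq> leader lt f \<Longrightarrow> lt w (leader lt f)"
    using v by auto
qed

lemma ranking_CV_less:
  assumes lt: "ranking n lt" and i: "i \<in> {1..n}" and "k < k'"
  shows "lt (CV i k) (CV i k')"
  using assms(3)
proof (induction k')
  case (Suc k')
  have s: "lt (CV i k') (CV i (Suc k'))" 
  proof -
    have "\<forall>v\<in>Cvars n. lt v (dnext v)" using lt unfolding ranking_def by blast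
    then show ?thesis using i by (metis CV_in_Cvars(1) dnext.simps(1))
  qed
  show ?case
  proof (cases "k = k'")
    case False
    then have "lt (CV i k) (CV i k')" using Suc by simp
    then show ?thesis using ranking_trans[OF lt _ _ _ _ s] i by simp
  qed (use s in simp)
qed simp

lemma partial_deriv_linform:
  assumes "linform f"
  shows "partial_deriv w f = Const (lc f w :: 'a::comm_ring_1)"
proof -
  have s: "partial_deriv w (sum g T) = (\<Sum>x\<in>T. partial_deriv w (g x))" for g :: "'b \<Rightarrow> ('b, 'a) mpol" and T
    by (rule additive_sum) (simp_all add: partial_deriv_add)
  have "partial_deriv w f = partial_deriv w (\<Sum>v\<in>vars f. Const (lc f v) * Var v)"
    using linform_as_sum[OF assms finite_vars order_refl] by simp
  also have "\<dots> = Const (\<Sum>v\<in>vars f. lc f v * (if v = w then 1 else 0))"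
    by (simp add: s partial_deriv_mult partial_deriv_Var Const_sum Const_mult cong: if_cong) (auto intro!: sum.cong)
  also have "\<dots> = Const (lc f w)"
  proof -
    have "w \<in> vars f \<longleftrightarrow> lc f w \<noteq> 0" using vars_linform[OF assms] by blast
    then show ?thesis by (simp add: mult_delta)
  qed
  finally show ?thesis .
qed

lemma coeff_in_linform:
  assumes f: "linform f" and v: "lc f v \<noteq> 0"
  shows "coeff_in {v} (Poly_Mapping.single v 1) f = Const (lc f v :: 'a::comm_ring_1)"
proof -
  let ?S = "{t \<in> Poly_Mapping.keys f. \<forall>u\<in>{v}. Poly_Mapping.lookup t u = Poly_Mapping.lookup (Poly_Mapping.single v 1) u}"
  have "?S = {Poly_Mapping.single v 1}"
  proof -
    have "t = Poly_Mapping.single v 1" if t: "t \<in> Poly_Mapping.keys f" "Poly_Mapping.lookup t v = 1" for t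
    proof -
      obtain w where w: "t = Poly_Mapping.single w 1" using f t by (auto simp: linform_def)
      then have "w = v" using t(2) by (simp add: lookup_single when_def split: if_splits)
      with w show ?thesis by simp
    qed
    then have "?S \<subseteq> {Poly_Mapping.single v 1}" by (intro subsetI) (simp only: mem_Collect_eq ball_simps lookup_single_eq singleton_iff)
    moreover have "Poly_Mapping.single v 1 \<in> ?S" using v by (simp add: lc_def in_keys_iff)
    ultimately show ?thesis by blast
  qed
  then show ?thesis unfolding coeff_in_def by (simp add: Const_def lc_def)
qed

lemma initial_of_linform:
  assumes f: "linform f" and v: "lc f (leader lt f) \<noteq> (0::'a::comm_ring_1)"
  shows "initial_of lt f = Const (lc f (leader lt f))"
proof -
  let ?v = "leader lt f"
  let ?E = "(\<lambda>t. Poly_Mapping.lookup t ?v) ` Poly_Mapping.keys f"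
  have k: "Poly_Mapping.single ?v 1 \<in> Poly_Mapping.keys f" using v by (simp add: lc_def in_keys_iff)
  have "Max ?E = 1"
  proof (rule Max_eqI)
    show "y \<le> 1" if "y \<in> ?E" for y
      using that f by (fastforce simp: linform_def lookup_single when_def)
    show "1 \<in> ?E" using k by (intro image_eqI[OF _ k]) simp
  qed simp
  then show ?thesis unfolding initial_of_def Let_def using coeff_in_linform[OF f v] by simp
qed

lemma vars_coeff_in: "vars (coeff_in W m f) \<subseteq> vars (f :: ('v, 'a::comm_monoid_add) mpol)"
proof -
  have "vars (Poly_Mapping.single (t - m) (Poly_Mapping.lookup f t)) \<subseteq> vars f" if "t \<in> Poly_Mapping.keys f" for t
  proof -
    have "Poly_Mapping.keys (t - m) \<subseteq> Poly_Mapping.keys t" by (auto simp: in_keys_iff lookup_minus)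
    then show ?thesis using that by (auto simp: vars_def)
  qed
  then show ?thesis unfolding coeff_in_def
    by (intro order_trans[OF vars_sum]) blast
qed

lemma (in diff_ring) diff_ideal_gen_singleton:
  assumes "f \<in> diff_ideal_gen d (ring_D n) {h}" "h \<in> ring_D n"
  shows "\<exists>g q. f = (\<Sum>l<(q::nat). g l * (dd d ^^ l) h)"
proof -
  \<comment> \<open>The clause that \<open>g\<close> vanishes from \<open>q\<close> on allows two
    sums to be extended to a common length. Differentiation moves \<open>g m\<close> to index
    \<open>m + 1\<close>, whence the length \<open>Suc q\<close> below.\<close>
  let ?I = "{f \<in> ring_D n. \<exists>g q. f = (\<Sum>l<(q::nat). g l * (dd d ^^ l) h) \<and> (\<forall>l\<ge>q. g l = 0)}"
  have memI: "f \<in> ?I" if "f \<in> ring_D n" "f = (\<Sum>l<q. g l * (dd d ^^ l) h)" "\<forall>l\<ge>q. g l = 0" for f g and q :: nat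
    using that by blast
  have "diff_ideal d (ring_D n) ?I"
    unfolding diff_ideal_def
  proof (intro conjI ballI)
    show "0 \<in> ?I" by (auto simp: ring_D_closed intro!: exI[of _ "\<lambda>_. 0"])
  next
    fix x y assume "x \<in> ?I" "y \<in> ?I"
    then obtain g q g' q' where x: "x = (\<Sum>l<(q::nat). g l * (dd d ^^ l) h)" "\<forall>l\<ge>q. g l = 0"
      and y: "y = (\<Sum>l<(q'::nat). g' l * (dd d ^^ l) h)" "\<forall>l\<ge>q'. g' l = 0"
      by blast
    have ext: "(\<Sum>l<q. g l * (dd d ^^ l) h) = (\<Sum>l<q + r. g l * (dd d ^^ l) h)"
      if "\<forall>l\<ge>q. g l = 0" for g q r
      using that by (intro sum.mono_neutral_left) auto
    have "x = (\<Sum>l<q + q'. g l * (dd d ^^ l) h)" using x ext by simp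
    moreover have "y = (\<Sum>l<q + q'. g' l * (dd d ^^ l) h)" using y ext[of q' g' q] by (simp add: add.commute)
    ultimately have "x + y = (\<Sum>l<q + q'. (g l + g' l) * (dd d ^^ l) h)"
      by (simp add: ring_distribs sum.distrib)
    moreover have "\<forall>l\<ge>q + q'. g l + g' l = 0" using x(2) y(2) by simp
    moreover have "x + y \<in> ring_D n" using \<open>x \<in> ?I\<close> \<open>y \<in> ?I\<close> by (auto intro: ring_D_closed)
    ultimately show "x + y \<in> ?I" by (intro memI[of _ "\<lambda>l. g l + g' l" "q + q'"])
  next
    fix a x :: "'a dpol" assume "a \<in> ring_D n" "x \<in> ?I"
    then obtain g q where x: "x = (\<Sum>l<(q::nat). g l * (dd d ^^ l) h)" "\<forall>l\<ge>q. g l = 0" by blast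
    then have "a * x = (\<Sum>l<q. (a * g l) * (dd d ^^ l) h)" "\<forall>l\<ge>q. a * g l = 0"
      by (simp_all add: sum_distrib_left mult_ac)
    moreover have "a * x \<in> ring_D n" using \<open>a \<in> ring_D n\<close> \<open>x \<in> ?I\<close> by (auto intro: ring_D_closed)
    ultimately show "a * x \<in> ?I" by (intro memI[of _ "\<lambda>l. a * g l" q])
  next
    fix x assume "x \<in> ?I"
    then obtain g q where x: "x = (\<Sum>l<(q::nat). g l * (dd d ^^ l) h)" "\<forall>l\<ge>q. g l = 0" by blast
    let ?g = "\<lambda>l. dd d (g l) + (case l of 0 \<Rightarrow> 0 | Suc m \<Rightarrow> g m)"
    have "dd d x = (\<Sum>l<q. dd d (g l) * (dd d ^^ l) h) + (\<Sum>l<q. g l * (dd d ^^ Suc l) h)"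
      by (simp add: x(1) dd_sum dd_mult sum.distrib)
    also have "(\<Sum>l<q. dd d (g l) * (dd d ^^ l) h) = (\<Sum>l<Suc q. dd d (g l) * (dd d ^^ l) h)"
      using x(2) by simp
    also have "(\<Sum>l<q. g l * (dd d ^^ Suc l) h) = (\<Sum>l<Suc q. (case l of 0 \<Rightarrow> 0 | Suc m \<Rightarrow> g m) * (dd d ^^ l) h)"
      by (subst sum.lessThan_Suc_shift) simp
    finally have "dd d x = (\<Sum>l<Suc q. ?g l * (dd d ^^ l) h)"
      by (simp only: ring_distribs sum.distrib)
    moreover have "\<forall>l\<ge>Suc q. ?g l = 0" using x(2) by (auto split: nat.split)
    moreover have "dd d x \<in> ring_D n" using \<open>x \<in> ?I\<close> by (auto intro: ring_D_dd)
    ultimately show "dd d x \<in> ?I" by (intro memI[of _ ?g "Suc q"])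
  qed blast
  moreover have "h \<in> ?I"
    using assms(2) by (auto intro!: exI[of _ "\<lambda>l. if l = 0 then 1 else 0"] exI[of _ 1])
  ultimately have "diff_ideal_gen d (ring_D n) {h} \<subseteq> ?I" by (intro diff_ideal_gen_least) auto
  then show ?thesis using assms(1) by blast
qed

section \<open>The module of syzygies is cyclic\<close>

context linear_system
begin

lemma cform_cong: "(\<And>i. i \<in> {1..n} \<Longrightarrow> F i = F' i) \<Longrightarrow> cform F = cform F'"
  by (simp add: cform_def)

lemma cform_eq_0_iff: "cform F = 0 \<longleftrightarrow> (\<forall>i\<in>{1..n}. F i = 0)"
proof
  assume "cform F = 0"
  then have "cform F = cform (\<lambda>_. 0)" by (simp add: cform_def)
  then show "\<forall>i\<in>{1..n}. F i = 0" using cform_eqD by blast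
qed (simp add: cform_def)

lemma syz_mult: "syz F \<Longrightarrow> syz (\<lambda>i. op_mult d E (F i))"
  by (simp add: syz_def op_mult_assoc flip: op_mult_sum_right)

lemma syz_diff: "syz F \<Longrightarrow> syz F' \<Longrightarrow> syz (\<lambda>i. F i - F' i)"
  by (simp add: syz_def op_mult_diff_left sum_subtractf)

lemma syz_cancel:
  assumes "syz (\<lambda>i. op_mult d E (F i))" "E \<noteq> 0"
  shows "syz F"
  unfolding syz_def
proof
  fix j assume "j \<in> {1..n - 1}"
  then have "op_mult d E (\<Sum>i = 1..n. op_mult d (F i) (G i j)) = 0"
    using assms(1) by (simp add: syz_def op_mult_assoc op_mult_sum_right)
  then show "(\<Sum>i = 1..n. op_mult d (F i) (G i j)) = 0"
    using assms(2) by (simp add: op_mult_eq_0_iff)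
qed

lemma syz_cong: "(\<And>i. i \<in> {1..n} \<Longrightarrow> F i = F' i) \<Longrightarrow> syz F \<longleftrightarrow> syz F'"
  by (simp add: syz_def)

text \<open>By \<open>inj\<close> a syzygy is determined by its last entry, so the module embeds
  into the operators as a left ideal. As in a Euclidean ring, a nonzero last entry of least degree
  generates it: the remainder of a right division is again the last entry of a syzygy.\<close>

lemma syz_generator:
  assumes inj: "\<And>F. syz F \<Longrightarrow> F n = 0 \<Longrightarrow> \<forall>i\<in>{1..n}. F i = 0"
    and ex: "syz F0" "\<exists>i\<in>{1..n}. F0 i \<noteq> 0"
  obtains L where "syz L" "\<exists>i\<in>{1..n}. L i \<noteq> 0"
    "\<And>F. syz F \<Longrightarrow> \<exists>E. \<forall>i\<in>{1..n}. F i = op_mult d E (L i)"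
proof -
  let ?Q = "\<lambda>F. syz F \<and> F n \<noteq> 0"
  have "?Q F0" using inj[of F0] ex by blast
  then obtain L where L: "?Q L" and min: "\<And>F. ?Q F \<Longrightarrow> degree (L n) \<le> degree (F n)"
    using ex_has_least_nat[of ?Q F0 "\<lambda>F. degree (F n)"] by blast
  have "\<exists>E. \<forall>i\<in>{1..n}. F i = op_mult d E (L i)" if F: "syz F" for F
  proof -
    from L have "L n \<noteq> 0" by blast
    then obtain E r where E: "F n = op_mult d E (L n) + r" "r = 0 \<or> degree r < degree (L n)"
      using op_right_division[of "L n" "F n"] by blast
    let ?F = "\<lambda>i. F i - op_mult d E (L i)"
    have s: "syz ?F" using F L by (intro syz_diff syz_mult) blast+
    have "?F n = r" using E by simp
    then have "?F n = 0" using min[of ?F] s E(2) by fastforce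
    from inj[OF s this] show ?thesis by auto
  qed
  moreover have "\<exists>i\<in>{1..n}. L i \<noteq> 0"
  proof -
    have "n \<ge> 1" using ex(2) by auto
    then show ?thesis using L by (intro bexI[of _ n]) auto
  qed
  ultimately show ?thesis using L that by blast
qed

end

section \<open>The linear form of a generating syzygy\<close>

locale syz_generated = linear_system +
  fixes L :: "nat \<Rightarrow> 'a poly"
  assumes syz_L: "syz L" and L_nz: "\<exists>i\<in>{1..n}. L i \<noteq> 0"
    and syz_gen: "\<And>F. syz F \<Longrightarrow> \<exists>E. \<forall>i\<in>{1..n}. F i = op_mult d E (L i)"
begin

abbreviation A where "A \<equiv> cform L"

lemma A_nz: "A \<noteq> 0" using L_nz by (auto simp: cform_eq_0_iff)

lemma phi_A: "phi A = 0" by (simp add: phi_cform_eq_0 syz_L)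

lemma linform_kernel:
  assumes "linform v" "v \<in> ring_D n" "phi v = 0"
  obtains E where "v = op_apply d E A" "v = cform (\<lambda>i. op_mult d E (L i))"
proof -
  obtain F where F: "v = cform F" using linform_eq_cform assms by blast
  with assms have "syz F" by (simp add: phi_cform_eq_0)
  then obtain E where "\<forall>i\<in>{1..n}. F i = op_mult d E (L i)" using syz_gen by blast
  then have "v = cform (\<lambda>i. op_mult d E (L i))" unfolding F by (intro cform_cong) simp
  then show ?thesis using that by (simp add: op_apply_cform)
qed

text \<open>By \<open>kernel_in_ideal\<close> it suffices to treat the linear elements of the
  kernel, and these are of the form \<open>op_apply d E A\<close>.\<close>

lemma ID_eq_gen: "ID d n sys = diff_ideal_gen d (ring_D n) {A}"
proof (intro equalityI subsetI)
  fix f assume "f \<in> ID d n sys"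
  then have f: "vars f \<subseteq> Cvars n" "phi f = 0" by (auto simp: mem_ID_iff ring_D_def)
  show "f \<in> diff_ideal_gen d (ring_D n) {A}"
  proof (rule kernel_in_ideal[OF _ _ _ _ f])
    fix v :: "'a dpol" assume "linform v" "vars v \<subseteq> Cvars n" "phi v = 0"
    then obtain E where E: "v = op_apply d E A" using linform_kernel[of v] unfolding ring_D_def by blast
    show "v \<in> diff_ideal_gen d (ring_D n) {A}"
      unfolding E by (rule diff_ideal_gen_op_apply[OF ring_D_closed(5)], rule diff_ideal_gen_closed(5)) simp
  qed (auto simp: ring_D_def intro: diff_ideal_gen_closed(1-3))
next
  have "diff_ideal d (ring_D n) {f \<in> ring_D n. phi f = 0}"
    unfolding diff_ideal_def
    by (auto simp: phi.hom_add phi.hom_mult phi_dd intro: ring_D_closed ring_D_dd)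
  then have "diff_ideal_gen d (ring_D n) {A} \<subseteq> {f \<in> ring_D n. phi f = 0}"
    by (rule diff_ideal_gen_least) (simp add: phi_A cform_in_ring_D)
  then show "f \<in> ID d n sys" if "f \<in> diff_ideal_gen d (ring_D n) {A}" for f
    using that by (auto simp: mem_ID_iff)
qed

lemma vars_A: "vars A \<noteq> {}"
proof
  assume "vars A = {}"
  then have "A = 0" using vars_linform[OF linform_cform, of L] by (intro linform_eqI linform_cform) auto
  then show False using A_nz by simp
qed

text \<open>The initial and the separant of a linear form are the same nonzero constant, so
  saturation adds nothing to the ideal generated by \<open>A\<close>.\<close>

lemma is_dRes_A:
  assumes lt: "ranking n lt"
  shows "is_dRes d n lt sys A"
proof -
  let ?a = "lc A (leader lt A)"
  have "leader lt A \<in> vars A" using leader_props(1)[OF lt cform_in_ring_D vars_A] .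
  then have a: "?a \<noteq> 0" using vars_linform[OF linform_cform, of L] by blast
  have i: "initial_of lt A = Const ?a" by (rule initial_of_linform[OF linform_cform a])
  have s: "separant lt A = Const ?a" unfolding separant_def by (rule partial_deriv_linform[OF linform_cform])
  let ?I = "diff_ideal_gen d (ring_D n) {A}"
  have "f \<in> sat_ideal d n lt A \<longleftrightarrow> f \<in> ID d n sys" for f
  proof
    assume "f \<in> sat_ideal d n lt A"
    then obtain k l where f: "f \<in> ring_D n" "Const ?a ^ k * Const ?a ^ l * f \<in> ?I"
      unfolding sat_ideal_def i s by blast
    let ?b = "?a ^ k * ?a ^ l"
    have "Const (inverse ?b) * (Const ?b * f) \<in> ?I"
      by (rule diff_ideal_gen_closed(3)[OF ring_D_closed(5)]) (use f in \<open>simp add: Const_mult Const_power\<close>)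
    moreover have "Const (inverse ?b) * (Const ?b * f) = Const (inverse ?b * ?b) * f"
      by (simp only: Const_mult mult.assoc)
    moreover have "inverse ?b * ?b = 1" by (rule left_inverse) (simp add: a)
    ultimately have "f \<in> ?I" by (simp only: Const_1 mult_1_left)
    then show "f \<in> ID d n sys" by (simp add: ID_eq_gen)
  next
    assume f: "f \<in> ID d n sys"
    then have "initial_of lt A ^ 0 * separant lt A ^ 0 * f \<in> ?I" "f \<in> ring_D n"
      by (simp_all add: ID_eq_gen[symmetric] mem_ID_iff)
    then show "f \<in> sat_ideal d n lt A" unfolding sat_ideal_def by blast
  qed
  then show ?thesis unfolding is_dRes_def
    using irreducible_linform[OF linform_cform A_nz cform_in_ring_D] by blast
qed

section \<open>Uniqueness of the resultant\<close>

text \<open>\<open>omega f\<close> is the Jacobian of \<open>f\<close> modulo the ideal, i.e. a tuple of operators over the image of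
  \<open>phi\<close>; \<open>top i K f u\<close> says that its \<open>i\<close>-th entry has order at most \<open>K\<close> with coefficient \<open>u\<close> there.
  From \<open>R \<in> [A]\<close> and \<open>s A \<in> [R]\<close>, where \<open>s\<close> is not in the ideal, one gets \<open>omega R = \<rho> L\<close> and
  \<open>phi s L = \<theta> \<rho> L\<close>, and comparing orders \<open>\<rho>\<close> must have order 0.\<close>

definition omega :: "'a dpol \<Rightarrow> dvar \<Rightarrow> 'a dpol" where
  "omega f w = phi (partial_deriv w f)"

definition top :: "nat \<Rightarrow> nat \<Rightarrow> 'a dpol \<Rightarrow> 'a dpol \<Rightarrow> bool" where
  "top i K f u \<longleftrightarrow> omega f (CV i K) = u \<and> (\<forall>k>K. omega f (CV i k) = 0)"

lemma omega_mult: "omega (f * g) w = phi f * omega g w + phi g * omega f w"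
  by (simp add: omega_def partial_deriv_mult phi.hom_add phi.hom_mult mult_ac)

lemma omega_sum: "omega (sum f S) w = (\<Sum>x\<in>S. omega (f x) w)"
proof -
  have "partial_deriv w (sum f S) = (\<Sum>x\<in>S. partial_deriv w (f x))"
    by (rule additive_sum) (simp_all add: partial_deriv_add)
  then show ?thesis by (simp add: omega_def phi.hom_sum)
qed

lemma omega_linform: "linform f \<Longrightarrow> omega f w = Const (lc f w)"
  by (simp add: omega_def partial_deriv_linform)

text \<open>By \<open>partial_deriv_dd\<close> each derivation raises the order by one and hands the
  top coefficient on unchanged.\<close>

lemma top_ddpow: "top i K f u \<Longrightarrow> top i (K + l) ((dd d ^^ l) f) u"
proof (induction l)
  case (Suc l)
  let ?f = "(dd d ^^ l) f"
  have *: "omega (dd d ?f) (CV i (Suc k)) = dd d (omega ?f (CV i (Suc k))) + omega ?f (CV i k)" for k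
    using partial_deriv_dd[of "CV i k" ?f] by (simp add: omega_def phi.hom_add phi_dd)
  have t: "omega ?f (CV i (K + l)) = u" "\<And>k. k > K + l \<Longrightarrow> omega ?f (CV i k) = 0"
    using Suc by (auto simp: top_def)
  have "omega (dd d ?f) (CV i k) = 0" if k: "k > Suc (K + l)" for k
  proof -
    obtain k' where "k = Suc k'" using k by (cases k) auto
    then show ?thesis using k t(2) * by simp
  qed
  then show ?case using t by (auto simp: top_def *)
qed simp

text \<open>Since \<open>phi\<close> kills \<open>f\<close> and its derivatives, the product rule
  loses the terms in which some \<open>g l\<close> is differentiated.\<close>

lemma omega_comb:
  assumes "phi f = 0"
  shows "omega (\<Sum>l<q. g l * (dd d ^^ l) f) w = (\<Sum>l<q. phi (g l) * omega ((dd d ^^ l) f) w)"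
proof -
  have "phi ((dd d ^^ l) f) = 0" for l
    by (induction l) (simp_all add: assms phi_dd)
  then show ?thesis by (simp add: omega_sum omega_mult)
qed

text \<open>The largest \<open>Q\<close> with \<open>phi (g Q) \<noteq> 0\<close> determines the
  top, because smaller indices reach only lower orders. A nonzero entry at some variable
  \<open>w\<close> guarantees that such a \<open>Q\<close> exists.\<close>

lemma top_comb:
  assumes f: "phi f = 0" "top i K f u" and nz: "omega (\<Sum>l<q. g l * (dd d ^^ l) f) w \<noteq> 0"
  obtains Q where "Q < q" "phi (g Q) \<noteq> 0" "\<And>l. l < q \<Longrightarrow> l > Q \<Longrightarrow> phi (g l) = 0"
    "top i (K + Q) (\<Sum>l<q. g l * (dd d ^^ l) f) (phi (g Q) * u)"
proof -
  let ?M = "{l. l < q \<and> phi (g l) \<noteq> 0}"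
  have "?M \<noteq> {}"
  proof
    assume "?M = {}"
    then have "omega (\<Sum>l<q. g l * (dd d ^^ l) f) w = 0"
      unfolding omega_comb[OF f(1)] by (intro sum.neutral) auto
    with nz show False ..
  qed
  moreover have fin: "finite ?M" by simp
  ultimately have Q: "Max ?M \<in> ?M" by (intro Max_in)
  define Q where "Q = Max ?M"
  have Q1: "Q < q" "phi (g Q) \<noteq> 0" using Q by (auto simp: Q_def)
  have Q2: "phi (g l) = 0" if "l < q" "l > Q" for l
  proof (rule ccontr)
    assume "phi (g l) \<noteq> 0"
    then have "l \<le> Q" unfolding Q_def using that(1) by (intro Max_ge[OF fin]) blast
    then show False using that(2) by simp
  qed
  have t: "omega ((dd d ^^ l) f) (CV i (K + l)) = u" "\<And>k. k > K + l \<Longrightarrow> omega ((dd d ^^ l) f) (CV i k) = 0" for l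
    using top_ddpow[OF f(2), of l] by (auto simp: top_def)
  have "omega (\<Sum>l<q. g l * (dd d ^^ l) f) (CV i (K + Q)) = (\<Sum>l<q. if l = Q then phi (g Q) * u else 0)"
    unfolding omega_comb[OF f(1)]
  proof (rule sum.cong)
    fix l assume "l \<in> {..<q}"
    then show "phi (g l) * omega ((dd d ^^ l) f) (CV i (K + Q)) = (if l = Q then phi (g Q) * u else 0)"
      using t[of l] Q2[of l] by (cases l Q rule: linorder_cases) auto
  qed simp
  moreover have "omega (\<Sum>l<q. g l * (dd d ^^ l) f) (CV i k) = 0" if "k > K + Q" for k
    unfolding omega_comb[OF f(1)]
  proof (rule sum.neutral, rule ballI)
    fix l assume "l \<in> {..<q}"
    then show "phi (g l) * omega ((dd d ^^ l) f) (CV i k) = 0"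
      using t(2)[of l k] Q2[of l] that by (cases "l \<le> Q") auto
  qed
  ultimately have "top i (K + Q) (\<Sum>l<q. g l * (dd d ^^ l) f) (phi (g Q) * u)"
    using Q1 by (auto simp: top_def)
  then show ?thesis using that Q1 Q2 by blast
qed

lemma dRes_unique:
  assumes lt: "ranking n lt" and R: "is_dRes d n lt sys R"
  shows "\<exists>\<alpha>. \<alpha> \<noteq> 0 \<and> Const \<alpha> * R = A"
proof -
  have irr: "irreducible_in_D n R" and IDs: "ID d n sys = sat_ideal d n lt R"
    using R by (auto simp: is_dRes_def)
  have RD: "R \<in> ring_D n" "R \<noteq> 0" "\<not> unit_in_D n R" using irr by (auto simp: irreducible_in_D_def)
  have Rv: "vars R \<noteq> {}"
  proof
    assume "vars R = {}"
    then show False using RD(2,3) vars_empty_iff[of R] unfolding unit_in_D_iff by (metis Const_0)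
  qed
  let ?I = "initial_of lt R" and ?s = "separant lt R" and ?g = "diff_ideal_gen d (ring_D n) {R}"
  have ID': "?I \<in> ring_D n" "?s \<in> ring_D n"
  proof -
    have "vars ?I \<subseteq> vars R" unfolding initial_of_def Let_def by (rule vars_coeff_in)
    then show "?I \<in> ring_D n" using RD(1) by (simp add: ring_D_def subset_trans)
    have "vars ?s \<subseteq> vars R" unfolding separant_def by (rule vars_partial_deriv)
    then show "?s \<in> ring_D n" using RD(1) by (simp add: ring_D_def subset_trans)
  qed
  have "R \<in> sat_ideal d n lt R" unfolding sat_ideal_def
    using RD(1) by (auto intro!: exI[of _ 0] diff_ideal_gen_closed(5))
  then have RID: "R \<in> ID d n sys" by (simp add: IDs)
  then have phiR: "phi R = 0" by (simp add: mem_ID_iff)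
  have one: "1 \<notin> sat_ideal d n lt R"
    unfolding IDs[symmetric] mem_ID_iff by simp
  \<comment> \<open>If the separant were in the ideal, a product of powers of initial and separant
    would lie in the ideal generated by \<open>R\<close>. Then 1 would be in the saturation,
    although \<open>phi 1 = 1\<close>.\<close>
  have phi_s: "phi ?s \<noteq> 0"
  proof
    assume "phi ?s = 0"
    then have "?s \<in> sat_ideal d n lt R" using ID' by (simp add: mem_ID_iff flip: IDs)
    then obtain a b where "?I ^ a * ?s ^ b * ?s \<in> ?g" by (auto simp: sat_ideal_def)
    then have "?I ^ a * ?s ^ Suc b * 1 \<in> ?g" by (simp add: mult_ac)
    then show False using one unfolding sat_ideal_def by (blast intro: ring_D_closed)
  qed
  have phi_I: "phi ?I \<noteq> 0"
  proof
    assume "phi ?I = 0"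
    then have "?I \<in> sat_ideal d n lt R" using ID' by (simp add: mem_ID_iff flip: IDs)
    then obtain a b where "?I ^ a * ?s ^ b * ?I \<in> ?g" by (auto simp: sat_ideal_def)
    then have "?I ^ Suc a * ?s ^ b * 1 \<in> ?g" by (simp add: mult_ac)
    then show False using one unfolding sat_ideal_def by (blast intro: ring_D_closed)
  qed
  have Cv: "vars A \<subseteq> Cvars n" "vars R \<subseteq> Cvars n" using cform_in_ring_D RD(1) by (auto simp: ring_D_def)
  note lA = leader_props[OF lt cform_in_ring_D vars_A] and lR = leader_props[OF lt RD(1) Rv]
  obtain i K where vA: "leader lt A = CV i K" and i: "i \<in> {1..n}" and LK: "coeff (L i) K \<noteq> 0"
    using lA(1) by (auto simp: vars_cform)
  \<comment> \<open>The ranking sorts the derivatives of one \<open>c_i\<close> by their order, so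
    the leader of \<open>A\<close> sits at the degree of \<open>L i\<close>.\<close>
  have Lk: "coeff (L i) k = 0" if "k > K" for k
  proof (rule ccontr)
    assume "coeff (L i) k \<noteq> 0"
    then have "CV i k \<in> vars A" using i by (auto simp: vars_cform)
    then have "lt (CV i k) (CV i K)" using lA(2)[of "CV i k"] vA that by auto
    moreover have "lt (CV i K) (CV i k)" using ranking_CV_less[OF lt i that] .
    ultimately show False using ranking_asym[OF lt, of "CV i k" "CV i K"] i by auto
  qed
  have degL: "degree (L i) = K" using LK Lk by (intro antisym degree_le le_degree) auto
  let ?a = "Const (coeff (L i) K) :: 'a dpol"
  have topA: "top i K A ?a"
    using i Lk by (simp add: top_def omega_linform[OF linform_cform] lc_cform)
  obtain g q where gR: "R = (\<Sum>l<q. g l * (dd d ^^ l) A)"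
    using diff_ideal_gen_singleton[OF _ cform_in_ring_D, of R] RID unfolding ID_eq_gen by blast
  have nzR: "omega R (leader lt R) \<noteq> 0" using phi_s by (simp add: separant_def omega_def)
  obtain Q where Q: "Q < q" "phi (g Q) \<noteq> 0" "\<And>l. l < q \<Longrightarrow> l > Q \<Longrightarrow> phi (g l) = 0"
    "top i (K + Q) R (phi (g Q) * ?a)"
    using top_comb[OF phi_A topA, of g q "leader lt R"] nzR unfolding gR[symmetric] by blast
  have "A \<in> sat_ideal d n lt R" by (simp add: mem_ID_iff cform_in_ring_D phi_A flip: IDs)
  then obtain a b where sA: "?I ^ a * ?s ^ b * A \<in> ?g" by (auto simp: sat_ideal_def)
  let ?S = "?I ^ a * ?s ^ b"
  obtain h q' where h: "?S * A = (\<Sum>l<q'. h l * (dd d ^^ l) R)"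
    using diff_ideal_gen_singleton[OF sA RD(1)] by blast
  have oS: "omega (?S * A) w = phi ?S * Const (lc A w)" for w
    by (simp add: omega_mult phi_A omega_linform[OF linform_cform])
  have "phi ?S \<noteq> 0" using phi_s phi_I by (simp add: phi.hom_mult phi.hom_power)
  then have "omega (?S * A) (CV i K) \<noteq> 0" using LK i by (simp add: oS lc_cform)
  then obtain M where "M < q'" "phi (h M) \<noteq> 0" and M: "top i (K + Q + M) (?S * A) (phi (h M) * (phi (g Q) * ?a))"
    using top_comb[OF phiR Q(4), of h q' "CV i K"] unfolding h[symmetric] by blast
  \<comment> \<open>\<open>Q\<close> and \<open>M\<close> are the orders of the operators leading
    from \<open>A\<close> to \<open>R\<close> and from \<open>R\<close> to \<open>?S * A\<close>.
    The Jacobian of the latter is \<open>phi ?S\<close> times that of \<open>A\<close>, whose entry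
    \<open>i\<close> has order \<open>K\<close>; hence both orders are 0.\<close>
  then have "omega (?S * A) (CV i (K + Q + M)) \<noteq> 0" using Q(2) LK by (auto simp: top_def)
  then have "coeff (L i) (K + Q + M) \<noteq> 0" using i by (auto simp: oS lc_cform)
  then have Q0: "Q = 0" using Lk[of "K + Q + M"] by (cases "Q + M") auto
  \<comment> \<open>At the leader of \<open>R\<close> the left side is the image of the separant,
    which is nonzero; so this leader occurs in \<open>A\<close>.\<close>
  have "omega R w = phi (g 0) * Const (lc A w)" for w
  proof -
    have "omega R w = (\<Sum>l<q. if l = 0 then phi (g 0) * omega A w else 0)"
      unfolding gR omega_comb[OF phi_A] using Q(3) Q0 by (intro sum.cong) auto
    then show ?thesis using Q(1) by (simp add: omega_linform[OF linform_cform])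
  qed
  then have "leader lt R \<in> vars A" using nzR vars_linform[OF linform_cform, of L] by auto
  then have vR: "leader lt R = leader lt A \<or> lt (leader lt R) (leader lt A)" using lA(2) by blast
  define X where "X = {w \<in> Cvars n. w = leader lt A \<or> lt w (leader lt A)}"
  have RX: "vars R \<subseteq> X"
  proof
    fix w assume w: "w \<in> vars R"
    have "w = leader lt R \<or> lt w (leader lt R)" using lR(2) w by blast
    moreover have C: "w \<in> Cvars n" "leader lt R \<in> Cvars n" "leader lt A \<in> Cvars n"
      using w Cv lR(1) lA(1) by (auto dest: subsetD)
    moreover note ranking_trans[OF lt C]
    ultimately have "w = leader lt A \<or> lt w (leader lt A)" using vR by auto
    then show "w \<in> X" using C(1) by (simp add: X_def)
  qed
  \<comment> \<open>Here \<open>kernel_in_ideal\<close> is applied to the polynomials in the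
    variables up to the leader of \<open>A\<close>. A linear element of the kernel among them is
    \<open>E\<close> applied to \<open>A\<close>; were \<open>E\<close> of positive order, a
    derivative of \<open>c_i\<close> above that leader would occur. So plain multiples of
    \<open>A\<close> suffice.\<close>
  have "R \<in> {A * h | h. vars h \<subseteq> X}"
  proof (rule kernel_in_ideal[OF _ _ _ _ RX phiR])
    show "0 \<in> {A * h | h. vars h \<subseteq> X}" by (auto intro!: exI[of _ 0])
    fix x y assume "x \<in> {A * h | h. vars h \<subseteq> X}" "y \<in> {A * h | h. vars h \<subseteq> X}"
    then obtain h h' where "x = A * h" "y = A * h'" "vars h \<subseteq> X" "vars h' \<subseteq> X" by blast
    then have "x + y = A * (h + h')" "vars (h + h') \<subseteq> X" using vars_add[of h h'] by (auto simp: algebra_simps)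
    then show "x + y \<in> {A * h | h. vars h \<subseteq> X}" by blast
  next
    fix f x :: "'a dpol" assume f: "vars f \<subseteq> X" and "x \<in> {A * h | h. vars h \<subseteq> X}"
    then obtain h where "x = A * h" "vars h \<subseteq> X" by blast
    then have "f * x = A * (f * h)" "vars (f * h) \<subseteq> X" using f vars_mult[of f h] by (auto simp: algebra_simps)
    then show "f * x \<in> {A * h | h. vars h \<subseteq> X}" by blast
  next
    fix v :: "'a dpol" assume v: "linform v" "vars v \<subseteq> X" "phi v = 0"
    have "v \<in> ring_D n" using v(2) by (auto simp: X_def ring_D_def)
    then obtain E where E: "v = op_apply d E A" "v = cform (\<lambda>i. op_mult d E (L i))"
      using linform_kernel v by blast
    have "degree E = 0"
    proof (rule ccontr)
      assume e: "degree E \<noteq> 0"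
      then have "E \<noteq> 0" by auto
      have "coeff (op_mult d E (L i)) (degree E + K) \<noteq> 0"
        using coeff_op_mult_top[of E "L i"] degL LK \<open>E \<noteq> 0\<close> by simp
      then have "CV i (degree E + K) \<in> X" using E(2) v(2) i by (auto simp: vars_cform)
      then have "lt (CV i (degree E + K)) (CV i K)" using e by (auto simp: X_def vA)
      moreover have "lt (CV i K) (CV i (degree E + K))" using e by (intro ranking_CV_less[OF lt i]) simp
      ultimately show False using ranking_asym[OF lt] i by simp
    qed
    then obtain e where "E = [:e:]" by (rule degree_eq_zeroE)
    then have "v = A * Const e" using E(1) by (simp add: op_apply_const mult.commute)
    then show "v \<in> {A * h | h. vars h \<subseteq> X}" by (auto intro!: exI[of _ "Const e"])
  qed
  then obtain h where h: "R = A * h" "vars h \<subseteq> X" by blast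
  have "h \<in> ring_D n" using h(2) by (auto simp: X_def ring_D_def)
  then have "unit_in_D n A \<or> unit_in_D n h" using irr h(1) cform_in_ring_D unfolding irreducible_in_D_def by blast
  moreover have "\<not> unit_in_D n A" using vars_A by (auto simp: unit_in_D_iff)
  ultimately obtain b where b: "b \<noteq> 0" "h = Const b" by (auto simp: unit_in_D_iff)
  then have "Const (inverse b) * R = Const (inverse b * b) * A" by (simp only: h(1) Const_mult) (simp add: mult_ac)
  then show ?thesis using b(1) by (intro exI[of _ "inverse b"]) simp
qed

section \<open>Primitive parts\<close>

text \<open>If \<open>E'\<close> divides all entries of \<open>E L\<close> from the left, the
  quotients again form a syzygy and equal \<open>N L\<close> for some \<open>N\<close>. Cancelling a
  nonzero entry of \<open>L\<close> gives \<open>E = E' N\<close>.\<close>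

lemma primitive_part_exists:
  assumes "B \<in> ID d n sys" "B \<noteq> 0" "linform B"
  shows "ID_primitive_part d n sys B A"
proof -
  have B: "B \<in> ring_D n" "phi B = 0" using assms by (auto simp: mem_ID_iff)
  obtain E where E: "B = cform (\<lambda>i. op_mult d E (L i))" using linform_kernel[OF assms(3) B] .
  let ?F = "\<lambda>i. op_mult d E (L i)"
  have "E \<noteq> 0" using assms(2) E by (auto simp: cform_eq_0_iff)
  obtain i where i: "i \<in> {1..n}" "L i \<noteq> 0" using L_nz by blast
  have "is_gcld d n ?F E"
    unfolding is_gcld_def
  proof (intro conjI allI impI ballI)
    show "left_dvd d E (?F j)" for j by (auto simp: left_dvd_def)
    fix E' assume "\<forall>i\<in>{1..n}. left_dvd d E' (?F i)"
    then have "\<forall>i\<in>{1..n}. \<exists>M. ?F i = op_mult d E' M" by (simp add: left_dvd_def)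
    then obtain M where M: "\<And>i. i \<in> {1..n} \<Longrightarrow> ?F i = op_mult d E' (M i)" by metis
    have "?F i \<noteq> 0" using i \<open>E \<noteq> 0\<close> by (simp add: op_mult_eq_0_iff)
    then have "E' \<noteq> 0" using M[OF i(1)] by auto
    have "syz (\<lambda>i. op_mult d E' (M i))"
      using syz_cong[of ?F "\<lambda>i. op_mult d E' (M i)"] M syz_mult[OF syz_L] by blast
    then have "syz M" using syz_cancel \<open>E' \<noteq> 0\<close> by blast
    then obtain N where N: "\<forall>i\<in>{1..n}. M i = op_mult d N (L i)" using syz_gen by blast
    have "op_mult d (E - op_mult d E' N) (L i) = 0"
      using M[OF i(1)] N i(1) by (simp add: op_mult_diff_left op_mult_assoc)
    then have "E = op_mult d E' N" using i(2) by (simp add: op_mult_eq_0_iff)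
    then show "left_dvd d E' E" by (auto simp: left_dvd_def)
  qed
  then show ?thesis unfolding ID_primitive_part_def
    using assms E by (fold cform_def) blast
qed

text \<open>The quotients by any greatest common left divisor \<open>D\<close> form a syzygy
  \<open>N L\<close>, so the entries are \<open>D N L = E L\<close>. As \<open>E\<close> is itself a
  common left divisor, \<open>D = E Y\<close>; hence \<open>E = E Y N\<close>, and
  \<open>Y N = 1\<close> forces \<open>N\<close> to have order 0.\<close>

lemma primitive_part_unique:
  assumes "ID_primitive_part d n sys B A'"
  shows "\<exists>\<alpha>. \<alpha> \<noteq> 0 \<and> A' = Const \<alpha> * A"
proof -
  obtain F D L' where B: "B \<in> ID d n sys" "B \<noteq> 0" "B = cform F" and D: "is_gcld d n F D"
    and F: "\<And>i. i \<in> {1..n} \<Longrightarrow> F i = op_mult d D (L' i)" and A': "A' = cform L'"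
    using assms unfolding ID_primitive_part_def by (fold cform_def) blast
  have BF: "B = cform (\<lambda>i. op_mult d D (L' i))" unfolding B(3) by (rule cform_cong) (rule F)
  then have "D \<noteq> 0" using B(2) by (auto simp: cform_eq_0_iff)
  have "phi B = 0" using B by (simp add: mem_ID_iff)
  then have "syz F" using B(3) by (simp add: phi_cform_eq_0)
  then have "syz (\<lambda>i. op_mult d D (L' i))" using syz_cong[of F "\<lambda>i. op_mult d D (L' i)"] F by blast
  then have "syz L'" using syz_cancel \<open>D \<noteq> 0\<close> by blast
  then obtain N where N: "\<forall>i\<in>{1..n}. L' i = op_mult d N (L i)" using syz_gen by blast
  obtain E where E: "\<forall>i\<in>{1..n}. F i = op_mult d E (L i)" using syz_gen \<open>syz F\<close> by blast
  have "\<forall>i\<in>{1..n}. left_dvd d E (F i)" using E by (auto simp: left_dvd_def)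
  then obtain Y where Y: "D = op_mult d E Y" using D unfolding is_gcld_def left_dvd_def by blast
  obtain i where i: "i \<in> {1..n}" "L i \<noteq> 0" using L_nz by blast
  have "op_mult d (E - op_mult d E (op_mult d Y N)) (L i) = 0"
    using F[OF i(1)] E N i(1) Y by (simp add: op_mult_diff_left op_mult_assoc)
  then have e: "E - op_mult d E (op_mult d Y N) = 0" using i(2) by (simp add: op_mult_eq_0_iff)
  have "op_mult d E (1 - op_mult d Y N) = 0" using e by (simp add: op_mult_diff_right)
  moreover have "E \<noteq> 0" using Y \<open>D \<noteq> 0\<close> by auto
  ultimately have "op_mult d Y N = 1" by (simp add: op_mult_eq_0_iff)
  then obtain b where b: "b \<noteq> 0" "N = [:b:]" by (rule op_mult_right_unit)
  have "A' = cform (\<lambda>i. op_mult d N (L i))" unfolding A' using N by (intro cform_cong) blast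
  also have "\<dots> = Const b * A" by (simp add: b(2) op_apply_const flip: op_apply_cform)
  finally show ?thesis using b(1) by blast
qed

end

section \<open>Generic operators\<close>

lemma vars_det:
  assumes "\<And>i j. i < dim_row A \<Longrightarrow> j < dim_row A \<Longrightarrow> vars (A $$ (i, j) :: ('v, 'a::comm_ring_1) mpol) \<subseteq> W"
    and sq: "dim_row A = dim_col A"
  shows "vars (Determinant.det A) \<subseteq> W"
proof -
  have s: "vars (signof p :: ('v, 'a) mpol) = {}" for p :: "nat \<Rightarrow> nat"
    by (cases "sign p = 1") (auto simp: sign_def)
  have "vars (signof p * (\<Prod>i = 0..<dim_row A. A $$ (i, p i))) \<subseteq> W" if "p permutes {0..<dim_row A}" for p
  proof -
    have "vars (A $$ (i, p i)) \<subseteq> W" if "i \<in> {0..<dim_row A}" for i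
      using that permutes_in_image[OF \<open>p permutes _\<close>, of i] by (intro assms(1)) auto
    then have "vars (\<Prod>i = 0..<dim_row A. A $$ (i, p i)) \<subseteq> W"
      using vars_prod[of "\<lambda>i. A $$ (i, p i)" "{0..<dim_row A}"] by blast
    then show ?thesis
      using vars_mult[of "signof p" "\<Prod>i = 0..<dim_row A. A $$ (i, p i)"] s[of p] by blast
  qed
  then show ?thesis unfolding det_def using sq
    by (auto intro!: order_trans[OF vars_sum])
qed

text \<open>Pairs \<open>(i, l)\<close> with \<open>l < m\<close> are numbered by
  \<open>i * m + l\<close> to index the scalar matrix below.\<close>

lemma sum_div_mod:
  "(\<Sum>a<r * m. f (a div m) (a mod m)) = (\<Sum>i<r. \<Sum>l<m. f i (l::nat) :: 'a::comm_monoid_add)"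
proof -
  have "(\<Sum>a<r * m. f (a div m) (a mod m)) = (\<Sum>i<r. \<Sum>a\<in>{i * m..<i * m + m}. f (a div m) (a mod m))"
    by (rule sum.nat_group[symmetric])
  also have "\<dots> = (\<Sum>i<r. \<Sum>l<m. f i l)"
  proof (rule sum.cong)
    fix i
    have "(\<Sum>a\<in>{i * m..<i * m + m}. f (a div m) (a mod m)) = (\<Sum>l\<in>{0..<m}. f ((l + i * m) div m) ((l + i * m) mod m))"
      using sum.shift_bounds_nat_ivl[of "\<lambda>a. f (a div m) (a mod m)" 0 "i * m" m] by (simp add: add.commute)
    also have "\<dots> = (\<Sum>l<m. f i l)"
      by (rule sum.cong) auto
    finally show "(\<Sum>a\<in>{i * m..<i * m + m}. f (a div m) (a mod m)) = (\<Sum>l<m. f i l)" .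
  qed simp
  finally show ?thesis .
qed

context diff_ring
begin

lemma op_mult_expand:
  assumes "\<And>l. l \<ge> m \<Longrightarrow> coeff A l = 0"
  shows "op_mult d A B = (\<Sum>l<m. smult (coeff A l) (op_mult d (monom 1 l) B))"
  by (rule op_apply_eqI)
    (simp add: op_apply_mult op_apply_sum_left op_apply_smult op_apply_monom op_apply_sum[OF assms])

text \<open>This shows the coefficients as polynomials over the integers in the derivatives of the
  \<open>c (i, j, k)\<close>; \<open>gent\<close> below copies them with variables.\<close>

lemma op_mult_monom_gen_op:
  "op_mult d (monom 1 l) (gen_op S c i j) =
    (\<Sum>k\<in>S i j. \<Sum>t\<le>l. monom (of_nat (l choose t) * (d ^^ t) (c (i, j, k))) (l - t + k))"
proof (rule op_apply_eqI)
  have fp: "(dd d ^^ a) ((dd d ^^ b) g) = (dd d ^^ (a + b)) g" for a b g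
    by (simp add: funpow_add)
  show "op_apply d (op_mult d (monom 1 l) (gen_op S c i j)) (Var (CV 0 0)) =
    op_apply d (\<Sum>k\<in>S i j. \<Sum>t\<le>l. monom (of_nat (l choose t) * (d ^^ t) (c (i, j, k))) (l - t + k)) (Var (CV 0 0))"
    unfolding op_apply_mult gen_op_def op_apply_sum_left op_apply_sum_right op_apply_monom[of _ _ "Var (CV 0 0)"]
      op_apply_Const_monom by (simp only: fp mult_1_left)
qed

end

context diff_field
begin

text \<open>A relation between the rows would make a determinant vanish which is a polynomial in the
  coefficients and their derivatives, hence the zero polynomial. Specializing \<open>c (i, \<sigma> i, \<kappa> i)\<close> to 1
  and everything else to 0 turns the matrix into the identity.\<close>

lemma generic_rows_independent:
  fixes c :: "nat \<times> nat \<times> nat \<Rightarrow> 'k" and F :: "nat \<Rightarrow> 'k poly"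
  assumes S: "\<And>i j. i \<in> {1..n} \<Longrightarrow> j \<in> {1..n - 1} \<Longrightarrow> finite (S i j)"
    and indet: "diff_indeterminates d (coeff_index n S) c"
    and \<sigma>: "inj_on \<sigma> {1..n - 1}" "\<And>i. i \<in> {1..n - 1} \<Longrightarrow> \<sigma> i \<in> {1..n - 1}"
    and nz: "\<And>i. i \<in> {1..n - 1} \<Longrightarrow> gen_op S c i (\<sigma> i) \<noteq> 0"
    and syz: "\<And>j. j \<in> {1..n - 1} \<Longrightarrow> (\<Sum>i=1..n - 1. op_mult d (F i) (gen_op S c i j)) = 0"
  shows "\<forall>i\<in>{1..n - 1}. F i = 0"
proof (rule ccontr)
  assume "\<not> ?thesis"
  then obtain i0 where i0: "i0 \<in> {1..n - 1}" "F i0 \<noteq> 0" by blast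
  have "\<exists>k. k \<in> S i (\<sigma> i)" if "i \<in> {1..n - 1}" for i
    using nz[OF that] by (cases "S i (\<sigma> i) = {}") (auto simp: gen_op_def)
  then obtain \<kappa> where \<kappa>: "\<And>i. i \<in> {1..n - 1} \<Longrightarrow> \<kappa> i \<in> S i (\<sigma> i)" by metis
  define m where "m = Suc (Max ((\<lambda>i. degree (F i)) ` {1..n - 1}))"
  have Fm: "coeff (F i) l = 0" if "i \<in> {1..n - 1}" "l \<ge> m" for i l
  proof (rule coeff_eq_0)
    have "degree (F i) \<le> Max ((\<lambda>i. degree (F i)) ` {1..n - 1})" using that(1) by (intro Max_ge) auto
    then show "degree (F i) < l" using that(2) by (simp add: m_def)
  qed
  have m0: "m > 0" by (simp add: m_def)
  define N where "N = (n - 1) * m"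
  define ri where "ri a = Suc (a div m)" for a
  define rl where "rl a = a mod m" for a
  have ri: "ri a \<in> {1..n - 1}" if "a < N" for a
    using that m0 by (simp add: ri_def N_def Suc_le_eq less_mult_imp_div_less)
  define gent :: "nat \<Rightarrow> nat \<Rightarrow> nat \<Rightarrow> nat \<Rightarrow> ((nat \<times> nat \<times> nat) \<times> nat, rat) mpol" where
    "gent i l j q = (\<Sum>k\<in>S i j. \<Sum>t\<le>l. if l - t + k = q then of_nat (l choose t) * Var ((i, j, k), t) else 0)" for i l j q
  define e where "e i l j q = coeff (op_mult d (monom 1 l) (gen_op S c i j)) q" for i l j q
  let ?s1 = "\<lambda>(x, l). (d ^^ l) (c x)"
  \<comment> \<open>This specialization is purely algebraic: all derivatives are separate variables,
    so those of positive order may be sent to 0 independently.\<close>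
  let ?s2 = "\<lambda>(x, t). case x of (i, j, k) \<Rightarrow> if t = (0::nat) \<and> j = \<sigma> i \<and> k = \<kappa> i then 1 else (0::rat)"
  let ?ev1 = "mp_eval of_rat ?s1 :: _ \<Rightarrow> 'k" and ?ev2 = "mp_eval (\<lambda>x::rat. x) ?s2"
  have r1: "comm_ring_hom (of_rat :: rat \<Rightarrow> 'k)"
    by unfold_locales (simp_all add: of_rat_add of_rat_mult)
  have r2: "comm_ring_hom (\<lambda>x::rat. x)"
    by unfold_locales simp_all
  interpret e1: comm_ring_hom ?ev1 by (rule comm_ring_hom.comm_ring_hom_mp_eval[OF r1])
  interpret e2: comm_ring_hom ?ev2 by (rule comm_ring_hom.comm_ring_hom_mp_eval[OF r2])
  have on1: "?ev1 (of_nat x) = of_nat x" for x by (rule e1.hom_of_nat)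
  have on2: "?ev2 (of_nat x) = of_nat x" for x by (rule e2.hom_of_nat)
  have ev1: "?ev1 (gent i l j q) = e i l j q" for i l j q
    by (simp add: gent_def e_def op_mult_monom_gen_op coeff_sum e1.hom_sum if_distrib[of ?ev1] e1.hom_mult on1
        comm_ring_hom.mp_eval_Var[OF r1] cong: if_cong)
  have ev2: "?ev2 (gent i l j q) = (if j = \<sigma> i \<and> l + \<kappa> i = q then 1 else 0)"
    if "i \<in> {1..n - 1}" "j \<in> {1..n - 1}" for i l j q
  proof -
    have fin: "finite (S i j)" using S that by auto
    have "?ev2 (gent i l j q) = (\<Sum>k\<in>S i j. \<Sum>t\<le>l. if l - t + k = q then of_nat (l choose t) * ?s2 ((i, j, k), t) else 0)"
      by (simp only: gent_def e2.hom_sum if_distrib[of ?ev2] e2.hom_mult on2 comm_ring_hom.mp_eval_Var[OF r2] e2.hom_zero)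
    also have "\<dots> = (\<Sum>k\<in>S i j. if k = \<kappa> i then (if j = \<sigma> i \<and> l + k = q then 1 else 0) else 0)"
    proof (rule sum.cong)
      fix k
      have "(\<Sum>t\<le>l. if l - t + k = q then of_nat (l choose t) * ?s2 ((i, j, k), t) else 0) =
        (\<Sum>t\<le>l. if t = 0 then (if k = \<kappa> i then (if j = \<sigma> i \<and> l + k = q then 1 else 0) else 0) else 0)"
        by (rule sum.cong) auto
      then show "(\<Sum>t\<le>l. if l - t + k = q then of_nat (l choose t) * ?s2 ((i, j, k), t) else 0) =
        (if k = \<kappa> i then (if j = \<sigma> i \<and> l + k = q then 1 else 0) else 0)" by simp
    qed simp
    also have "\<dots> = (if j = \<sigma> i \<and> l + \<kappa> i = q then 1 else 0)"
      using fin \<kappa>[OF that(1)] by auto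
    finally show ?thesis .
  qed
  \<comment> \<open>Row \<open>(i, l)\<close> stands for \<partial> to the power \<open>l\<close>
    times row \<open>i\<close> of the system. Column \<open>(i', l')\<close> reads the coefficient
    of order \<open>\<kappa> i' + l'\<close> in column \<open>\<sigma> i'\<close> of the system,
    which is the single nonzero coefficient of the specialized row \<open>(i', l')\<close>.\<close>
  define MT where "MT = mat N N (\<lambda>(a, b). gent (ri a) (rl a) (\<sigma> (ri b)) (\<kappa> (ri b) + rl b))"
  define M1 where "M1 = mat N N (\<lambda>(a, b). e (ri a) (rl a) (\<sigma> (ri b)) (\<kappa> (ri b) + rl b))"
  have MT1: "map_mat ?ev1 MT = M1"
    by (rule eq_matI) (simp_all add: MT_def M1_def ev1)
  have MT2: "map_mat ?ev2 MT = 1\<^sub>m N"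
  proof (rule eq_matI)
    fix a b assume "a < dim_row (1\<^sub>m N :: rat mat)" "b < dim_col (1\<^sub>m N :: rat mat)"
    then have ab: "a < N" "b < N" by simp_all
    have "?ev2 (gent (ri a) (rl a) (\<sigma> (ri b)) (\<kappa> (ri b) + rl b)) =
      (if \<sigma> (ri b) = \<sigma> (ri a) \<and> rl a + \<kappa> (ri a) = \<kappa> (ri b) + rl b then 1 else 0)"
      using ri ab \<sigma>(2) by (intro ev2) blast+
    also have "\<sigma> (ri b) = \<sigma> (ri a) \<and> rl a + \<kappa> (ri a) = \<kappa> (ri b) + rl b \<longleftrightarrow> ri a = ri b \<and> rl a = rl b"
      using inj_onD[OF \<sigma>(1), of "ri b" "ri a"] ri ab by auto
    also have "\<dots> \<longleftrightarrow> a = b"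
      by (metis Suc_inject div_mult_mod_eq ri_def rl_def)
    finally show "map_mat ?ev2 MT $$ (a, b) = 1\<^sub>m N $$ (a, b)" using ab by (simp add: MT_def)
  qed (simp_all add: MT_def)
  have "vars (Determinant.det MT) \<subseteq> coeff_index n S \<times> UNIV"
  proof (rule vars_det)
    fix a b assume "a < dim_row MT" "b < dim_row MT"
    then have ab: "a < N" "b < N" by (simp_all add: MT_def)
    have "vars (gent (ri a) (rl a) (\<sigma> (ri b)) q) \<subseteq> coeff_index n S \<times> UNIV" for q
    proof -
      have "vars (if l - t + k = q then of_nat (l choose t) * Var ((ri a, \<sigma> (ri b), k), t) else 0 :: ((nat \<times> nat \<times> nat) \<times> nat, rat) mpol)
        \<subseteq> coeff_index n S \<times> UNIV" if "k \<in> S (ri a) (\<sigma> (ri b))" for k l t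
      proof -
        have "ri a \<in> {1..n}" "\<sigma> (ri b) \<in> {1..n - 1}" using ri[OF ab(1)] \<sigma>(2)[OF ri[OF ab(2)]] by auto
        then have "((ri a, \<sigma> (ri b), k), t) \<in> coeff_index n S \<times> UNIV" using that by (simp add: coeff_index_def)
        moreover have "vars (of_nat (l choose t) :: ((nat \<times> nat \<times> nat) \<times> nat, rat) mpol) = {}"
          by (metis Const_of_nat vars_Const)
        ultimately show ?thesis
          using vars_mult[of "of_nat (l choose t)" "Var ((ri a, \<sigma> (ri b), k), t) :: ((nat \<times> nat \<times> nat) \<times> nat, rat) mpol"] by auto
      qed
      then show ?thesis unfolding gent_def
        by (intro order_trans[OF vars_sum] UN_least) blast
    qed
    then show "vars (MT $$ (a, b)) \<subseteq> coeff_index n S \<times> UNIV" using ab by (simp add: MT_def)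
  qed (simp add: MT_def)
  moreover have "eval_rat ?s1 (Determinant.det MT) = 0"
  proof -
    have "eval_rat ?s1 (Determinant.det MT) = ?ev1 (Determinant.det MT)"
      by (simp add: eval_rat_def mp_eval_def)
    also have "\<dots> = Determinant.det M1" by (simp flip: MT1)
    also have "\<dots> = Determinant.det (transpose_mat M1)"
      by (rule det_transpose[symmetric, of _ N]) (simp add: M1_def)
    also have "\<dots> = 0"
    proof -
      \<comment> \<open>The coefficients of the operators \<open>F i\<close> form a left kernel
        vector of \<open>M1\<close>, whence the transposition.\<close>
      let ?v = "vec N (\<lambda>a. coeff (F (ri a)) (rl a))"
      have c: "transpose_mat M1 \<in> carrier_mat N N" by (simp add: M1_def)
      have "?v \<noteq> 0\<^sub>v N"
      proof
        assume z: "?v = 0\<^sub>v N"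
        have l: "degree (F i0) < m" using Fm[OF i0(1), of "degree (F i0)"] i0(2) by (cases "degree (F i0) < m") auto
        let ?a = "(i0 - 1) * m + degree (F i0)"
        have "i0 - 1 < n - 1" using i0(1) by auto
        then have "Suc (i0 - 1) * m \<le> (n - 1) * m" by (intro mult_right_mono) auto
        then have a: "?a < N" using l by (simp add: N_def)
        moreover have "ri ?a = i0" "rl ?a = degree (F i0)" using l i0(1) by (simp_all add: ri_def rl_def)
        ultimately have "?v $ ?a = lead_coeff (F i0)" by simp
        then show False using z a i0(2) by simp
      qed
      moreover have "transpose_mat M1 *\<^sub>v ?v = 0\<^sub>v N"
      proof (rule eq_vecI)
        fix b assume "b < dim_vec (0\<^sub>v N :: 'k vec)"
        then have b: "b < N" by simp
        let ?j = "\<sigma> (ri b)" and ?q = "\<kappa> (ri b) + rl b"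
        have "(transpose_mat M1 *\<^sub>v ?v) $ b = (\<Sum>a<N. e (ri a) (rl a) ?j ?q * coeff (F (ri a)) (rl a))"
          using b by (simp add: M1_def scalar_prod_def atLeast0LessThan)
        also have "\<dots> = (\<Sum>i<n - 1. \<Sum>l<m. e (Suc i) l ?j ?q * coeff (F (Suc i)) l)"
          unfolding N_def ri_def rl_def by (rule sum_div_mod)
        also have "\<dots> = (\<Sum>i<n - 1. coeff (op_mult d (F (Suc i)) (gen_op S c (Suc i) ?j)) ?q)"
        proof (rule sum.cong)
          fix i assume "i \<in> {..<n - 1}"
          then have "Suc i \<in> {1..n - 1}" by auto
          from op_mult_expand[OF Fm[OF this], where B = "gen_op S c (Suc i) ?j"]
          show "(\<Sum>l<m. e (Suc i) l ?j ?q * coeff (F (Suc i)) l) = coeff (op_mult d (F (Suc i)) (gen_op S c (Suc i) ?j)) ?q"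
            by (simp add: coeff_sum e_def mult.commute)
        qed simp
        also have "\<dots> = (\<Sum>i=1..n - 1. coeff (op_mult d (F i) (gen_op S c i ?j)) ?q)"
          by (rule sum.reindex_bij_witness[of _ "\<lambda>i. i - 1" Suc]) auto
        also have "\<dots> = 0"
          using syz[OF \<sigma>(2)[OF ri[OF b]]] by (simp flip: coeff_sum)
        finally show "(transpose_mat M1 *\<^sub>v ?v) $ b = 0\<^sub>v N $ b" using b by simp
      qed (simp add: M1_def)
      ultimately show ?thesis unfolding det_0_iff_vec_prod_zero_field[OF c]
        using vec_carrier by blast
    qed
    finally show ?thesis .
  qed
  ultimately have "Determinant.det MT = 0" using indet unfolding diff_indeterminates_def by blast
  then have "?ev2 (Determinant.det MT) = 0" by simp
  then have "Determinant.det (1\<^sub>m N :: rat mat) = 0" by (simp flip: MT2)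
  then show False by simp
qed

end

section \<open>The coefficient ring with a perturbation parameter\<close>

lemma (in diff_ring) coeff_p_deriv: "coeff (p_deriv d x) k = d (coeff x k)"
  by (simp add: p_deriv_def coeff_map_poly)

lemma (in diff_ring) diff_ring_p_deriv: "diff_ring (p_deriv d)"
  by unfold_locales
    (auto simp: derivation_def poly_eq_iff coeff_p_deriv d_add coeff_mult d_sum d_mult sum.distrib)

lemma lookup_embed_p: "Poly_Mapping.lookup (embed_p f) t = [:Poly_Mapping.lookup f t:]"
  by (simp add: embed_p_def map.rep_eq when_def)

lemma lookup_p_coeff: "Poly_Mapping.lookup (p_coeff e f) t = coeff (Poly_Mapping.lookup f t) e"
  by (simp add: p_coeff_def map.rep_eq when_def)

lemma lc_p_coeff: "lc (p_coeff e f) v = coeff (lc f v) e"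
  by (simp add: lc_def lookup_p_coeff)

lemma linform_p_coeff:
  assumes "linform f"
  shows "linform (p_coeff e f)"
proof -
  have "Poly_Mapping.keys (p_coeff e f) \<subseteq> Poly_Mapping.keys f"
    by (auto simp: in_keys_iff lookup_p_coeff)
  then show ?thesis using assms unfolding linform_def by blast
qed

lemma linform_embed_p:
  assumes "linform f"
  shows "linform (embed_p f)"
proof -
  have "Poly_Mapping.keys (embed_p f) \<subseteq> Poly_Mapping.keys f"
    by (auto simp: in_keys_iff lookup_embed_p)
  then show ?thesis using assms unfolding linform_def by blast
qed

lemma linform_perturbed:
  "linform (f i) \<Longrightarrow> linform (g i) \<Longrightarrow> linform (perturbed f g i)"
  unfolding perturbed_def by (intro linform_diff linform_Const_mult linform_embed_p)

lemma lc_perturbed: "lc (perturbed f g i) v = [:lc (f i) v, - lc (g i) v:]"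
  by (simp add: perturbed_def lc_diff lc_Const_mult) (simp add: lc_def lookup_embed_p)

section \<open>Determinants of coefficient matrices of linear forms\<close>

lemma coeff_in_var:
  assumes f: "linform f" and w: "w \<in> W"
  shows "coeff_in W (Poly_Mapping.single w 1) f = Const (lc f w :: 'a::comm_ring_1)"
proof -
  let ?S = "{t \<in> Poly_Mapping.keys f. \<forall>v\<in>W. Poly_Mapping.lookup t v = Poly_Mapping.lookup (Poly_Mapping.single w 1) v}"
  have "?S \<subseteq> {Poly_Mapping.single w 1}"
  proof
    fix t assume t: "t \<in> ?S"
    then obtain u where u: "t = Poly_Mapping.single u 1" using f unfolding linform_def by blast
    have "Poly_Mapping.lookup t w = 1" using t w by simp
    then have "u = w" by (simp add: u lookup_single when_def split: if_splits)
    then show "t \<in> {Poly_Mapping.single w 1}" by (simp add: u)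
  qed
  then have "coeff_in W (Poly_Mapping.single w 1) f =
      (\<Sum>t\<in>{Poly_Mapping.single w 1}. Poly_Mapping.single (t - Poly_Mapping.single w 1) (Poly_Mapping.lookup f t))"
    unfolding coeff_in_def
  proof (intro sum.mono_neutral_left ballI)
    fix t assume "t \<in> {Poly_Mapping.single w 1} - ?S"
    then have t: "t = Poly_Mapping.single w 1" "t \<notin> Poly_Mapping.keys f" by auto
    then show "Poly_Mapping.single (t - Poly_Mapping.single w 1) (Poly_Mapping.lookup f t) = 0"
      by (simp only: in_keys_iff not_not single_zero)
  qed simp_all
  then show ?thesis by (simp add: Const_def lc_def)
qed

lemma lookup_coeff_in_0:
  "Poly_Mapping.lookup (coeff_in W 0 f) t = (if \<forall>v\<in>W. Poly_Mapping.lookup t v = 0 then Poly_Mapping.lookup f t else 0)"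
  by (auto simp: coeff_in_def lookup_sum lookup_single when_def in_keys_iff sum.delta')

lemma lc_coeff_in_0: "lc (coeff_in W 0 f) v = (if v \<in> W then 0 else lc f v)"
  by (auto simp: lc_def lookup_coeff_in_0 lookup_single when_def)

lemma linform_coeff_in_0: "linform f \<Longrightarrow> linform (coeff_in W 0 f)"
  by (auto simp: linform_def in_keys_iff lookup_coeff_in_0 split: if_splits)

text \<open>The last column is filled with 0 as a placeholder, since only cofactors along that
  column are formed.\<close>

definition lc_mat :: "'a::comm_ring_1 dpol list \<Rightarrow> dvar list \<Rightarrow> 'a mat" where
  "lc_mat fs vs = mat (length fs) (length fs)
     (\<lambda>(r, s). if s < length vs then lc (fs ! r) (vs ! s) else 0)"

definition last_cofactor :: "'a::comm_ring_1 dpol list \<Rightarrow> dvar list \<Rightarrow> nat \<Rightarrow> 'a" where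
  "last_cofactor fs vs r = cofactor (lc_mat fs vs) r (length vs)"

text \<open>Replacing the last column by a copy of column \<open>s\<close> makes the determinant
  vanish and leaves the cofactors along the last column unchanged.\<close>

lemma last_cofactor_column:
  assumes len: "length fs = Suc (length vs)" and s: "s < length vs"
  shows "(\<Sum>r<length fs. last_cofactor fs vs r * lc (fs ! r) (vs ! s)) = 0"
proof -
  let ?L = "length fs" and ?T = "length vs"
  define M where "M = mat ?L ?L (\<lambda>(r, s'). lc (fs ! r) (vs ! (if s' < ?T then s' else s)))"
  have c: "M \<in> carrier_mat ?L ?L" by (simp add: M_def)
  have "col M s = col M ?T"
    by (rule eq_vecI) (use s len in \<open>simp_all add: M_def\<close>)
  then have "Determinant.det M = 0"
    using s len by (intro det_identical_columns[OF c, of s ?T]) auto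
  moreover have "Determinant.det M = (\<Sum>r<?L. M $$ (r, ?T) * cofactor M r ?T)"
    using laplace_expansion_column[OF c, of ?T] len by simp
  moreover have "cofactor M r ?T = last_cofactor fs vs r" if "r < ?L" for r
  proof -
    have "mat_delete M r ?T = mat_delete (lc_mat fs vs) r ?T"
      by (rule eq_matI) (use len that in \<open>auto simp: mat_delete_def M_def lc_mat_def\<close>)
    then show ?thesis by (simp add: cofactor_def last_cofactor_def)
  qed
  moreover have "M $$ (r, ?T) = lc (fs ! r) (vs ! s)" if "r < ?L" for r
    using that len by (simp add: M_def)
  ultimately show ?thesis by (simp add: mult.commute)
qed

text \<open>All columns but the last consist of constants, so expansion along the last one leaves
  scalar cofactors.\<close>

lemma det_coeff_matrix:
  assumes len: "length fs = Suc (length vs)" and lin: "\<And>f. f \<in> set fs \<Longrightarrow> linform f"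
  shows "Determinant.det (mat (length fs) (length fs) (\<lambda>(r, s).
           coeff_in (set vs) (if s < length vs then Poly_Mapping.single (vs ! s) 1 else 0) (fs ! r)))
    = (\<Sum>r<length fs. Const (last_cofactor fs vs r) * coeff_in (set vs) 0 (fs ! r))"
proof -
  let ?L = "length fs" and ?T = "length vs"
  define M where "M = mat ?L ?L (\<lambda>(r, s).
           coeff_in (set vs) (if s < length vs then Poly_Mapping.single (vs ! s) 1 else 0) (fs ! r))"
  have c: "M \<in> carrier_mat ?L ?L" by (simp add: M_def)
  have "Determinant.det M = (\<Sum>r<?L. M $$ (r, ?T) * cofactor M r ?T)"
    using laplace_expansion_column[OF c, of ?T] len by simp
  moreover have "cofactor M r ?T = Const (last_cofactor fs vs r)" if "r < ?L" for r
  proof -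
    have e: "M $$ (r', s) = Const (lc_mat fs vs $$ (r', s))" if "r' < ?L" "s < ?T" for r' s
    proof -
      have "M $$ (r', s) = coeff_in (set vs) (Poly_Mapping.single (vs ! s) 1) (fs ! r')"
        using that len by (simp add: M_def)
      also have "\<dots> = Const (lc (fs ! r') (vs ! s))"
        using that lin by (intro coeff_in_var) simp_all
      finally show ?thesis using that len by (simp add: lc_mat_def)
    qed
    have "mat_delete M r ?T = map_mat Const (mat_delete (lc_mat fs vs) r ?T)"
    proof -
      have "dim_row M = ?L" "dim_col M = ?L" "dim_row (lc_mat fs vs) = ?L" "dim_col (lc_mat fs vs) = ?L"
        by (simp_all add: M_def lc_mat_def)
      then show ?thesis by (intro eq_matI) (use len that in \<open>auto simp: mat_delete_def e\<close>)
    qed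
    then have "Determinant.det (mat_delete M r ?T) = Const (Determinant.det (mat_delete (lc_mat fs vs) r ?T))"
      by (simp add: comm_ring_hom.hom_det[OF comm_ring_hom_Const])
    then show ?thesis
      by (simp add: cofactor_def last_cofactor_def Const_mult Const_power Const_uminus)
  qed
  moreover have "M $$ (r, ?T) = coeff_in (set vs) 0 (fs ! r)" if "r < ?L" for r
    using that len by (simp add: M_def)
  ultimately show ?thesis by (simp add: M_def mult.commute)
qed

text \<open>This cofactor is the minor of all rows but the last; over a domain its vanishing yields
  a nontrivial relation between those rows.\<close>

lemma last_cofactor_eq_0:
  fixes fs :: "'a::idom dpol list"
  assumes len: "length fs = Suc (length vs)" and z: "last_cofactor fs vs (length vs) = 0"
  obtains w where "\<exists>r<length vs. w r \<noteq> 0"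
    "\<And>s. s < length vs \<Longrightarrow> (\<Sum>r<length vs. w r * lc (fs ! r) (vs ! s)) = 0"
proof -
  let ?T = "length vs"
  define K where "K = mat ?T ?T (\<lambda>(r, s). lc (fs ! r) (vs ! s))"
  have K: "K \<in> carrier_mat ?T ?T" by (simp add: K_def)
  have "mat_delete (lc_mat fs vs) ?T ?T = K"
    by (rule eq_matI) (use len in \<open>auto simp: mat_delete_def lc_mat_def K_def\<close>)
  then have "Determinant.det K = 0" using z by (simp add: last_cofactor_def cofactor_def)
  then have "Determinant.det (transpose_mat K) = 0" by (simp add: det_transpose[OF K])
  then obtain v where v: "v \<in> carrier_vec ?T" "v \<noteq> 0\<^sub>v ?T" "transpose_mat K *\<^sub>v v = 0\<^sub>v ?T"
    using det_0_iff_vec_prod_zero[of "transpose_mat K" ?T] K by auto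
  have "\<exists>r<?T. v $ r \<noteq> 0"
    using v(1,2) by (auto intro!: eq_vecI)
  moreover have "(\<Sum>r<?T. v $ r * lc (fs ! r) (vs ! s)) = 0" if "s < ?T" for s
  proof -
    have "(transpose_mat K *\<^sub>v v) $ s = (\<Sum>r<?T. v $ r * lc (fs ! r) (vs ! s))"
      using that v(1) by (simp add: K_def scalar_prod_def atLeast0LessThan mult.commute)
    then show ?thesis using v(3) that by simp
  qed
  ultimately show ?thesis by (rule that)
qed

lemma coeff_op_of:
  assumes "linform f"
  shows "coeff (op_of f j) k = lc f (UV j k)"
proof -
  have fin: "finite {k. UV j k \<in> vars f}"
    using finite_vimageI[OF finite_vars[of f], of "UV j"] by (simp add: vimage_def inj_def)
  have "UV j k \<in> vars f \<longleftrightarrow> lc f (UV j k) \<noteq> 0"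
    using vars_linform[OF assms] by blast
  then show ?thesis using fin by (auto simp: op_of_def coeff_sum lc_def)
qed

lemma ord_U_props:
  assumes "UV j k \<in> vars f"
  shows "ord_U f \<ge> int k" "\<And>K. (\<And>j k. UV j k \<in> vars f \<Longrightarrow> k \<le> K) \<Longrightarrow> ord_U f \<le> int K"
proof -
  let ?S = "{k. \<exists>j. UV j k \<in> vars f}"
  have "?S \<subseteq> (\<lambda>v. case v of UV j k \<Rightarrow> k | CV i k \<Rightarrow> k) ` vars f" by force
  then have fin: "finite ?S" by (rule finite_subset) simp
  have o: "ord_U f = int (Max ?S)" using assms by (auto simp: ord_U_def)
  show "ord_U f \<ge> int k" unfolding o using Max_ge[OF fin, of k] assms by auto
  show "ord_U f \<le> int K" if K: "\<And>j k. UV j k \<in> vars f \<Longrightarrow> k \<le> K" for K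
  proof -
    have "Max ?S \<le> K"
    proof (rule Max.boundedI[OF fin])
      show "?S \<noteq> {}" using assms by blast
      show "a \<le> K" if "a \<in> ?S" for a using that K by blast
    qed
    then show ?thesis by (simp add: o)
  qed
qed

section \<open>The perturbation\<close>

locale perturbed_system = linear_system +
  assumes n2: "n \<ge> 2"
begin

text \<open>Being above every degree in \<open>G\<close>, it is exactly the order of the perturbed
  polynomials with \<open>i < n\<close>.\<close>

definition eps_ord :: nat where
  "eps_ord = Suc (Max ((\<lambda>(i, j). degree (G i j)) ` ({1..n} \<times> {1..n - 1})))"

text \<open>The first summand lets row \<open>j\<close> attain its order in column \<open>j\<close>,
  and the second puts an underived \<open>u_j\<close> into row \<open>j + 1\<close>. Both gammas
  therefore vanish in every column, and the part of the system carrying the parameter is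
  bidiagonal.\<close>

definition eps :: "nat \<Rightarrow> 'a dpol" where
  "eps i = (if i < n then Var (UV i eps_ord) else 0) + (if 1 < i then Var (UV (i - 1) 0) else 0)"

abbreviation Q where "Q \<equiv> perturbed sys eps"

lemma coeff_G_eps_ord: "i \<in> {1..n} \<Longrightarrow> j \<in> {1..n - 1} \<Longrightarrow> k \<ge> eps_ord \<Longrightarrow> coeff (G i j) k = 0"
proof (rule coeff_eq_0)
  assume ij: "i \<in> {1..n}" "j \<in> {1..n - 1}" "k \<ge> eps_ord"
  have "degree (G i j) \<le> Max ((\<lambda>(i, j). degree (G i j)) ` ({1..n} \<times> {1..n - 1}))"
    using ij by (intro Max_ge) auto
  then show "degree (G i j) < k" using ij(3) by (simp add: eps_ord_def)
qed

lemma eps_ord_pos: "eps_ord > 0" by (simp add: eps_ord_def)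

lemma linform_sys: "linform (sys i)"
  unfolding sys_def by (intro linform_add linform_H) simp

lemma linform_eps: "linform (eps i)"
  unfolding eps_def by (intro linform_add) simp_all

lemma linform_Q: "linform (Q i)"
  by (intro linform_perturbed linform_sys linform_eps)

lemma lc_ddpow_sys_CV: "lc ((dd d ^^ l) (sys i)) (CV i' k) = (if i = i' \<and> k = l then 1 else 0)"
proof -
  have "CV i' k \<notin> vars ((dd d ^^ l) (H i))" using vars_ddpow[OF vars_H dnext_Uvars, of l i] by auto
  then have "lc ((dd d ^^ l) (H i)) (CV i' k) = 0"
    using vars_linform[OF linform_ddpow[OF linform_H, of l i]] by blast
  then show ?thesis by (auto simp: sys_def ddpow_add ddpow_CV lc_add lc_Var)
qed

lemma lc_sys_UV: "lc (sys i) (UV j k) = (if j \<in> {1..n - 1} then coeff (G i j) k else 0)"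
  by (simp add: sys_def lc_add lc_Var H_def lc_sum lc_op_apply_Var)

lemma lc_ddpow_eps_UV: "lc ((dd d ^^ l) (eps i)) (UV j k) =
    (if i < n \<and> j = i \<and> k = eps_ord + l then 1 else 0) + (if 1 < i \<and> j = i - 1 \<and> k = l then 1 else 0)"
  by (auto simp: eps_def ddpow_add if_distrib[of "dd d ^^ l"] ddpow_UV lc_add lc_Var)

lemma lc_ddpow_eps_CV: "lc ((dd d ^^ l) (eps i)) (CV i' k) = 0"
  by (auto simp: eps_def ddpow_add if_distrib[of "dd d ^^ l"] ddpow_UV lc_add lc_Var)

lemma lc_Q: "lc (Q i) v = [:lc (sys i) v, - lc (eps i) v:]"
  by (rule lc_perturbed)

lemma linear_perturbation_eps: "linear_perturbation n eps"
  unfolding linear_perturbation_def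
proof (intro ballI)
  fix i t assume i: "i \<in> {1..n}" and t: "t \<in> Poly_Mapping.keys (eps i)"
  then obtain v where v: "t = Poly_Mapping.single v 1" using linform_eps unfolding linform_def by blast
  with t have "lc (eps i) v \<noteq> 0" by (simp add: lc_def in_keys_iff)
  then have "v \<in> Uvars n"
    using i lc_ddpow_eps_UV[of 0 i] lc_ddpow_eps_CV[of 0 i] n2
    by (cases v) (auto split: if_splits)
  with v show "\<exists>v\<in>Uvars n. t = Poly_Mapping.single v 1" by blast
qed

definition Q_ord where "Q_ord i = nat (ord_U (Q i))"

lemma lc_Q_UV: "lc (Q i) (UV j k) = [:if j \<in> {1..n - 1} then coeff (G i j) k else 0,
    - ((if i < n \<and> j = i \<and> k = eps_ord then 1 else 0) + (if 1 < i \<and> j = i - 1 \<and> k = 0 then 1 else 0)):]"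
  using lc_ddpow_eps_UV[of 0 i j k] by (simp add: lc_Q lc_sys_UV)

lemma in_vars_Q: "v \<in> vars (Q i) \<longleftrightarrow> lc (Q i) v \<noteq> 0"
  using vars_linform[OF linform_Q] by blast

lemma ord_U_Q:
  assumes i: "i \<in> {1..n}"
  shows "ord_U (Q i) = int (Q_ord i)" "\<And>j k. UV j k \<in> vars (Q i) \<Longrightarrow> k \<le> Q_ord i" "i < n \<Longrightarrow> Q_ord i = eps_ord"
proof -
  have ex: "\<exists>j k. UV j k \<in> vars (Q i)" and ex': "i < n \<Longrightarrow> UV i eps_ord \<in> vars (Q i)"
  proof -
    show eps_ord: "UV i eps_ord \<in> vars (Q i)" if "i < n"
      using that i by (auto simp: in_vars_Q lc_Q_UV)
    have "UV (n - 1) 0 \<in> vars (Q i)" if "\<not> i < n"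
      using that i n2 eps_ord_pos by (auto simp: in_vars_Q lc_Q_UV)
    then show "\<exists>j k. UV j k \<in> vars (Q i)" using eps_ord by blast
  qed
  then have pos: "ord_U (Q i) \<ge> 0" using ord_U_props(1) by (metis of_nat_0_le_iff order_trans)
  then show o: "ord_U (Q i) = int (Q_ord i)" by (simp add: Q_ord_def)
  show "k \<le> Q_ord i" if "UV j k \<in> vars (Q i)" for j k
    using ord_U_props(1)[OF that] o by simp
  have "k \<le> eps_ord" if "UV j k \<in> vars (Q i)" for j k
  proof (rule ccontr)
    assume "\<not> k \<le> eps_ord"
    then show False using that coeff_G_eps_ord[OF i, of j k] by (auto simp: in_vars_Q lc_Q_UV split: if_splits)
  qed
  then have "ord_U (Q i) \<le> int eps_ord" using ex ord_U_props(2) by blast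
  then show "Q_ord i = eps_ord" if "i < n" using o ord_U_props(1)[OF ex'[OF that]] by simp
qed

lemma coeff_op_of_Q: "coeff (op_of (Q i) j) k = lc (Q i) (UV j k)"
  by (rule coeff_op_of[OF linform_Q])

lemma gamma_up_Q:
  assumes j: "j \<in> {1..n - 1}"
  shows "gamma_up n Q j = 0"
  unfolding gamma_up_def
proof (rule Min_eqI)
  let ?S = "{ord_U (Q i) - int (degree (op_of (Q i) j)) |i. i \<in> {1..n} \<and> op_of (Q i) j \<noteq> 0}"
  have "?S \<subseteq> (\<lambda>i. ord_U (Q i) - int (degree (op_of (Q i) j))) ` {1..n}" by blast
  then show "finite ?S" by (rule finite_subset) simp
  have le: "degree (op_of (Q i) j) \<le> Q_ord i" if "i \<in> {1..n}" "op_of (Q i) j \<noteq> 0" for i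
  proof -
    have "lc (Q i) (UV j (degree (op_of (Q i) j))) \<noteq> 0"
      using that(2) by (simp flip: coeff_op_of_Q)
    then show ?thesis using ord_U_Q(2)[OF that(1)] in_vars_Q by blast
  qed
  then show "0 \<le> y" if "y \<in> ?S" for y
    using that ord_U_Q(1) by auto
  have jn: "j \<in> {1..n}" "j < n" using j n2 by auto
  have nz: "coeff (op_of (Q j) j) eps_ord \<noteq> 0" using jn by (simp add: coeff_op_of_Q lc_Q_UV)
  then have nz': "op_of (Q j) j \<noteq> 0" by auto
  have "degree (op_of (Q j) j) = Q_ord j"
    using le_degree[OF nz] le[OF jn(1) nz'] ord_U_Q(3)[OF jn] by simp
  then have "0 = ord_U (Q j) - int (degree (op_of (Q j) j))" using ord_U_Q(1)[OF jn(1)] by simp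
  then show "0 \<in> ?S" using jn(1) nz' by blast
qed

lemma gamma_lo_Q:
  assumes j: "j \<in> {1..n - 1}"
  shows "gamma_lo n Q j = 0"
  unfolding gamma_lo_def
proof (rule Min_eqI)
  let ?S = "{int (ldeg (op_of (Q i) j)) |i. i \<in> {1..n} \<and> op_of (Q i) j \<noteq> 0}"
  have "?S \<subseteq> (\<lambda>i. int (ldeg (op_of (Q i) j))) ` {1..n}" by blast
  then show "finite ?S" by (rule finite_subset) simp
  show "0 \<le> y" if "y \<in> ?S" for y using that by auto
  have jn: "Suc j \<in> {1..n}" using j n2 by auto
  have nz: "coeff (op_of (Q (Suc j)) j) 0 \<noteq> 0" using j eps_ord_pos by (auto simp: coeff_op_of_Q lc_Q_UV)
  then have "ldeg (op_of (Q (Suc j)) j) = 0" by (simp add: ldeg_def)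
  then have "0 = int (ldeg (op_of (Q (Suc j)) j))" by simp
  moreover have "op_of (Q (Suc j)) j \<noteq> 0" using nz by auto
  ultimately show "0 \<in> ?S" using jn by blast
qed

lemma gamma_Q: "gamma n Q = 0"
  unfolding gamma_def by (intro sum.neutral) (simp add: gamma_up_Q gamma_lo_Q)

definition N :: nat where "N = (n - 1) * eps_ord + Q_ord n"

lemma total_ord_Q: "total_ord n Q = int N"
proof -
  have s: "{1..n} = insert n {1..<n}" using n2 by auto
  have "total_ord n Q = (\<Sum>i=1..n. int (Q_ord i))" unfolding total_ord_def by (intro sum.cong) (simp_all add: ord_U_Q(1))
  also have "\<dots> = int (Q_ord n) + (\<Sum>i\<in>{1..<n}. int (Q_ord i))" unfolding s by simp
  also have "(\<Sum>i\<in>{1..<n}. int (Q_ord i)) = (\<Sum>i\<in>{1..<n}. int eps_ord)"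
    by (intro sum.cong) (auto simp: ord_U_Q(3))
  finally show ?thesis by (simp add: N_def)
qed

lemma eps_ord_le_N: "eps_ord \<le> N"
proof -
  obtain t where "n - 1 = Suc t" using n2 by (cases "n - 1") auto
  then show ?thesis by (simp add: N_def)
qed

lemma Q_ord_le_N: "i \<in> {1..n} \<Longrightarrow> Q_ord i \<le> N"
  using ord_U_Q(3)[of i] eps_ord_le_N by (cases "i < n") (auto simp: N_def)

lemma FRes_defined_Q: "FRes_defined n Q"
  unfolding FRes_defined_def using Q_ord_le_N by (simp add: total_ord_Q gamma_Q ord_U_Q(1))

text \<open>Pairs \<open>(i, l)\<close> in the order of \<open>ps\<close>, so that rows can be
  counted and told apart without comparing polynomials.\<close>

definition ridx :: "(nat \<times> nat) list" where
  "ridx = concat (map (\<lambda>i. map (Pair i) [0..<Suc (N - Q_ord i)]) [1..<Suc n])"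

abbreviation qrow :: "nat \<times> nat \<Rightarrow> 'a poly dpol" where
  "qrow \<equiv> \<lambda>(i, l). (dd (p_deriv d) ^^ l) (Q i)"

lemma ps_Q: "ps (p_deriv d) n Q = map qrow ridx"
proof -
  have "nat (total_ord n Q - ord_U (Q i) - gamma n Q) = N - Q_ord i" if "i \<in> set [1..<Suc n]" for i
  proof -
    have "i \<in> {1..n}" using that by auto
    then show ?thesis using Q_ord_le_N by (simp add: total_ord_Q gamma_Q ord_U_Q(1) nat_diff_distrib')
  qed
  then have "map (\<lambda>k. (dd (p_deriv d) ^^ k) (Q i)) [0..<Suc (nat (total_ord n Q - ord_U (Q i) - gamma n Q))]
    = map (\<lambda>x. qrow (i, x)) [0..<Suc (N - Q_ord i)]" if "i \<in> set [1..<Suc n]" for i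
    using that by simp
  then show ?thesis unfolding ps_def ridx_def map_concat map_map comp_def
    by (intro arg_cong[of _ _ concat]) (rule map_cong[OF refl])
qed

lemma set_ridx: "(i, l) \<in> set ridx \<longleftrightarrow> i \<in> {1..n} \<and> l \<le> N - Q_ord i"
  by (auto simp: ridx_def image_iff simp del: upt_Suc)

lemma distinct_ridx: "distinct ridx"
  unfolding ridx_def
proof (rule distinct_concat)
  show "distinct (map (\<lambda>i. map (Pair i) [0..<Suc (N - Q_ord i)]) [1..<Suc n])"
    unfolding distinct_map by (auto intro!: inj_onI simp del: upt_Suc simp: upt_conv_Cons)
qed (auto simp: distinct_map inj_on_def)

text \<open>This is the row deleted in the cofactor of \<open>a_last_nz\<close>; its order is the
  strict bound on the order of \<open>f n\<close> there.\<close>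

lemma last_ridx: "last ridx = (n, (n - 1) * eps_ord)"
proof -
  have "[1..<Suc n] = [1..<n] @ [n]" using n2 by simp
  then have "last ridx = (n, N - Q_ord n)" by (simp add: ridx_def last_map)
  then show ?thesis by (simp add: N_def)
qed

abbreviation vs where "vs \<equiv> col_vars n Q"

lemma vs_eq: "vs = concat (map (\<lambda>j. map (UV j) [0..<Suc N]) [1..<n])"
  unfolding col_vars_def
  by (intro arg_cong[of _ _ concat] map_cong) (auto simp: gamma_lo_Q gamma_up_Q gamma_Q total_ord_Q)

lemma set_vs: "set vs = {UV j k | j k. j \<in> {1..n - 1} \<and> k \<le> N}"
  unfolding vs_eq by (auto simp: image_iff simp del: upt_Suc)

text \<open>The rows number \<open>(n - 1) (N - eps_ord + 1) + (n - 1) eps_ord + 1\<close>, which is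
  one more than the \<open>(n - 1) (N + 1)\<close> variables.\<close>

lemma length_ridx: "length ridx = Suc (length vs)"
proof -
  have "length vs = (n - 1) * Suc N"
    unfolding vs_eq by (simp add: length_concat comp_def sum_list_triv)
  moreover have "length ridx = (\<Sum>i\<in>{1..<Suc n}. Suc (N - Q_ord i))"
    unfolding ridx_def by (simp add: length_concat comp_def interv_sum_list_conv_sum_set_nat del: upt_Suc)
  moreover have "{1..<Suc n} = insert n {1..<n}" using n2 by auto
  moreover have "(\<Sum>i\<in>{1..<n}. Suc (N - Q_ord i)) = (\<Sum>i\<in>{1..<n}. Suc (N - eps_ord))"
    by (intro sum.cong) (auto simp: ord_U_Q(3))
  moreover have "(n - 1) * Suc (N - eps_ord) + Suc ((n - 1) * eps_ord) = Suc ((n - 1) * Suc N)"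
  proof -
    obtain x where "N = eps_ord + x" using eps_ord_le_N le_Suc_ex by blast
    moreover have "t * Suc x + Suc (t * eps_ord) = Suc (t * Suc (eps_ord + x))" for t
      by (simp add: algebra_simps)
    ultimately show ?thesis by simp
  qed
  moreover have "N - Q_ord n = (n - 1) * eps_ord" by (simp add: N_def)
  ultimately show ?thesis using n2 by simp
qed

lemma linform_qrow: "linform (qrow r)"
proof (cases r)
  case (Pair i l)
  then show ?thesis using diff_ring.linform_ddpow[OF diff_ring_p_deriv linform_Q] by simp
qed

text \<open>As the parameter is a constant, differentiation keeps the rows of degree at most 1 in it
  and acts on both parts separately.\<close>

lemma lc_qrow: "lc (qrow (i, l)) v = [:lc ((dd d ^^ l) (sys i)) v, - lc ((dd d ^^ l) (eps i)) v:]"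
proof (induction l arbitrary: v)
  case (Suc l)
  let ?q = "qrow (i, l)" and ?s = "(dd d ^^ l) (sys i)" and ?e = "(dd d ^^ l) (eps i)"
  have lin: "linform ?q" "linform ?s" "linform ?e"
    by (rule linform_qrow linform_ddpow[OF linform_sys] linform_ddpow[OF linform_eps])+
  have pd: "p_deriv d [:x, - y:] = [:d x, - d y:]" for x y
    by (rule poly_eqI) (simp add: coeff_p_deriv coeff_pCons d_uminus split: nat.split)
  have q: "qrow (i, Suc l) = dd (p_deriv d) ?q" by simp
  show ?case
  proof (cases "\<exists>w. v = dnext w")
    case True
    then obtain w where v: "v = dnext w" by blast
    show ?thesis unfolding q v diff_ring.lc_dd(1)[OF diff_ring_p_deriv lin(1)]
      by (simp only: Suc pd funpow.simps comp_apply lc_dd(1)[OF lin(2)] lc_dd(1)[OF lin(3)]) simp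
  next
    case False
    then have v: "\<And>w. v \<noteq> dnext w" by blast
    show ?thesis unfolding q diff_ring.lc_dd(2)[OF diff_ring_p_deriv lin(1) v]
      by (simp only: Suc pd funpow.simps comp_apply lc_dd(2)[OF lin(2) v] lc_dd(2)[OF lin(3) v])
  qed
qed (simp add: lc_Q)

lemma lc_qrow_CV: "lc (qrow r) (CV i k) = (if r = (i, k) then 1 else 0)"
  by (cases r) (auto simp: lc_qrow[unfolded split_conv] lc_ddpow_sys_CV lc_ddpow_eps_CV one_pCons)

lemma lc_qrow_outside:
  assumes i: "i \<in> {1..n}"
  shows "k > Q_ord i + l \<or> j \<notin> {1..n - 1} \<Longrightarrow> lc (qrow (i, l)) (UV j k) = 0"
proof (induction l arbitrary: k)
  case 0
  have "lc (Q i) (UV j k) = 0" if "k > Q_ord i" using ord_U_Q(2)[OF i, of j k] that in_vars_Q by force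
  moreover have "lc (Q i) (UV j k) = 0" if "j \<notin> {1..n - 1}" using that i n2 by (auto simp: lc_Q_UV)
  ultimately show ?case using 0 by auto
next
  case (Suc l)
  have q: "qrow (i, Suc l) = dd (p_deriv d) (qrow (i, l))" by simp
  have p0: "p_deriv d 0 = 0" by (simp add: p_deriv_def)
  show ?case
  proof (cases k)
    case 0
    have "lc (qrow (i, Suc l)) (UV j 0) = p_deriv d (lc (qrow (i, l)) (UV j 0))"
      unfolding q
    proof (rule diff_ring.lc_dd(2)[OF diff_ring_p_deriv linform_qrow])
      show "UV j 0 \<noteq> dnext w" for w by (cases w) auto
    qed
    moreover have "lc (qrow (i, l)) (UV j 0) = 0" using Suc 0 by simp
    ultimately show ?thesis using 0 p0 by simp
  next
    case (Suc k')
    have "lc (qrow (i, Suc l)) (UV j k) = p_deriv d (lc (qrow (i, l)) (UV j k)) + lc (qrow (i, l)) (UV j k')"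
      unfolding q Suc using diff_ring.lc_dd(1)[OF diff_ring_p_deriv linform_qrow, of "(i, l)" "UV j k'"] by simp
    moreover have "lc (qrow (i, l)) (UV j k) = 0" "lc (qrow (i, l)) (UV j k') = 0"
      using Suc.IH[of k] Suc.IH[of k'] Suc.prems Suc by auto
    ultimately show ?thesis using p0 by simp
  qed
qed

section \<open>The determinant as a combination of the rows\<close>

definition a :: "nat \<Rightarrow> 'a poly" where
  "a r = last_cofactor (map qrow ridx) vs r"

text \<open>For the listed variables this is the cofactor relation. The others occur in no row,
  since \<open>Q_ord i + l \<le> N\<close> for every row \<open>(i, l)\<close>.\<close>

lemma sum_a_UV: "(\<Sum>r<length ridx. a r * lc (qrow (ridx ! r)) (UV j k)) = 0"
proof (cases "j \<in> {1..n - 1} \<and> k \<le> N")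
  case True
  then have "UV j k \<in> set vs" by (auto simp: set_vs)
  then obtain s where s: "s < length vs" "vs ! s = UV j k" by (metis in_set_conv_nth)
  have "(\<Sum>r<length (map qrow ridx). last_cofactor (map qrow ridx) vs r * lc (map qrow ridx ! r) (vs ! s)) = 0"
    using s(1) by (intro last_cofactor_column) (simp_all add: length_ridx)
  then show ?thesis unfolding s(2) length_map by (simp only: a_def nth_map cong: sum.cong) (simp add: lessThan_def)
next
  case False
  have "lc (qrow (ridx ! r)) (UV j k) = 0" if "r < length ridx" for r
  proof -
    obtain i l where il: "ridx ! r = (i, l)" by force
    then have "(i, l) \<in> set ridx" using that nth_mem by fastforce
    then have i: "i \<in> {1..n}" "l \<le> N - Q_ord i" by (simp_all add: set_ridx)
    then have "Q_ord i + l \<le> N" using Q_ord_le_N[OF i(1)] by simp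
    then show ?thesis unfolding il using False by (intro lc_qrow_outside[OF i(1)]) auto
  qed
  then show ?thesis by (intro sum.neutral) simp
qed

abbreviation Fr where "Fr \<equiv> FRes (p_deriv d) n Q"

lemma Fr_eq: "Fr = (\<Sum>r<length ridx. Const (a r) * coeff_in (set vs) 0 (qrow (ridx ! r)))"
proof -
  have "Fr = (\<Sum>r<length (map qrow ridx). Const (last_cofactor (map qrow ridx) vs r) * coeff_in (set vs) 0 (map qrow ridx ! r))"
    unfolding FRes_def FMat_def Let_def ps_Q
  proof (rule det_coeff_matrix)
    show "linform f" if "f \<in> set (map qrow ridx)" for f
      using that linform_qrow by auto
  qed (simp add: length_ridx)
  then show ?thesis by (simp add: a_def)
qed

lemma linform_Fr: "linform Fr"
  unfolding Fr_eq by (intro linform_sum linform_Const_mult linform_coeff_in_0 linform_qrow)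

text \<open>The last column omits the terms in \<open>vs\<close>, but by \<open>sum_a_UV\<close>
  these cancel; so the determinant is the combination of the full rows.\<close>

lemma lc_Fr: "lc Fr v = (\<Sum>r<length ridx. a r * lc (qrow (ridx ! r)) v)"
proof (cases v)
  case (CV i k)
  then have "v \<notin> set vs" by (auto simp: set_vs)
  then show ?thesis by (simp add: Fr_eq lc_sum lc_Const_mult lc_coeff_in_0)
next
  case (UV j k)
  have "lc Fr v = (\<Sum>r<length ridx. if v \<in> set vs then 0 else a r * lc (qrow (ridx ! r)) v)"
    by (simp add: Fr_eq lc_sum lc_Const_mult lc_coeff_in_0 if_distrib cong: if_cong)
  then show ?thesis using sum_a_UV[of j k] unfolding UV by (cases "UV j k \<in> set vs") simp_all
qed

lemma lc_Fr_UV: "lc Fr (UV j k) = 0"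
  unfolding lc_Fr by (rule sum_a_UV)

lemma sum_ridx:
  assumes "r < length ridx"
  shows "(\<Sum>r'<length ridx. if ridx ! r' = ridx ! r then f r' else 0) = f r"
proof -
  have "(\<Sum>r'<length ridx. if ridx ! r' = ridx ! r then f r' else 0) = (\<Sum>r'<length ridx. if r' = r then f r' else 0)"
    using assms distinct_ridx by (intro sum.cong) (auto simp: nth_eq_iff_index_eq)
  then show ?thesis using assms by simp
qed

text \<open>The variable \<open>CV i k\<close> occurs in row \<open>(i, k)\<close> only, with
  coefficient 1; this makes the cofactors visible in the determinant.\<close>

lemma lc_Fr_CV:
  assumes "r < length ridx" "ridx ! r = (i, k)"
  shows "lc Fr (CV i k) = a r"
proof -
  have "lc Fr (CV i k) = (\<Sum>r'<length ridx. if ridx ! r' = ridx ! r then a r' else 0)"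
    unfolding lc_Fr lc_qrow_CV mult_delta assms(2) ..
  then show ?thesis using sum_ridx[OF assms(1)] by simp
qed

text \<open>If the cofactor vanished, the highest coefficient in the parameter of a row relation would give
  operators \<open>f\<^sub>i\<close> with constant coefficients such that \<open>f\<^sub>j \<partial>\<^bsup>eps_ord\<^esup> + f\<^bsub>j+1\<^esub> = 0\<close>. As
  \<open>f\<^sub>n\<close> has order below \<open>(n - 1) eps_ord\<close>, all of them vanish.\<close>

lemma a_last_nz: "a (length vs) \<noteq> 0"
proof
  assume "a (length vs) = 0"
  then obtain w where w: "\<exists>r<length vs. w r \<noteq> 0"
    and ws: "\<And>s. s < length vs \<Longrightarrow> (\<Sum>r<length vs. w r * lc (map qrow ridx ! r) (vs ! s)) = 0"
    using last_cofactor_eq_0[of "map qrow ridx" vs] length_ridx unfolding a_def by auto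
  let ?T = "length vs"
  \<comment> \<open>\<open>E\<close> is the largest degree in the parameter among the multipliers
    \<open>w r\<close>. In degree \<open>E + 1\<close> the unperturbed part of the rows cannot
    contribute, which leaves a relation for \<open>eps\<close>.\<close>
  define E where "E = Max ((\<lambda>r. degree (w r)) ` {r. r < ?T \<and> w r \<noteq> 0})"
  have fin: "finite ((\<lambda>r. degree (w r)) ` {r. r < ?T \<and> w r \<noteq> 0})" by simp
  have "E \<in> (\<lambda>r. degree (w r)) ` {r. r < ?T \<and> w r \<noteq> 0}"
    unfolding E_def using w by (intro Max_in fin) blast
  then obtain r0 where r0: "r0 < ?T" "coeff (w r0) E \<noteq> 0" by auto
  have wE: "coeff (w r) (Suc E) = 0" if "r < ?T" for r
  proof (cases "w r = 0")
    case False
    then have "degree (w r) \<le> E" unfolding E_def using that by (intro Max_ge fin) blast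
    then show ?thesis by (intro coeff_eq_0) simp
  qed simp
  \<comment> \<open>\<open>f i l\<close> is the coefficient of order \<open>l\<close> in the
    operator \<open>f_i\<close>, with value 0 for pairs that index no row.\<close>
  define f where "f i l = (\<Sum>r<?T. if ridx ! r = (i, l) then coeff (w r) E else 0)" for i l
  have f0: "f i l = 0" if "(i, l) \<notin> set ridx" for i l
    unfolding f_def
  proof (intro sum.neutral ballI)
    fix r assume "r \<in> {..<?T}"
    then have "ridx ! r \<in> set ridx" using length_ridx by simp
    then show "(if ridx ! r = (i, l) then coeff (w r) E else 0) = 0" using that by auto
  qed
  have rel: "(if k \<ge> eps_ord then f j (k - eps_ord) else 0) + f (Suc j) k = 0" if j: "j \<in> {1..n - 1}" for j k
  proof (cases "k \<le> N")
    case True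
    then have "UV j k \<in> set vs" using j by (auto simp: set_vs)
    then obtain s where s: "s < ?T" "vs ! s = UV j k" by (metis in_set_conv_nth)
    have "0 = coeff (\<Sum>r<?T. w r * lc (map qrow ridx ! r) (vs ! s)) (Suc E)" using ws[OF s(1)] by simp
    also have "\<dots> = (\<Sum>r<?T. - ((if k \<ge> eps_ord then if ridx ! r = (j, k - eps_ord) then coeff (w r) E else 0 else 0) +
        (if ridx ! r = (Suc j, k) then coeff (w r) E else 0)))"
      unfolding coeff_sum
    proof (rule sum.cong)
      fix r assume "r \<in> {..<?T}"
      then have r: "r < ?T" "r < length ridx" using length_ridx by simp_all
      obtain i l where il: "ridx ! r = (i, l)" by force
      then have i: "i \<in> {1..n}" using nth_mem[OF r(2)] by (simp add: set_ridx)
      have "coeff (w r * [:x, y:]) (Suc E) = coeff (w r) E * y" for x y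
        using wE[OF r(1)] by (simp add: mult_pCons_right)
      then have "coeff (w r * lc (map qrow ridx ! r) (vs ! s)) (Suc E) =
          - (coeff (w r) E * lc ((dd d ^^ l) (eps i)) (UV j k))"
        using r by (simp add: il s(2) lc_qrow[unfolded split_conv])
      also have "\<dots> = - ((if k \<ge> eps_ord then if (i, l) = (j, k - eps_ord) then coeff (w r) E else 0 else 0) +
        (if (i, l) = (Suc j, k) then coeff (w r) E else 0))"
      proof -
        have c1: "i < n \<and> j = i \<and> k = eps_ord + l \<longleftrightarrow> k \<ge> eps_ord \<and> (i, l) = (j, k - eps_ord)"
          using j by auto
        have c2: "1 < i \<and> j = i - 1 \<and> k = l \<longleftrightarrow> (i, l) = (Suc j, k)"
          using j by auto
        show ?thesis unfolding lc_ddpow_eps_UV c1 c2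
          by (cases "k \<ge> eps_ord") (simp_all del: Pair_inject prod.inject)
      qed
      finally show "coeff (w r * lc (map qrow ridx ! r) (vs ! s)) (Suc E) =
          - ((if k \<ge> eps_ord then if ridx ! r = (j, k - eps_ord) then coeff (w r) E else 0 else 0) +
        (if ridx ! r = (Suc j, k) then coeff (w r) E else 0))" unfolding il .
    qed simp
    also have "\<dots> = - ((if k \<ge> eps_ord then f j (k - eps_ord) else 0) + f (Suc j) k)"
      unfolding sum_negf sum.distrib f_def by (cases "k \<ge> eps_ord") simp_all
    finally show ?thesis by (simp add: neg_eq_iff_add_eq_0)
  next
    case False
    have "Q_ord j = eps_ord" using j n2 by (intro ord_U_Q(3)) auto
    moreover have "\<not> k - eps_ord \<le> N - eps_ord" if "k \<ge> eps_ord" using False that eps_ord_le_N by arith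
    ultimately have "f j (k - eps_ord) = 0" if "k \<ge> eps_ord" using that by (intro f0) (simp add: set_ridx)
    moreover have "f (Suc j) k = 0" using False by (intro f0) (auto simp: set_ridx)
    ultimately show ?thesis by simp
  qed
  \<comment> \<open>Order \<open>(n - 1) * eps_ord\<close> belongs to the last row, which is absent
    from the relation; higher orders index no row.\<close>
  have top: "f n l = 0" if "l \<ge> (n - 1) * eps_ord" for l
  proof (cases "l = (n - 1) * eps_ord")
    case True
    have lst: "ridx ! ?T = (n, (n - 1) * eps_ord)"
      using last_ridx length_ridx last_conv_nth[of ridx] by (cases "ridx = []") auto
    show ?thesis unfolding f_def
    proof (intro sum.neutral ballI)
      fix r assume "r \<in> {..<?T}"
      then have "ridx ! r \<noteq> ridx ! ?T" using distinct_ridx length_ridx by (simp add: nth_eq_iff_index_eq)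
      then show "(if ridx ! r = (n, l) then coeff (w r) E else 0) = 0" using True lst by simp
    qed
  next
    case False
    then show ?thesis using that by (intro f0) (auto simp: set_ridx N_def)
  qed
  \<comment> \<open>Used at order \<open>k + eps_ord\<close>, each relation lowers the bound on the
    order by \<open>eps_ord\<close>; after \<open>n - 1\<close> steps it reaches 0, so
    \<open>f 1\<close> vanishes.\<close>
  have down: "\<forall>k\<ge>(n - 1 - t) * eps_ord. f (n - t) k = 0" if "t \<le> n - 1" for t
    using that
  proof (induction t)
    case 0
    then show ?case using top by simp
  next
    case (Suc t)
    let ?j = "n - Suc t"
    have j: "?j \<in> {1..n - 1}" "Suc ?j = n - t" using Suc.prems n2 by auto
    have t: "n - 1 - t = Suc (n - 1 - Suc t)" using Suc.prems by simp
    show ?case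
    proof (intro allI impI)
      fix k assume k: "k \<ge> (n - 1 - Suc t) * eps_ord"
      then have "(n - 1 - t) * eps_ord \<le> k + eps_ord" unfolding t by simp
      then have "f (n - t) (k + eps_ord) = 0" using Suc by simp
      then show "f ?j k = 0" using rel[OF j(1), of "k + eps_ord"] j(2) by simp
    qed
  qed
  have f1: "f 1 k = 0" for k using down[of "n - 1"] n2 by simp
  \<comment> \<open>Conversely, the relations express \<open>f (Suc j)\<close> through
    \<open>f j\<close>, so the vanishing of \<open>f 1\<close> spreads to all operators.\<close>
  have all: "f (Suc j) k = 0" if "j \<le> n - 1" for j k
    using that
  proof (induction j arbitrary: k)
    case 0 then show ?case using f1 by simp
  next
    case (Suc j)
    then show ?case using rel[of "Suc j" k] by (simp split: if_splits)
  qed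
  obtain i l where il: "ridx ! r0 = (i, l)" by force
  then have i: "i \<in> {1..n}" using nth_mem[of r0 ridx] r0(1) length_ridx by (simp add: set_ridx)
  have "f i l = (\<Sum>r<?T. if r = r0 then coeff (w r) E else 0)"
    unfolding f_def il[symmetric] using r0(1) distinct_ridx length_ridx
    by (intro sum.cong) (auto simp: nth_eq_iff_index_eq)
  then have "f i l = coeff (w r0) E" using r0(1) by simp
  moreover have "f i l = 0" using all[of "i - 1" l] i by (simp add: diff_le_mono)
  ultimately show False using r0(2) by simp
qed

lemma Fr_nz: "Fr \<noteq> 0"
proof
  assume z: "Fr = 0"
  obtain i k where ik: "ridx ! length vs = (i, k)" by force
  have "lc Fr (CV i k) = a (length vs)" using ik length_ridx by (intro lc_Fr_CV) simp_all
  then show False using a_last_nz z by simp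
qed

text \<open>All cofactors are divisible by the lowest power of the parameter in the determinant. At
  that power the perturbed part drops out, and a combination of derivatives of the unperturbed
  system remains.\<close>

lemma lowest_p_coeff_Fr:
  "lowest_p_coeff Fr \<noteq> 0" "linform (lowest_p_coeff Fr)" "lowest_p_coeff Fr \<in> ID d n sys"
proof -
  define e where "e = (LEAST e. p_coeff e Fr \<noteq> 0)"
  have B: "lowest_p_coeff Fr = p_coeff e Fr" by (simp add: lowest_p_coeff_def e_def)
  have "\<exists>e. p_coeff e Fr \<noteq> 0"
  proof -
    obtain t where "Poly_Mapping.lookup Fr t \<noteq> 0" using Fr_nz by (metis poly_mapping_eqI lookup_zero)
    then obtain e where "coeff (Poly_Mapping.lookup Fr t) e \<noteq> 0" by (metis poly_eqI coeff_0)
    then have "Poly_Mapping.lookup (p_coeff e Fr) t \<noteq> 0" by (simp add: lookup_p_coeff)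
    then have "p_coeff e Fr \<noteq> 0" by auto
    then show ?thesis ..
  qed
  then have e: "p_coeff e Fr \<noteq> 0" unfolding e_def by (rule LeastI_ex)
  have least: "p_coeff e' Fr = 0" if "e' < e" for e'
    using not_less_Least[of e' "\<lambda>e. p_coeff e Fr \<noteq> 0"] that by (auto simp: e_def)
  show "lowest_p_coeff Fr \<noteq> 0" using e B by simp
  show lin: "linform (lowest_p_coeff Fr)" unfolding B by (rule linform_p_coeff[OF linform_Fr])
  \<comment> \<open>The cofactors are themselves coefficients of the determinant, so the minimality
    of \<open>e\<close> applies to each of them.\<close>
  have a0: "coeff (a r) e' = 0" if "r < length ridx" "e' < e" for r e'
  proof -
    obtain i k where "ridx ! r = (i, k)" by force
    then have "lc (p_coeff e' Fr) (CV i k) = coeff (a r) e'" using lc_Fr_CV that(1) by (simp add: lc_p_coeff)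
    then show ?thesis using least[OF that(2)] by simp
  qed
  let ?srow = "\<lambda>(i, l). (dd d ^^ l) (sys i)"
  have Beq: "p_coeff e Fr = (\<Sum>r<length ridx. Const (coeff (a r) e) * ?srow (ridx ! r))"
  proof (rule linform_eqI)
    show "linform (\<Sum>r<length ridx. Const (coeff (a r) e) * ?srow (ridx ! r))"
      by (intro linform_sum linform_Const_mult) (auto intro: linform_ddpow linform_sys split: prod.split)
    fix v
    have "lc (p_coeff e Fr) v = (\<Sum>r<length ridx. coeff (a r * lc (qrow (ridx ! r)) v) e)"
      by (simp add: lc_p_coeff lc_Fr coeff_sum)
    also have "\<dots> = (\<Sum>r<length ridx. coeff (a r) e * lc (?srow (ridx ! r)) v)"
    proof (rule sum.cong)
      fix r assume "r \<in> {..<length ridx}"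
      then have r: "r < length ridx" by simp
      obtain i l where il: "ridx ! r = (i, l)" by force
      have *: "coeff (a r * [:x, y:]) e = coeff (a r) e * x" for x y
        using a0[OF r] by (cases e) (simp_all add: mult_pCons_right)
      show "coeff (a r * lc (qrow (ridx ! r)) v) e = coeff (a r) e * lc (?srow (ridx ! r)) v"
        unfolding il split_conv lc_qrow[unfolded split_conv] by (rule *)
    qed simp
    finally show "lc (p_coeff e Fr) v = lc (\<Sum>r<length ridx. Const (coeff (a r) e) * ?srow (ridx ! r)) v"
      by (simp add: lc_sum lc_Const_mult)
  qed (rule linform_p_coeff[OF linform_Fr])
  have "p_coeff e Fr \<in> diff_ideal_gen d (ring_DU n) (sys ` {1..n})"
    unfolding Beq
  proof (intro diff_ideal_gen_sum diff_ideal_gen_closed(3))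
    fix r assume "r \<in> {..<length ridx}"
    then have r: "ridx ! r \<in> set ridx" by simp
    obtain i l where il: "ridx ! r = (i, l)" by force
    with r have i: "i \<in> {1..n}" by (simp add: set_ridx)
    have "(dd d ^^ l) (sys i) \<in> diff_ideal_gen d (ring_DU n) (sys ` {1..n})"
      by (rule diff_ideal_gen_ddpow, rule diff_ideal_gen_closed(5)) (use i in blast)
    then show "?srow (ridx ! r) \<in> diff_ideal_gen d (ring_DU n) (sys ` {1..n})" by (simp add: il)
  qed (simp add: ring_DU_def)
  moreover have "p_coeff e Fr \<in> ring_D n"
  proof -
    have "v \<in> Cvars n" if "v \<in> vars (p_coeff e Fr)" for v
    proof -
      have "lc (p_coeff e Fr) v \<noteq> 0" using that vars_linform[OF linform_p_coeff[OF linform_Fr]] by blast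
      then have nz: "lc Fr v \<noteq> 0" by (auto simp: lc_p_coeff)
      then obtain i k where v: "v = CV i k" using lc_Fr_UV by (cases v) auto
      have "\<exists>r<length ridx. ridx ! r = (i, k)"
      proof (rule ccontr)
        assume "\<not> ?thesis"
        then have "lc Fr v = 0" unfolding lc_Fr v lc_qrow_CV by (intro sum.neutral) auto
        then show False using nz by simp
      qed
      then have "(i, k) \<in> set ridx" by (metis nth_mem)
      then show ?thesis using v by (simp add: set_ridx)
    qed
    then show ?thesis by (auto simp: ring_D_def)
  qed
  ultimately show "lowest_p_coeff Fr \<in> ID d n sys" by (simp add: B ID_def)
qed

end

section \<open>The theorem for generic super essential systems\<close>

theorem proposition6p8:
  fixes d :: "'k::field_char_0 \<Rightarrow> 'k"
    and n :: nat
    and S :: "nat \<Rightarrow> nat \<Rightarrow> nat set"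
    and c :: "nat \<times> nat \<times> nat \<Rightarrow> 'k"
    and lt :: "dvar \<Rightarrow> dvar \<Rightarrow> bool"
  defines "P \<equiv> gen_sys d n S c"
  assumes n: "n \<ge> 2"
    and S: "\<And>i j. i \<in> {1..n} \<Longrightarrow> j \<in> {1..n - 1} \<Longrightarrow> finite (S i j)"
    and d: "derivation d"
    and indet: "diff_indeterminates d (coeff_index n S) c"
    and gen: "diff_field_generated d (c ` coeff_index n S)"
    and P1: "\<And>i. i \<in> {1..n} \<Longrightarrow> ord_U (P i) \<ge> 0"
    and P4: "\<And>j. j \<in> {1..n - 1} \<Longrightarrow> \<exists>i\<in>{1..n}. gen_op S c i j \<noteq> 0"
    and super: "super_essential n (gen_op S c)"
    and lt: "ranking n lt"
  shows "(\<exists>R. is_dRes d n lt P R) \<and>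
    (\<exists>\<epsilon>. linear_perturbation n \<epsilon> \<and>
         FRes_defined n (perturbed P \<epsilon>) \<and>
         FRes (p_deriv d) n (perturbed P \<epsilon>) \<noteq> 0 \<and>
         (\<exists>A. is_A_eps d n P \<epsilon> A) \<and>
         (\<forall>R A. is_dRes d n lt P R \<longrightarrow> is_A_eps d n P \<epsilon> A \<longrightarrow>
            (\<exists>\<alpha>. \<alpha> \<noteq> 0 \<and> Const \<alpha> * R = A)))"
proof -
  interpret diff_field d by unfold_locales (rule d)
  interpret perturbed_system d n "gen_op S c" by unfold_locales (rule n)
  have P: "P = sys"
    by (rule ext) (simp add: P_def gen_sys_def sys_def H_def)
  \<comment> \<open>The instance \<open>i = n\<close> matches the first \<open>n - 1\<close> rows
    with the columns, as \<open>generic_rows_independent\<close> requires.\<close>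
  have "n \<in> {1..n}" using n by simp
  then obtain \<tau> where \<tau>: "\<tau> permutes {1..n - 1}" "\<forall>j\<in>{1..n - 1}. gen_op S c j (\<tau> (n - j)) \<noteq> 0"
    using super unfolding super_essential_def by blast
  define \<sigma> where "\<sigma> j = \<tau> (n - j)" for j
  have \<sigma>: "inj_on \<sigma> {1..n - 1}"
  proof (rule inj_onI)
    fix i j assume "i \<in> {1..n - 1}" "j \<in> {1..n - 1}" "\<sigma> i = \<sigma> j"
    then have "n - i = n - j" using permutes_inj[OF \<tau>(1)] by (auto simp: \<sigma>_def dest: injD)
    then show "i = j" using \<open>i \<in> {1..n - 1}\<close> \<open>j \<in> {1..n - 1}\<close> by auto
  qed
  have \<sigma>': "\<sigma> i \<in> {1..n - 1}" if "i \<in> {1..n - 1}" for i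
    using that unfolding \<sigma>_def permutes_in_image[OF \<tau>(1)] by auto
  have indep: "\<forall>i\<in>{1..n}. F i = 0" if F: "syz F" "F n = 0" for F
  proof -
    have s: "{1..n} = insert n {1..n - 1}" "n \<notin> {1..n - 1}" using n by auto
    have "(\<Sum>i=1..n - 1. op_mult d (F i) (gen_op S c i j)) = 0" if "j \<in> {1..n - 1}" for j
      using F that unfolding syz_def s(1) sum.insert[OF finite_atLeastAtMost s(2)] by simp
    then have "\<forall>i\<in>{1..n - 1}. F i = 0"
      using \<tau>(2) by (intro generic_rows_independent[OF S indet \<sigma> \<sigma>']) (auto simp: \<sigma>_def)
    then show ?thesis using F(2) unfolding s(1) by blast
  qed
  \<comment> \<open>The perturbation also supplies the nonzero syzygy from which a generator is
    obtained: the lowest coefficient of its determinant is a nonzero linear element of the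
    ideal.\<close>
  obtain F where F: "lowest_p_coeff Fr = cform F"
    using linform_eq_cform lowest_p_coeff_Fr(2,3) mem_ID_iff by blast
  then have "syz F" "\<exists>i\<in>{1..n}. F i \<noteq> 0"
    using lowest_p_coeff_Fr(1,3) by (auto simp: mem_ID_iff phi_cform_eq_0 cform_eq_0_iff)
  from syz_generator[OF indep this]
  obtain L where L: "syz L" "\<exists>i\<in>{1..n}. L i \<noteq> 0" "\<And>F. syz F \<Longrightarrow> \<exists>E. \<forall>i\<in>{1..n}. F i = op_mult d E (L i)"
    by blast
  interpret sg: syz_generated d n "gen_op S c" L
    by unfold_locales (rule L; assumption)+
  have "\<exists>\<alpha>. \<alpha> \<noteq> 0 \<and> Const \<alpha> * R = A'" if R: "is_dRes d n lt sys R" and A': "is_A_eps d n sys eps A'" for R A'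
  proof -
    obtain \<alpha> where \<alpha>: "\<alpha> \<noteq> 0" "Const \<alpha> * R = sg.A" using sg.dRes_unique[OF lt R] by blast
    obtain \<beta> where \<beta>: "\<beta> \<noteq> 0" "A' = Const \<beta> * sg.A"
      using sg.primitive_part_unique A' unfolding is_A_eps_def by blast
    have "Const (\<beta> * \<alpha>) * R = A'" by (simp add: \<beta>(2) Const_mult mult.assoc flip: \<alpha>(2))
    then show ?thesis using \<alpha>(1) \<beta>(1) by (intro exI[of _ "\<beta> * \<alpha>"]) simp
  qed
  moreover have "is_A_eps d n sys eps sg.A"
    unfolding is_A_eps_def by (intro sg.primitive_part_exists lowest_p_coeff_Fr)
  ultimately show ?thesis
    unfolding P using sg.is_dRes_A[OF lt] linear_perturbation_eps FRes_defined_Q Fr_nz by blast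
qed

end
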